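(* Assume the standing assumptions in the context, and let $f\in AC([T,x_0))$. The following properties are equivalent: (i) the finite limit $\gamma:=\lim_{x\to x_0}F^*(x)$ exists; (ii) the finite limit $a_2:=\lim_{x\to x_0}f_2^*(x)$ exists; (iii) both finite limits $a_1:=\lim_{x\to x_0}f_1^*(x)$ and $a_2:=\lim_{x\to x_0}f_2^*(x)$ exist; (iv) there are real numbers $a_1,a_2$ such that, as $x\to x_0$, $$f(x)=a_1\phi_1(x)+a_2\phi_2(x)+o(\phi_2(x)),\qquad \Big(\frac{f(x)}{\phi_1(x)}\Big)'=a_2\Big(\frac{\phi_2(x)}{\phi_1(x)}\Big)'+o\Big(\Big(\frac{\phi_2(x)}{\phi_1(x)}\Big)'\Big);$$ (v) there are real numbers $a_1,a_2$ such that, as $x\to x_0$, $$f(x)=a_1\phi_1(x)+a_2\phi_2(x)+o(\phi_2(x)),\qquad \Big(\frac{f(x)}{\phi_2(x)}\Big)'=a_1\Big(\frac{\phi_1(x)}{\phi_2(x)}\Big)'+o\Big(\frac{\phi_2(x)}{\phi_1(x)}\Big(\frac{\phi_1(x)}{\phi_2(x)}\Big)'\Big);$$ (vi) there are real numbers $a_1,a_2$ and a function $\overline F$, Lebesgue-summable on every compact subinterval of $I$, with $\overline F(x)=o(1)$ as $x\to x_0$ and $$f(x)=a_1\phi_1(x)+a_2\phi_2(x)-\Phi(x)\int_x^{x_0}W(t)\Phi(t)^{-2}\,\overline F(t)\,dt,\qquad x\in(T,x_0);$$ (vii) there are real numbers $a_1,a_2$ and a function $\overline f_2$, Lebesgue-summable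 on every compact subinterval of $I$, with $\overline f_2(x)=o(1)$ as $x\to x_0$ and $$f(x)=a_1\phi_1(x)+a_2\phi_2(x)-\phi_1(x)\int_x^{x_0}\Big(\frac{\phi_2(t)}{\phi_1(t)}\Big)'\,\overline f_2(t)\,dt,\qquad x\in[T,x_0).$$ Moreover, when these properties hold: the constants $a_1,a_2$ appearing in (iii)–(vii) are the same, namely $a_1=\lim_{x\to x_0}f_1^*(x)$, $a_2=\lim_{x\to x_0}f_2^*(x)$; consequently the coefficients of the contact curves $y=f_1^*(\xi)\phi_1(x)+f_2^*(\xi)\phi_2(x)$ converge, as $\xi\to x_0$, to those of $y=a_1\phi_1(x)+a_2\phi_2(x)$; $\gamma=a_1\phi_1(T)+a_2\phi_2(T)$; in (vi) necessarily $\overline F=F^*-\gamma$ a.e. on $I$, and in (vii) necessarily $\overline f_2=f_2^*-a_2$ a.e. on $I$; the limits $$\lim_{x\to x_0}\frac{\phi_1(x)}{\phi_2(x)}\int_x^{x_0}\Big(\frac{\phi_2(t)}{\phi_1(t)}\Big)'f_2^*(t)\,dt=-a_2,\qquad \lim_{x\to x_0}\frac{\Phi(x)}{\phi_2(x)}\int_x^{x_0}W(t)\Phi(t)^{-2}F^*(t)\,dt=-\frac{\gamma}{\phi_2(T)}$$ exist; and the representations $$f(x)=a_1\phi_1(x)+a_2\phi_2(x)-\phi_1(x)\int_x^{x_0}\Big(\frac{\phi_2(t)}{\phi_1(t)}\Big)'[f_2^*(t)-a_2]\,dt,\quad x\in[T,x_0),$$ $$f(x)=a_1\phi_1(x)+a_2\phi_2(x)-\Phi(x)\int_x^{x_0}W(t)\Phi(t)^{-2}[F^*(t)-\gamma]\,dt,\quad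 x\in(T,x_0),$$ hold.
   Context: Let $x_0\in\mathbb{R}\cup\{+\infty\}$, $T\in\mathbb{R}$ with $T<x_0$, and $I:=[T,x_0)$. All limits and asymptotic relations "as $x\to x_0$" are taken for $x\in I$ (left-sided); for functions defined only almost everywhere (e.g. those involving $f'$ for $f$ absolutely continuous), limits are taken over the points where they are defined. For differentiable $g,h$ put $W(g,h;x):=g(x)h'(x)-g'(x)h(x)$. Standing assumptions on the comparison functions $\phi_1,\phi_2:I\to\mathbb{R}$: $\phi_1,\phi_2\in C^1(I)$; $\phi_2(x)=o(\phi_1(x))$ as $x\to x_0$; $\phi_1(x)\ne0$ and $\phi_2(x)\neq0$ for all $x\in I$; $W(x):=W(\phi_1,\phi_2;x)\ne 0$ for all $x\in I$. $AC([T,x_0))$ denotes the functions absolutely continuous on every compact subinterval of $I$. For such $f$ and every $t\in I$ at which $f$ is differentiable define $f_1^*(t):=W(f,\phi_2;t)/W(t)$, $f_2^*(t):=-W(f,\phi_1;t)/W(t)$ (so $f_1^*=(f/\phi_2)'/(\phi_1/\phi_2)'$, $f_2^*=(f/\phi_1)'/(\phi_2/\phi_1)'$, and $f_1^*(t)\phi_1+f_2^*(t)\phi_2$ is the unique element of $\mathrm{span}(\phi_1,\phi_2)$ having first-order contact with $f$ at $t$). Put $\Phi(x):=\phi_2(T)\phi_1(x)-\phi_1(T)\phi_2(x)$ and $F^*(t):=\phi_1(T)f_1^*(t)+\phi_2(T)f_2^*(t)=W(\Phi,f;t)/W(t)$. *)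

theory Defs
  imports "HOL-Analysis.Analysis" "HOL-Library.Landau_Symbols"
begin

definition Ival :: "real \<Rightarrow> ereal \<Rightarrow> real set" where
  "Ival T x0 = {t. T \<le> t \<and> ereal t < x0}"

definition left_filter :: "ereal \<Rightarrow> real filter" where
  "left_filter x0 = (case x0 of ereal r \<Rightarrow> at_left r | PInfty \<Rightarrow> at_top | MInfty \<Rightarrow> bot)"

text \<open>Left-sided filter at x0 restricted to points where f is differentiable
  (used for limits of quantities involving f').\<close>
definition diff_filter :: "ereal \<Rightarrow> (real \<Rightarrow> real) \<Rightarrow> real filter" where
  "diff_filter x0 f = inf (left_filter x0) (principal {t. f differentiable (at t)})"

definition abs_cont_on :: "real set \<Rightarrow> (real \<Rightarrow> real) \<Rightarrow> bool" where
  "abs_cont_on S f \<longleftrightarrow> (\<forall>\<epsilon>>0. \<exists>\<delta>>0. \<forall>(n::nat) (u::nat \<Rightarrow> real) v.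
      (\<forall>k<n. u k \<le> v k \<and> u k \<in> S \<and> v k \<in> S) \<and>
      (\<forall>j<n. \<forall>k<n. j \<noteq> k \<longrightarrow> v j \<le> u k \<or> v k \<le> u j) \<and>
      (\<Sum>k<n. v k - u k) < \<delta> \<longrightarrow> (\<Sum>k<n. \<bar>f (v k) - f (u k)\<bar>) < \<epsilon>)"

definition AC_loc :: "real \<Rightarrow> ereal \<Rightarrow> (real \<Rightarrow> real) \<Rightarrow> bool" where
  "AC_loc T x0 f \<longleftrightarrow> (\<forall>a b. a \<in> Ival T x0 \<longrightarrow> b \<in> Ival T x0 \<longrightarrow> abs_cont_on {a..b} f)"

definition loc_summable :: "real \<Rightarrow> ereal \<Rightarrow> (real \<Rightarrow> real) \<Rightarrow> bool" where
  "loc_summable T x0 h \<longleftrightarrow>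
     (\<forall>a b. a \<in> Ival T x0 \<longrightarrow> b \<in> Ival T x0 \<longrightarrow> h absolutely_integrable_on {a..b})"

definition improper_int_to :: "(real \<Rightarrow> real) \<Rightarrow> real \<Rightarrow> ereal \<Rightarrow> real \<Rightarrow> bool" where
  "improper_int_to h x x0 L \<longleftrightarrow> ((\<lambda>y. integral {x..y} h) \<longlongrightarrow> L) (left_filter x0)"

definition Wr :: "(real \<Rightarrow> real) \<Rightarrow> (real \<Rightarrow> real) \<Rightarrow> (real \<Rightarrow> real) \<Rightarrow> (real \<Rightarrow> real) \<Rightarrow> real \<Rightarrow> real" where
  "Wr g g' h h' t = g t * h' t - g' t * h t"

definition dquot :: "(real \<Rightarrow> real) \<Rightarrow> (real \<Rightarrow> real) \<Rightarrow> (real \<Rightarrow> real) \<Rightarrow> (real \<Rightarrow> real) \<Rightarrow> real \<Rightarrow> real" where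
  "dquot g g' h h' t = (g' t * h t - g t * h' t) / (h t)\<^sup>2"

definition f1star :: "(real \<Rightarrow> real) \<Rightarrow> (real \<Rightarrow> real) \<Rightarrow> (real \<Rightarrow> real) \<Rightarrow> (real \<Rightarrow> real) \<Rightarrow> (real \<Rightarrow> real) \<Rightarrow> real \<Rightarrow> real" where
  "f1star \<phi>1 \<phi>1' \<phi>2 \<phi>2' f t = Wr f (deriv f) \<phi>2 \<phi>2' t / Wr \<phi>1 \<phi>1' \<phi>2 \<phi>2' t"

definition f2star :: "(real \<Rightarrow> real) \<Rightarrow> (real \<Rightarrow> real) \<Rightarrow> (real \<Rightarrow> real) \<Rightarrow> (real \<Rightarrow> real) \<Rightarrow> (real \<Rightarrow> real) \<Rightarrow> real \<Rightarrow> real" where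
  "f2star \<phi>1 \<phi>1' \<phi>2 \<phi>2' f t = - Wr f (deriv f) \<phi>1 \<phi>1' t / Wr \<phi>1 \<phi>1' \<phi>2 \<phi>2' t"

definition PhiT :: "real \<Rightarrow> (real \<Rightarrow> real) \<Rightarrow> (real \<Rightarrow> real) \<Rightarrow> real \<Rightarrow> real" where
  "PhiT T \<phi>1 \<phi>2 x = \<phi>2 T * \<phi>1 x - \<phi>1 T * \<phi>2 x"

definition Fstar :: "real \<Rightarrow> (real \<Rightarrow> real) \<Rightarrow> (real \<Rightarrow> real) \<Rightarrow> (real \<Rightarrow> real) \<Rightarrow> (real \<Rightarrow> real) \<Rightarrow> (real \<Rightarrow> real) \<Rightarrow> real \<Rightarrow> real" where
  "Fstar T \<phi>1 \<phi>1' \<phi>2 \<phi>2' f t =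
     \<phi>1 T * f1star \<phi>1 \<phi>1' \<phi>2 \<phi>2' f t + \<phi>2 T * f2star \<phi>1 \<phi>1' \<phi>2 \<phi>2' f t"


definition cond_iv where
  "cond_iv x0 \<phi>1 \<phi>1' \<phi>2 \<phi>2' f a1 a2 \<longleftrightarrow>
     (\<lambda>x. f x - (a1 * \<phi>1 x + a2 * \<phi>2 x)) \<in> o[left_filter x0](\<phi>2) \<and>
     (\<lambda>x. dquot f (deriv f) \<phi>1 \<phi>1' x - a2 * dquot \<phi>2 \<phi>2' \<phi>1 \<phi>1' x)
        \<in> o[diff_filter x0 f](dquot \<phi>2 \<phi>2' \<phi>1 \<phi>1')"

definition cond_v where
  "cond_v x0 \<phi>1 \<phi>1' \<phi>2 \<phi>2' f a1 a2 \<longleftrightarrow>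
     (\<lambda>x. f x - (a1 * \<phi>1 x + a2 * \<phi>2 x)) \<in> o[left_filter x0](\<phi>2) \<and>
     (\<lambda>x. dquot f (deriv f) \<phi>2 \<phi>2' x - a1 * dquot \<phi>1 \<phi>1' \<phi>2 \<phi>2' x)
        \<in> o[diff_filter x0 f](\<lambda>x. \<phi>2 x / \<phi>1 x * dquot \<phi>1 \<phi>1' \<phi>2 \<phi>2' x)"

definition rep_vi where
  "rep_vi T x0 \<phi>1 \<phi>1' \<phi>2 \<phi>2' f a1 a2 Fb \<longleftrightarrow>
     (\<forall>x. T < x \<and> ereal x < x0 \<longrightarrow>
        (\<exists>L. improper_int_to
                (\<lambda>t. Wr \<phi>1 \<phi>1' \<phi>2 \<phi>2' t / (PhiT T \<phi>1 \<phi>2 t)\<^sup>2 * Fb t) x x0 L \<and>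
             f x = a1 * \<phi>1 x + a2 * \<phi>2 x - PhiT T \<phi>1 \<phi>2 x * L))"

definition rep_vii where
  "rep_vii T x0 \<phi>1 \<phi>1' \<phi>2 \<phi>2' f a1 a2 f2b \<longleftrightarrow>
     (\<forall>x \<in> Ival T x0.
        (\<exists>L. improper_int_to (\<lambda>t. dquot \<phi>2 \<phi>2' \<phi>1 \<phi>1' t * f2b t) x x0 L \<and>
             f x = a1 * \<phi>1 x + a2 * \<phi>2 x - \<phi>1 x * L))"

end

theory Submission
  imports Defs
begin

text \<open>Both quotients \<open>h = f / \<psi>\<close>, with \<open>\<psi> = \<phi>1\<close> or \<open>\<psi> = \<Phi>\<close>, satisfy
  \<open>h' = \<rho>' G\<close> almost everywhere, where \<open>\<rho>\<close> is strictly monotone, tends to \<open>0\<close> at \<open>x0\<close>, and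
  \<open>G\<close> is \<open>f\<^sub>2\<^sup>*\<close> or \<open>F\<^sup>*\<close>. Since \<open>h\<close> is locally absolutely continuous it is the
  integral of \<open>\<rho>' G\<close>; so a limit of \<open>G\<close> makes \<open>h\<close> Cauchy at \<open>x0\<close>, and integrating from \<open>x\<close> to
  \<open>x0\<close> yields the representations and the \<open>o(\<phi>2)\<close> expansion. Conversely, in a representation the remainder
  over \<open>\<rho>\<close> has difference quotients of size \<open>o(1)\<close>, which forces \<open>G\<close> to converge along all points of
  differentiability, not merely almost all.\<close>

section \<open>Absolutely continuous functions\<close>

text \<open>All seven properties are reduced to one normal form, convergence of both contact
  coefficients (\<open>coeffs_tendsto\<close>). A limit of the single combination \<open>G\<close>
  yields both coefficients: it forces \<open>h\<close> to converge too, and the two limits determine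
  \<open>f1\<close> and \<open>f2\<close> through a linear system that stays nonsingular at
  \<open>x0\<close>. The obstacle in the converse is the gap between null sets and limits:
  \<open>diff_filter\<close> sees every point of differentiability, so knowing \<open>G\<close>
  almost everywhere says nothing about its limit. Difference quotients of \<open>h\<close> bridge
  the gap, since they are controlled by integrals yet converge to \<open>\<rho>' * G\<close> at each
  such point. Absolute continuity is given by its \<epsilon>-\<delta> definition; the calculus it
  supports (derivative almost everywhere, recovery of the function from it) is derived from Vitali
  coverings and gauge integrals.\<close>

lemma abs_cont_on_division:
  assumes ac: "abs_cont_on {a..b} f" and "0 < e"
  obtains \<delta> where "0 < \<delta>"
    "\<And>D. D division_of \<Union>D \<Longrightarrow> \<Union>D \<subseteq> {a..b} \<Longrightarrow> (\<Sum>K\<in>D. measure lborel K) < \<delta>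
        \<Longrightarrow> (\<Sum>K\<in>D. \<bar>f (Sup K) - f (Inf K)\<bar>) < e"
proof -
  obtain \<delta> where "\<delta> > 0" and *: "\<forall>(n::nat) (u::nat \<Rightarrow> real) v.
      (\<forall>k<n. u k \<le> v k \<and> u k \<in> {a..b} \<and> v k \<in> {a..b}) \<and>
      (\<forall>j<n. \<forall>k<n. j \<noteq> k \<longrightarrow> v j \<le> u k \<or> v k \<le> u j) \<and>
      (\<Sum>k<n. v k - u k) < \<delta> \<longrightarrow> (\<Sum>k<n. \<bar>f (v k) - f (u k)\<bar>) < e"
    using ac[unfolded abs_cont_on_def, rule_format, OF \<open>0 < e\<close>] by (elim exE conjE)
  note \<delta> = *[rule_format, OF conjI[OF _ conjI]]
  show ?thesis
  proof (rule that[OF \<open>\<delta> > 0\<close>])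
    fix D :: "real set set"
    assume D: "D division_of \<Union>D" "\<Union>D \<subseteq> {a..b}" and sm: "(\<Sum>K\<in>D. measure lborel K) < \<delta>"
    \<comment> \<open>A division has disjoint interiors only, so a one-point member may lie inside
      another member and violate the ordering condition of \<open>abs_cont_on\<close>. Such members
      contribute nothing to either sum and are dropped before enumerating.\<close>
    define D' where "D' = {K\<in>D. Inf K < Sup K}"
    have form: "\<exists>c d. K = {c..d} \<and> c \<le> d \<and> Inf K = c \<and> Sup K = d \<and> measure lborel K = d - c" if "K \<in> D" for K
      using division_ofD(3,4)[OF D(1) that] by auto
    have fin: "finite D" "finite D'" using D(1) by (auto simp: D'_def division_of_finite)
    obtain h where h: "bij_betw h {..<card D'} D'"
      using ex_bij_betw_nat_finite[OF fin(2)] by (auto simp: atLeast0LessThan)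
    have hD: "h k \<in> D" "Inf (h k) < Sup (h k)" if "k < card D'" for k
      using bij_betwE[OF h] that by (auto simp: D'_def)
    have eq: "(\<Sum>k<card D'. g (h k)) = (\<Sum>K\<in>D. g K)"
      if "\<And>K. K \<in> D \<Longrightarrow> Inf K = Sup K \<Longrightarrow> g K = 0" for g :: "real set \<Rightarrow> real"
    proof -
      have "(\<Sum>k<card D'. g (h k)) = sum g D'"
        using sum.reindex_bij_betw[OF h] .
      also have "\<dots> = sum g D"
      proof (rule sum.mono_neutral_left[OF fin(1)])
        show "\<forall>K\<in>D - D'. g K = 0"
          using form that unfolding D'_def by fastforce
      qed (auto simp: D'_def)
      finally show ?thesis .
    qed
    have "(\<Sum>k<card D'. \<bar>f (Sup (h k)) - f (Inf (h k))\<bar>) < e"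
    proof (rule \<delta>)
      show "\<forall>k<card D'. Inf (h k) \<le> Sup (h k) \<and> Inf (h k) \<in> {a..b} \<and> Sup (h k) \<in> {a..b}"
      proof (intro allI impI)
        fix k assume k: "k < card D'"
        have "h k \<subseteq> {a..b}" using hD(1)[OF k] D(2) by auto
        then show "Inf (h k) \<le> Sup (h k) \<and> Inf (h k) \<in> {a..b} \<and> Sup (h k) \<in> {a..b}"
          using form[OF hD(1)[OF k]] by (metis atLeastAtMost_iff order_refl subsetD)
      qed
      show "\<forall>j<card D'. \<forall>k<card D'. j \<noteq> k \<longrightarrow> Sup (h j) \<le> Inf (h k) \<or> Sup (h k) \<le> Inf (h j)"
      proof (intro allI impI)
        fix j k assume j: "j < card D'" and k: "k < card D'" and "j \<noteq> k"
        then have "h j \<noteq> h k" using h by (auto simp: bij_betw_def inj_on_def)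
        then have i: "interior (h j) \<inter> interior (h k) = {}"
          using division_ofD(5)[OF D(1) hD(1)[OF j] hD(1)[OF k]] by auto
        obtain c d where cd: "h j = {c..d}" "Inf (h j) = c" "Sup (h j) = d" using form[OF hD(1)[OF j]] by auto
        obtain c' d' where cd': "h k = {c'..d'}" "Inf (h k) = c'" "Sup (h k) = d'" using form[OF hD(1)[OF k]] by auto
        have lt: "c < d" "c' < d'" using hD(2)[OF j] hD(2)[OF k] cd cd' by auto
        show "Sup (h j) \<le> Inf (h k) \<or> Sup (h k) \<le> Inf (h j)"
        proof (rule ccontr)
          assume "\<not> ?thesis"
          then have "max c c' < min d d'" using cd cd' lt by auto
          then obtain z where "max c c' < z" "z < min d d'" using dense by blast
          then have "z \<in> interior (h j) \<inter> interior (h k)" using cd(1) cd'(1) by auto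
          with i show False by blast
        qed
      qed
      have "(\<Sum>k<card D'. Sup (h k) - Inf (h k)) = (\<Sum>K\<in>D. Sup K - Inf K)"
        by (rule eq) auto
      also have "\<dots> = (\<Sum>K\<in>D. measure lborel K)" using form by (intro sum.cong) auto
      finally show "(\<Sum>k<card D'. Sup (h k) - Inf (h k)) < \<delta>" using sm by simp
    qed
    also have "(\<Sum>k<card D'. \<bar>f (Sup (h k)) - f (Inf (h k))\<bar>) = (\<Sum>K\<in>D. \<bar>f (Sup K) - f (Inf K)\<bar>)"
      by (rule eq) auto
    finally show "(\<Sum>K\<in>D. \<bar>f (Sup K) - f (Inf K)\<bar>) < e" .
  qed
qed

lemma sum_increments_division:
  fixes f :: "real \<Rightarrow> real"
  assumes "a \<le> b" "D division_of {a..b}"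
  shows "(\<Sum>K\<in>D. f (Sup K) - f (Inf K)) = f b - f a"
proof -
  define p where "p = (\<lambda>K. (Inf K, K)) ` D"
  have form: "\<exists>c d. K = {c..d} \<and> c \<le> d" if "K \<in> D" for K
    using division_ofD(3,4)[OF assms(2) that] by auto
  have "p tagged_division_of {a..b}"
    unfolding p_def
  proof (rule tagged_division_ofI)
    show "finite ((\<lambda>K. (Inf K, K)) ` D)" using division_ofD(1)[OF assms(2)] by simp
    fix x K assume "(x, K) \<in> (\<lambda>K. (Inf K, K)) ` D"
    then have K: "K \<in> D" "x = Inf K" by auto
    show "x \<in> K" using form[OF K(1)] K(2) by auto
    show "K \<subseteq> {a..b}" "\<exists>c d. K = cbox c d" using division_ofD(2,4)[OF assms(2) K(1)] by auto
    fix y L assume "(y, L) \<in> (\<lambda>K. (Inf K, K)) ` D" "(x, K) \<noteq> (y, L)"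
    then show "interior K \<inter> interior L = {}" using division_ofD(5)[OF assms(2) K(1), of L] K(2) by auto
  next
    show "\<Union>{K. \<exists>x. (x, K) \<in> (\<lambda>K. (Inf K, K)) ` D} = {a..b}"
      using division_ofD(6)[OF assms(2)] by blast
  qed
  then have "sum (\<lambda>(x,K). f(Sup K) - f(Inf K)) p = f b - f a"
    using additive_tagged_division_1[OF assms(1)] by blast
  moreover have "sum (\<lambda>(x,K). f(Sup K) - f(Inf K)) p = (\<Sum>K\<in>D. f (Sup K) - f (Inf K))"
    unfolding p_def by (subst sum.reindex) (auto simp: inj_on_def)
  ultimately show ?thesis by simp
qed

text \<open>\<open>G\<close> divides the gaps left by \<open>D\<close> inside \<open>C\<close>.
  Complete \<open>D\<close> to a division \<open>r\<close> of the set divided by \<open>C\<close>,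
  and \<open>C\<close> to a division \<open>q\<close> of an interval: exchanging \<open>C\<close>
  for \<open>r\<close> inside \<open>q\<close> leaves the telescoping total unchanged, so
  \<open>C\<close> and \<open>r\<close> have equal increments. \<open>G\<close> is chosen before
  \<open>f\<close>; with the identity function the formula measures the gaps.\<close>

lemma sum_increments_refine:
  fixes C D :: "real set set"
  assumes C: "C division_of \<Union>C" and D: "D division_of \<Union>D" and sub: "\<Union>D \<subseteq> \<Union>C"
  obtains G where "G division_of \<Union>G" "\<Union>G \<subseteq> \<Union>C"
    "\<And>f :: real \<Rightarrow> real. (\<Sum>K\<in>C. f (Sup K) - f (Inf K)) - (\<Sum>K\<in>D. f (Sup K) - f (Inf K)) = (\<Sum>K\<in>G. f (Sup K) - f (Inf K))"
proof -
  obtain r where r: "D \<subseteq> r" "r division_of \<Union>C"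
    using partial_division_extend[OF D C sub] by blast
  obtain a b where ab: "\<Union>C \<subseteq> cbox a b" "a \<le> b"
  proof -
    obtain a b where "\<Union>C \<subseteq> cbox a b" using elementary_subset_cbox[OF C] by blast
    then have "\<Union>C \<subseteq> cbox (min a b) b" by auto
    then show ?thesis using that by (metis min.cobounded2)
  qed
  obtain q where q: "C \<subseteq> q" "q division_of cbox a b"
    using partial_division_extend_interval[OF C ab(1)] by blast
  have E: "(q - C) division_of \<Union>(q - C)"
    using division_of_subset[of q "q - C"] q(2) division_of_union_self by blast
  have fin: "finite C" "finite D" "finite r" "finite q"
    using C D r q by (auto dest: division_of_finite)
  have op: "interior K \<inter> interior (\<Union>(q - C)) = {}" if "K \<in> C" for K
  proof (rule Int_interior_Union_intervals)
    fix T assume T: "T \<in> q - C"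
    show "\<exists>a b. T = cbox a b" using division_ofD(4)[OF q(2)] T by blast
    show "interior K \<inter> interior T = {}"
      using division_ofD(5)[OF q(2), of K T] q(1) that T by auto
  qed (use fin in auto)
  have op2: "interior (\<Union>(q - C)) \<inter> interior (\<Union>C) = {}"
  proof (rule Int_interior_Union_intervals)
    fix T assume T: "T \<in> C"
    show "\<exists>a b. T = cbox a b" using division_ofD(4)[OF C] T by blast
    show "interior (\<Union>(q - C)) \<inter> interior T = {}"
      using op[OF T] by (simp add: Int_commute)
  qed (use fin in auto)
  have rE: "(r \<union> (q - C)) division_of cbox a b"
  proof -
    have "(r \<union> (q - C)) division_of (\<Union>C \<union> \<Union>(q - C))"
      using division_disjoint_union[OF r(2) E] op2 by (simp add: Int_commute)
    moreover have "\<Union>C \<union> \<Union>(q - C) = cbox a b"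
      using q(1) division_ofD(6)[OF q(2)] by blast
    ultimately show ?thesis by simp
  qed
  show ?thesis
  proof (rule that[of "r - D"])
    show "(r - D) division_of \<Union>(r - D)"
      using division_of_subset[of r "r - D"] r(2) division_of_union_self by blast
    show "\<Union>(r - D) \<subseteq> \<Union>C" using division_ofD(6)[OF r(2)] by blast
  next
    fix f :: "real \<Rightarrow> real"
    let ?F = "\<lambda>K. f (Sup K) - f (Inf K)"
    \<comment> \<open>Members shared by \<open>r\<close> and \<open>q - C\<close> are counted only
      once in the union; they are single points, so nothing is lost.\<close>
    have deg: "?F K = 0" if K: "K \<in> r" "K \<in> q - C" for K
    proof -
      have "interior K = {}"
        using op2 K interior_mono[of K "\<Union>C"] interior_mono[of K "\<Union>(q - C)"] division_ofD(2)[OF r(2) K(1)] by blast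
      moreover obtain c d where "K = {c..d}" "K \<noteq> {}"
        using division_ofD(3,4)[OF r(2) K(1)] by auto
      ultimately show ?thesis by auto
    qed
    have 1: "sum ?F q = f b - f a" "sum ?F (r \<union> (q - C)) = f b - f a"
      using sum_increments_division ab(2) q(2) rE by auto
    have 2: "sum ?F q = sum ?F C + sum ?F (q - C)"
      using sum.subset_diff[OF q(1) fin(4)] by (simp add: add.commute)
    have 3: "sum ?F (r \<union> (q - C)) = sum ?F r + sum ?F (q - C)"
      using deg fin by (intro sum.union_inter_neutral) auto
    have 4: "sum ?F r = sum ?F D + sum ?F (r - D)"
      using sum.subset_diff[OF r(1) fin(3)] by (simp add: add.commute)
    show "sum ?F C - sum ?F D = sum ?F (r - D)" using 1 2 3 4 by linarith
  qed
qed

section \<open>Vitali coverings and null sets of extreme slopes\<close>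

text \<open>Vitali selects countably many disjoint intervals covering almost all of
  \<open>S\<close>, and finitely many of them exhaust their union up to measure \<open>e\<close>.
  Covering by the interior, with the endpoints moved into \<open>R\<close>, leaves an open set in
  which a second covering can be placed.\<close>

lemma vitali_division:
  fixes S :: "real set"
  assumes cov: "\<And>x d. x \<in> S \<Longrightarrow> 0 < d \<Longrightarrow> \<exists>u v. u < v \<and> u \<le> x \<and> x \<le> v \<and> v - u < d \<and> P u v"
    and sub: "\<And>u v. u < v \<Longrightarrow> P u v \<Longrightarrow> {u..v} \<subseteq> U"
    and U: "U \<in> lmeasurable" and "0 < e"
  obtains D R where "D division_of \<Union>D"
    "\<And>K. K \<in> D \<Longrightarrow> \<exists>u v. u < v \<and> K = {u..v} \<and> P u v"
    "R \<in> lmeasurable" "measure lebesgue R < e" "S \<subseteq> interior (\<Union>D) \<union> R"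
proof -
  let ?K = "{(u,v). u < v \<and> P u v}"
  \<comment> \<open>The covering theorem speaks of balls, so an interval is encoded by its midpoint
    and half its length.\<close>
  let ?a = "\<lambda>(u,v). (u + v) / 2 :: real" and ?r = "\<lambda>(u,v). (v - u) / 2 :: real"
  have cb: "cball (?a i) (?r i) = {fst i..snd i}" for i
    by (auto simp: cball_eq_atLeastAtMost field_simps split: prod.splits)
  obtain C where C: "countable C" "C \<subseteq> ?K"
    and pw: "pairwise (\<lambda>i j. disjnt (cball (?a i) (?r i)) (cball (?a j) (?r j))) C"
    and neg: "negligible (S - (\<Union>i\<in>C. cball (?a i) (?r i)))"
  proof (rule Vitali_covering_theorem_cballs[where K = ?K and r = ?r and a = ?a and S = S])
    show "0 < ?r i" if "i \<in> ?K" for i using that by auto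
    show "\<exists>i. i \<in> ?K \<and> x \<in> cball (?a i) (?r i) \<and> ?r i < d" if x: "x \<in> S" "0 < d" for x d
    proof -
      obtain u v where "u < v \<and> u \<le> x \<and> x \<le> v \<and> v - u < d \<and> P u v" using cov[OF x] by blast
      then have "(u,v) \<in> ?K" "x \<in> {fst (u,v)..snd (u,v)}" "?r (u,v) < d" using x(2) by auto
      then show ?thesis unfolding cb[symmetric] by blast
    qed
  qed
  define I where "I = (\<lambda>i::real\<times>real. {fst i..snd i})"
  have dis: "disjnt (I i) (I j)" if "i \<in> C" "j \<in> C" "i \<noteq> j" for i j
    using pairwiseD[OF pw that] unfolding cb I_def .
  have neg: "negligible (S - \<Union>(I ` C))" using neg unfolding cb I_def .
  have IU: "\<Union>(I ` C) \<subseteq> U"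
  proof (rule UN_least)
    fix i assume "i \<in> C"
    then have "fst i < snd i" "P (fst i) (snd i)" using C(2) by auto
    then show "I i \<subseteq> U" unfolding I_def by (rule sub)
  qed
  have Im: "I i \<in> lmeasurable" for i by (simp add: I_def)
  have UC: "\<Union>(I ` C) \<in> lmeasurable"
    by (rule fmeasurableI2[OF U IU]) (use C(1) Im in \<open>auto intro!: sets.countable_UN'\<close>)
  have bd: "measure lebesgue (\<Union>D') \<le> measure lebesgue U" if "D' \<subseteq> I ` C" "finite D'" for D'
  proof (rule measure_mono_fmeasurable[OF _ _ U])
    show "\<Union>D' \<subseteq> U" using that IU by blast
    show "\<Union>D' \<in> sets lebesgue" using that Im by (intro sets.finite_Union) (auto simp: fmeasurableD)
  qed
  obtain D where "D \<subseteq> I ` C" "finite D"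
    and Dm: "measure lebesgue (\<Union>(I ` C)) - e < measure lebesgue (\<Union>D)"
  proof (rule measure_countable_Union_approachable[of "I ` C" e "measure lebesgue U"])
  qed (use C(1) Im bd \<open>0 < e\<close> in auto)
  then obtain F where F: "finite F" "F \<subseteq> C" and D_def: "D = I ` F"
    by (meson finite_subset_image)
  \<comment> \<open>The intervals outside the finite family, the points of \<open>S\<close> missed
    by the covering, and the endpoints; the last two sets are negligible.\<close>
  define R where "R = (\<Union>(I ` C) - \<Union>D) \<union> (S - \<Union>(I ` C)) \<union> (\<Union>D - interior (\<Union>D))"
  have D: "D division_of \<Union>D"
  proof (rule division_ofI)
    show "finite D" using F(1) by (simp add: D_def)
    fix K assume "K \<in> D"
    then obtain i where i: "i \<in> F" "K = I i" by (auto simp: D_def)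
    show "K \<noteq> {}" "\<exists>a b. K = cbox a b" "K \<subseteq> \<Union>D" using i F(2) C(2) \<open>K \<in> D\<close>
      by (auto simp: I_def) 
    fix L assume "L \<in> D" "K \<noteq> L"
    then obtain j where j: "j \<in> F" "L = I j" "i \<noteq> j" using i by (auto simp: D_def)
    have "K \<inter> L = {}" using dis[of i j] i j F(2) by (auto simp: disjnt_def)
    then show "interior K \<inter> interior L = {}" using interior_subset by blast
  qed simp
  have negb: "negligible (\<Union>D - interior (\<Union>D))"
  proof -
    have "\<Union>D - interior (\<Union>D) \<subseteq> (\<Union>i\<in>F. {fst i, snd i})"
    proof
      fix x assume x: "x \<in> \<Union>D - interior (\<Union>D)"
      then obtain i where i: "i \<in> F" "x \<in> I i" by (auto simp: D_def)
      have "interior (I i) \<subseteq> interior (\<Union>D)" using i by (intro interior_mono) (auto simp: D_def)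
      with x i show "x \<in> (\<Union>i\<in>F. {fst i, snd i})" by (auto simp: I_def) force
    qed
    then show ?thesis using F(1) by (meson finite.emptyI finite_UN_I finite_insert negligible_finite negligible_subset)
  qed
  show ?thesis
  proof (rule that[OF D])
    show "\<exists>u v. u < v \<and> K = {u..v} \<and> P u v" if K: "K \<in> D" for K
    proof -
      obtain i where i: "i \<in> C" "K = {fst i..snd i}" using K F(2) unfolding D_def I_def by blast
      then have "fst i < snd i" "P (fst i) (snd i)" using C(2) by auto
      then show ?thesis using i(2) by blast
    qed
    have UD: "\<Union>D \<in> lmeasurable" using lmeasurable_division[OF D] .
    have DC: "\<Union>D \<subseteq> \<Union>(I ` C)" using F(2) by (auto simp: D_def)
    have m1: "(\<Union>(I ` C) - \<Union>D) \<in> lmeasurable" using UC UD by blast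
    have "measure lebesgue (\<Union>(I ` C) - \<Union>D) = measure lebesgue (\<Union>(I ` C)) - measure lebesgue (\<Union>D)"
      by (rule measurable_measure_Diff[OF UC _ DC]) (use UD in auto)
    also have "\<dots> < e" using Dm by simp
    finally have m2: "measure lebesgue (\<Union>(I ` C) - \<Union>D) < e" .
    have N: "negligible ((S - \<Union>(I ` C)) \<union> (\<Union>D - interior (\<Union>D)))" using neg negb by simp
    have Req: "R = (\<Union>(I ` C) - \<Union>D) \<union> ((S - \<Union>(I ` C)) \<union> (\<Union>D - interior (\<Union>D)))"
      unfolding R_def by blast
    show "R \<in> lmeasurable" unfolding Req using m1 negligible_imp_measurable[OF N] by blast
    have "measure lebesgue R = measure lebesgue (\<Union>(I ` C) - \<Union>D)"
      unfolding Req using m1 N by (simp add: measure_Un_null_set negligible_iff_null_sets)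
    then show "measure lebesgue R < e" using m2 by simp
    show "S \<subseteq> interior (\<Union>D) \<union> R" unfolding R_def by blast
  qed
qed

lemma division_sum_lengths:
  fixes D :: "real set set"
  assumes "D division_of \<Union>D"
  shows "(\<Sum>K\<in>D. Sup K - Inf K) = measure lebesgue (\<Union>D)"
    and "(\<Sum>K\<in>D. measure lborel K) = measure lebesgue (\<Union>D)"
proof -
  have form: "measure lebesgue K = Sup K - Inf K \<and> measure lborel K = Sup K - Inf K" if K: "K \<in> D" for K
  proof -
    obtain c d where "K = {c..d}" "K \<noteq> {}" using division_ofD(3,4)[OF assms K] by auto
    then show ?thesis by auto
  qed
  show "(\<Sum>K\<in>D. Sup K - Inf K) = measure lebesgue (\<Union>D)"
    and "(\<Sum>K\<in>D. measure lborel K) = measure lebesgue (\<Union>D)"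
    unfolding content_division[OF assms, symmetric] using form by (auto intro!: sum.cong)
qed

text \<open>Cover \<open>S\<close> in the sense of Vitali by a finite family \<open>C\<close> of intervals of slope below \<open>p\<close>, and what remains
  inside \<open>C\<close> by a family \<open>D\<close> of intervals of slope above \<open>q\<close>, both of total length close to the outer
  measure \<open>\<mu>\<close> of \<open>S\<close>. The gaps between \<open>D\<close> and \<open>C\<close> are short, so absolute continuity
  makes the increment of \<open>f\<close> over them negligible, whence \<open>q \<mu> \<le> p \<mu>\<close>. For monotone \<open>f\<close> the gaps
  would be handled by monotonicity; this version needs no Jordan decomposition.\<close>

lemma slopes_negligible:
  fixes f :: "real \<Rightarrow> real"
  assumes ac: "abs_cont_on {a..b} f" and "p < q" and S: "S \<subseteq> {a<..<b}"
    and lo: "\<And>x d. x \<in> S \<Longrightarrow> 0 < d \<Longrightarrow> \<exists>u v. u < v \<and> u \<le> x \<and> x \<le> v \<and> v - u < d \<and> f v - f u < p * (v - u)"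
    and hi: "\<And>x d. x \<in> S \<Longrightarrow> 0 < d \<Longrightarrow> \<exists>u v. u < v \<and> u \<le> x \<and> x \<le> v \<and> v - u < d \<and> q * (v - u) < f v - f u"
  shows "negligible S"
proof -
  let ?m = "measure lebesgue"
  \<comment> \<open>\<open>S\<close> may be non-measurable, so its size is the infimum
    \<open>\<mu>\<close> over measurable supersets of finite measure.\<close>
  define M where "M = ?m ` {U \<in> lmeasurable. S \<subseteq> U}"
  define \<mu> where "\<mu> = Inf M"
  have bdd: "bdd_below M" unfolding M_def by (intro bdd_belowI[of _ 0]) auto
  have ne: "M \<noteq> {}" using S unfolding M_def by (auto intro!: exI[of _ "{a<..<b}"])
  have \<mu>_le: "\<mu> \<le> ?m U" if "U \<in> lmeasurable" "S \<subseteq> U" for U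
    unfolding \<mu>_def using that by (intro cInf_lower[OF _ bdd]) (auto simp: M_def)
  have "0 \<le> \<mu>" unfolding \<mu>_def using ne by (intro cInf_greatest) (auto simp: M_def)
  have outer: "\<exists>V. open V \<and> V \<in> lmeasurable \<and> S \<subseteq> V \<and> V \<subseteq> {a<..<b} \<and> ?m V < \<mu> + e" if "0 < e" for e
  proof -
    have "Inf M < \<mu> + e/2" using \<open>0 < e\<close> by (simp add: \<mu>_def)
    then obtain U where U: "U \<in> lmeasurable" "S \<subseteq> U" "?m U < \<mu> + e/2"
      using cInf_lessD[OF ne] by (auto simp: M_def)
    obtain T where T: "open T" "U \<subseteq> T" "T - U \<in> lmeasurable" "emeasure lebesgue (T - U) < ennreal (e/2)"
      using sets_lebesgue_outer_open[of U "e/2"] U(1) \<open>0 < e\<close> by auto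
    have "?m (T - U) < e/2" using T(3,4) \<open>0 < e\<close> by (simp add: emeasure_eq_measure2 ennreal_less_iff)
    moreover have "?m (U \<union> (T - U)) \<le> ?m U + ?m (T - U)"
      using U(1) T(3) by (intro measure_Un_le) auto
    moreover have "?m (T \<inter> {a<..<b}) \<le> ?m (U \<union> (T - U))"
      using T by (intro measure_mono_fmeasurable fmeasurable.Un[OF U(1) T(3)]) auto
    ultimately have "?m (T \<inter> {a<..<b}) < \<mu> + e" using U(3) by simp
    moreover have "T \<inter> {a<..<b} \<in> lmeasurable"
      using T(1) by (intro bounded_set_imp_lmeasurable) (auto intro: bounded_subset[of "{a<..<b}"])
    ultimately show ?thesis using T(1,2) U(2) S by (intro exI[of _ "T \<inter> {a<..<b}"]) auto
  qed
  have shrink: "\<exists>u v. u < v \<and> u \<le> x \<and> x \<le> v \<and> v - u < d \<and> {u..v} \<subseteq> V \<and> Q u v"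
    if "open V" "x \<in> V" "0 < d"
      and Q: "\<And>d::real. 0 < d \<Longrightarrow> \<exists>u v. u < v \<and> u \<le> x \<and> x \<le> v \<and> v - u < d \<and> Q u v" for V :: "real set" and x d Q
  proof -
    obtain r where r: "r > 0" "ball x r \<subseteq> V" using \<open>open V\<close> \<open>x \<in> V\<close> openE by blast
    obtain u v where uv: "u < v" "u \<le> x" "x \<le> v" "v - u < min d r" "Q u v"
      using Q[of "min d r"] \<open>0 < d\<close> r(1) by auto
    have "{u..v} \<subseteq> ball x r" using uv by (auto simp: dist_real_def)
    then show ?thesis using uv r(2) by (intro exI[of _ u] exI[of _ v]) auto
  qed
  have main: "(q - p) * \<mu> \<le> e * (1 + 2 * \<bar>p\<bar> + 2 * \<bar>q\<bar>)" if "0 < e" for e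
  proof -
    obtain \<delta> where "0 < \<delta>" and \<delta>: "\<And>D. D division_of \<Union>D \<Longrightarrow> \<Union>D \<subseteq> {a..b} \<Longrightarrow> (\<Sum>K\<in>D. measure lborel K) < \<delta>
        \<Longrightarrow> (\<Sum>K\<in>D. \<bar>f (Sup K) - f (Inf K)\<bar>) < e"
      using abs_cont_on_division[OF ac \<open>0 < e\<close>] by blast
    \<comment> \<open>The gaps between the two families will measure less than (\<mu> + \<epsilon>)
      - (\<mu> - 2 * \<epsilon>) = 3 * \<epsilon>, which has to stay below \<delta>.\<close>
    define \<epsilon> where "\<epsilon> = min e (\<delta>/4)"
    have \<epsilon>: "0 < \<epsilon>" "\<epsilon> \<le> e" "3 * \<epsilon> < \<delta>" using \<open>0 < e\<close> \<open>0 < \<delta>\<close> by (auto simp: \<epsilon>_def min_def)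
    obtain V where V: "open V" "V \<in> lmeasurable" "S \<subseteq> V" "V \<subseteq> {a<..<b}" "?m V < \<mu> + \<epsilon>"
      using outer[OF \<epsilon>(1)] by blast
    obtain C R1 where C: "C division_of \<Union>C"
      "\<And>K. K \<in> C \<Longrightarrow> \<exists>u v. u < v \<and> K = {u..v} \<and> {u..v} \<subseteq> V \<and> f v - f u < p * (v - u)"
      and R1: "R1 \<in> lmeasurable" "?m R1 < \<epsilon>" "S \<subseteq> interior (\<Union>C) \<union> R1"
    proof (rule vitali_division[of S "\<lambda>u v. {u..v} \<subseteq> V \<and> f v - f u < p * (v - u)" V \<epsilon>])
      show "\<exists>u v. u < v \<and> u \<le> x \<and> x \<le> v \<and> v - u < d \<and> {u..v} \<subseteq> V \<and> f v - f u < p * (v - u)"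
        if "x \<in> S" "0 < d" for x d
        using shrink[OF V(1) _ \<open>0 < d\<close>, of x "\<lambda>u v. f v - f u < p * (v - u)"] V(3) that lo[OF that(1)] by blast
    qed (use V \<epsilon> in auto)
    \<comment> \<open>The intervals of the second covering must fit inside the first family, hence
      its interior.\<close>
    define V' where "V' = interior (\<Union>C)"
    obtain D R2 where D: "D division_of \<Union>D"
      "\<And>K. K \<in> D \<Longrightarrow> \<exists>u v. u < v \<and> K = {u..v} \<and> {u..v} \<subseteq> V' \<and> q * (v - u) < f v - f u"
      and R2: "R2 \<in> lmeasurable" "?m R2 < \<epsilon>" "S \<inter> V' \<subseteq> interior (\<Union>D) \<union> R2"
    proof (rule vitali_division[of "S \<inter> V'" "\<lambda>u v. {u..v} \<subseteq> V' \<and> q * (v - u) < f v - f u" "\<Union>C" \<epsilon>])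
      show "\<exists>u v. u < v \<and> u \<le> x \<and> x \<le> v \<and> v - u < d \<and> {u..v} \<subseteq> V' \<and> q * (v - u) < f v - f u"
        if "x \<in> S \<inter> V'" "0 < d" for x d
        using shrink[of V' x d "\<lambda>u v. q * (v - u) < f v - f u"] that hi[of x] by (auto simp: V'_def)
      show "\<Union>C \<in> lmeasurable" using lmeasurable_division[OF C(1)] .
      show "\<And>u v. {u..v} \<subseteq> V' \<and> q * (v - u) < f v - f u \<Longrightarrow> {u..v} \<subseteq> \<Union>C"
        unfolding V'_def using interior_subset by blast
    qed (use \<epsilon> in auto)
    have sub: "\<Union>D \<subseteq> \<Union>C" "\<Union>C \<subseteq> V"
      using D(2) C(2) interior_subset[of "\<Union>C"] unfolding V'_def by blast+
    have lm: "\<Union>C \<in> lmeasurable" "\<Union>D \<in> lmeasurable"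
      using lmeasurable_division C(1) D(1) by blast+
    obtain G where G: "G division_of \<Union>G" "\<Union>G \<subseteq> \<Union>C"
      "\<And>f :: real \<Rightarrow> real. (\<Sum>K\<in>C. f (Sup K) - f (Inf K)) - (\<Sum>K\<in>D. f (Sup K) - f (Inf K)) = (\<Sum>K\<in>G. f (Sup K) - f (Inf K))"
      using sum_increments_refine[OF C(1) D(1) sub(1)] by blast
    have mC: "?m (\<Union>C) < \<mu> + \<epsilon>"
      using measure_mono_fmeasurable[OF sub(2) _ V(2)] lm V(5) by (auto simp: fmeasurableD)
    have mDC: "?m (\<Union>D) \<le> ?m (\<Union>C)"
      using measure_mono_fmeasurable[OF sub(1) _ lm(1)] lm by (auto simp: fmeasurableD)
    have mD: "\<mu> \<le> ?m (\<Union>D) + 2 * \<epsilon>"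
    proof -
      have "S \<subseteq> \<Union>D \<union> (R1 \<union> R2)" using R1(3) R2(3) interior_subset[of "\<Union>D"] unfolding V'_def by blast
      then have "\<mu> \<le> ?m (\<Union>D \<union> (R1 \<union> R2))" using lm R1 R2 by (intro \<mu>_le) auto
      also have "\<dots> \<le> ?m (\<Union>D) + ?m (R1 \<union> R2)" using lm R1 R2 by (intro measure_Un_le) auto
      also have "?m (R1 \<union> R2) \<le> ?m R1 + ?m R2" using R1 R2 by (intro measure_Un_le) auto
      finally show ?thesis using R1(2) R2(2) by simp
    qed
    have "(\<Sum>K\<in>G. \<bar>f (Sup K) - f (Inf K)\<bar>) < e"
    proof (rule \<delta>[OF G(1)])
      show "\<Union>G \<subseteq> {a..b}" using G(2) sub(2) V(4) greaterThanLessThan_subseteq_atLeastAtMost_iff[of a b a b] by blast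
      have "(\<Sum>K\<in>G. measure lborel K) = ?m (\<Union>C) - ?m (\<Union>D)"
        using G(3)[of "\<lambda>x. x"] division_sum_lengths[OF G(1)] division_sum_lengths[OF C(1)]
          division_sum_lengths[OF D(1)] by simp
      then show "(\<Sum>K\<in>G. measure lborel K) < \<delta>" using mC mD \<epsilon> by simp
    qed
    then have G': "\<bar>\<Sum>K\<in>G. f (Sup K) - f (Inf K)\<bar> < e"
      using sum_abs[of "\<lambda>K. f (Sup K) - f (Inf K)" G] by linarith
    have "(\<Sum>K\<in>C. f (Sup K) - f (Inf K)) \<le> (\<Sum>K\<in>C. p * (Sup K - Inf K))"
      by (rule sum_mono) (use C(2) in fastforce)
    then have 1: "(\<Sum>K\<in>C. f (Sup K) - f (Inf K)) \<le> p * ?m (\<Union>C)"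
      using division_sum_lengths[OF C(1)] by (simp add: sum_distrib_left[symmetric])
    have "(\<Sum>K\<in>D. q * (Sup K - Inf K)) \<le> (\<Sum>K\<in>D. f (Sup K) - f (Inf K))"
      by (rule sum_mono) (use D(2) in fastforce)
    then have 2: "q * ?m (\<Union>D) \<le> (\<Sum>K\<in>D. f (Sup K) - f (Inf K))"
      using division_sum_lengths[OF D(1)] by (simp add: sum_distrib_left[symmetric])
    have 3: "q * ?m (\<Union>D) - p * ?m (\<Union>C) \<le> e"
      using 1 2 G(3)[of f] G' by linarith
    \<comment> \<open>Both totals lie between \<mu> - 2 * \<epsilon> and \<mu> + \<epsilon>, so
      replacing them by \<mu> costs a multiple of \<open>e\<close>.\<close>
    have "\<bar>?m (\<Union>D) - \<mu>\<bar> \<le> 2 * e" "\<bar>?m (\<Union>C) - \<mu>\<bar> \<le> 2 * e"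
      using mC mD mDC \<epsilon> by linarith+
    then have "\<bar>q\<bar> * \<bar>?m (\<Union>D) - \<mu>\<bar> \<le> \<bar>q\<bar> * (2 * e)" "\<bar>p\<bar> * \<bar>?m (\<Union>C) - \<mu>\<bar> \<le> \<bar>p\<bar> * (2 * e)"
      by (auto intro: mult_left_mono)
    then have "\<bar>q * (?m (\<Union>D) - \<mu>)\<bar> \<le> \<bar>q\<bar> * (2 * e)" "\<bar>p * (?m (\<Union>C) - \<mu>)\<bar> \<le> \<bar>p\<bar> * (2 * e)"
      by (simp_all only: abs_mult)
    with 3 show ?thesis by (simp add: algebra_simps abs_le_iff)
  qed
  have "(q - p) * \<mu> \<le> 0"
  proof (rule field_le_epsilon)
    fix e :: real assume "0 < e"
    define k where "k = 1 + 2 * \<bar>p\<bar> + 2 * \<bar>q\<bar>"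
    have "k > 0" by (simp add: k_def add_pos_nonneg)
    then show "(q - p) * \<mu> \<le> 0 + e" using main[of "e / k"] \<open>0 < e\<close> by (simp add: k_def[symmetric])
  qed
  then have "\<mu> = 0" using \<open>p < q\<close> \<open>0 \<le> \<mu>\<close> by (simp add: mult_le_0_iff)
  then show ?thesis using outer unfolding negligible_outer by (metis add_0)
qed

text \<open>Non-overlapping intervals with slopes above \<open>M\<close> have total length at most
  \<open>B / M\<close>, because their increments sum to at most \<open>B\<close>; and
  \<open>M\<close> may be taken as large as desired.\<close>

lemma steep_negligible:
  fixes f :: "real \<Rightarrow> real"
  assumes S: "S \<subseteq> {a<..<b}"
    and bv: "\<And>D. D division_of \<Union>D \<Longrightarrow> \<Union>D \<subseteq> {a..b} \<Longrightarrow> (\<Sum>K\<in>D. \<bar>f (Sup K) - f (Inf K)\<bar>) \<le> B"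
    and steep: "\<And>M x d. x \<in> S \<Longrightarrow> 0 < d \<Longrightarrow> \<exists>u v. u < v \<and> u \<le> x \<and> x \<le> v \<and> v - u < d \<and> M * (v - u) < \<bar>f v - f u\<bar>"
  shows "negligible S"
  unfolding negligible_outer
proof (intro allI impI)
  fix e :: real assume "0 < e"
  let ?m = "measure lebesgue"
  have "0 \<le> B" using bv[of "{}"] by (auto simp: division_of_trivial)
  \<comment> \<open>\<open>M * (e / 2) = B + 1\<close> exceeds \<open>B\<close>, so the selected
    intervals measure less than \<open>e / 2\<close>; the other half is for
    \<open>R\<close>.\<close>
  define M where "M = 2 * (B + 1) / e"
  have "0 < M" using \<open>0 < e\<close> \<open>0 \<le> B\<close> by (simp add: M_def)
  obtain D R where D: "D division_of \<Union>D"
      "\<And>K. K \<in> D \<Longrightarrow> \<exists>u v. u < v \<and> K = {u..v} \<and> {u..v} \<subseteq> {a<..<b} \<and> M * (v - u) < \<bar>f v - f u\<bar>"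
    and R: "R \<in> lmeasurable" "?m R < e/2" "S \<subseteq> interior (\<Union>D) \<union> R"
  proof (rule vitali_division[of S "\<lambda>u v. {u..v} \<subseteq> {a<..<b} \<and> M * (v - u) < \<bar>f v - f u\<bar>" "{a<..<b}" "e/2"])
    fix x d :: real assume x: "x \<in> S" and "0 < d"
    define d' where "d' = min d (min (x - a) (b - x))"
    have "0 < d'" using x S \<open>0 < d\<close> by (auto simp: d'_def)
    then obtain u v where uv: "u < v" "u \<le> x" "x \<le> v" "v - u < d'" "M * (v - u) < \<bar>f v - f u\<bar>"
      using steep[OF x] by blast
    then have "{u..v} \<subseteq> {a<..<b}" by (auto simp: d'_def)
    then show "\<exists>u v. u < v \<and> u \<le> x \<and> x \<le> v \<and> v - u < d \<and> {u..v} \<subseteq> {a<..<b} \<and> M * (v - u) < \<bar>f v - f u\<bar>"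
      using uv by (intro exI[of _ u] exI[of _ v]) (auto simp: d'_def)
  qed (use \<open>0 < e\<close> in auto)
  have lm: "\<Union>D \<in> lmeasurable" using lmeasurable_division D(1) by blast
  have "(\<Sum>K\<in>D. M * (Sup K - Inf K)) \<le> (\<Sum>K\<in>D. \<bar>f (Sup K) - f (Inf K)\<bar>)"
    by (rule sum_mono) (use D(2) in fastforce)
  moreover have "(\<Sum>K\<in>D. \<bar>f (Sup K) - f (Inf K)\<bar>) \<le> B"
  proof (rule bv[OF D(1)])
    show "\<Union>D \<subseteq> {a..b}" using D(2) by force
  qed
  ultimately have "M * ?m (\<Union>D) \<le> B"
    using division_sum_lengths[OF D(1)] by (simp add: sum_distrib_left[symmetric])
  also have "B < M * (e / 2)" using \<open>0 < e\<close> by (simp add: M_def)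
  finally have "?m (\<Union>D) < e / 2" using \<open>0 < M\<close> by simp
  moreover have "?m (\<Union>D \<union> R) \<le> ?m (\<Union>D) + ?m R" using lm R by (intro measure_Un_le) auto
  ultimately have "?m (\<Union>D \<union> R) < e" using R(2) by linarith
  moreover have "S \<subseteq> \<Union>D \<union> R" using R(3) interior_subset[of "\<Union>D"] by blast
  ultimately show "\<exists>T. S \<subseteq> T \<and> T \<in> lmeasurable \<and> ?m T < e" using lm R(1) by blast
qed

section \<open>Differentiability almost everywhere\<close>

text \<open>Liminf and Limsup of the slopes, taken in the extended reals, coincide unless two
  rationals separate them, and the bound makes the common value finite. Rational levels keep the
  family of exceptional sets countable.\<close>

lemma differentiable_if_slopes_converge:
  fixes f :: "real \<Rightarrow> real"
  assumes bounded: "eventually (\<lambda>y. \<bar>(f y - f x) / (y - x)\<bar> \<le> M) (at x)"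
    and gap: "\<And>p q :: rat. p < q \<Longrightarrow> \<not> ((\<exists>\<^sub>F y in at x. (f y - f x) / (y - x) < of_rat p) \<and>
                                       (\<exists>\<^sub>F y in at x. of_rat q < (f y - f x) / (y - x)))"
  shows "f differentiable at x"
proof -
  define s where "s = (\<lambda>y. ereal ((f y - f x) / (y - x)))"
  have nb: "at x \<noteq> bot" by simp
  have le: "Limsup (at x) s \<le> Liminf (at x) s"
  proof (rule ccontr)
    assume "\<not> ?thesis"
    then have "Liminf (at x) s < Limsup (at x) s" by simp
    then obtain c d where cd: "Liminf (at x) s < ereal c" "c < d" "ereal d < Limsup (at x) s"
      by (metis ereal_dense2 less_ereal.simps(1))
    obtain p :: rat where p: "c < of_rat p" "of_rat p < d" using of_rat_dense[OF cd(2)] by blast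
    obtain q :: rat where q: "of_rat p < (of_rat q :: real)" "of_rat q < d" using of_rat_dense[OF p(2)] by blast
    have "p < q" using q(1) by (simp add: of_rat_less)
    then consider "eventually (\<lambda>y. \<not> (f y - f x) / (y - x) < of_rat p) (at x)"
      | "eventually (\<lambda>y. \<not> of_rat q < (f y - f x) / (y - x)) (at x)"
      using gap by (auto simp: frequently_def)
    then show False
    proof cases
      case 1
      then have "eventually (\<lambda>y. ereal (of_rat p) \<le> s y) (at x)"
        by eventually_elim (simp add: s_def)
      then have "ereal (of_rat p) \<le> Liminf (at x) s" by (rule Liminf_bounded)
      then show False using cd(1) p(1) by (meson ereal_less_eq(3) less_le_not_le order_trans less_imp_le)
    next
      case 2
      then have "eventually (\<lambda>y. s y \<le> ereal (of_rat q)) (at x)"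
        by eventually_elim (simp add: s_def)
      then have "Limsup (at x) s \<le> ereal (of_rat q)" by (rule Limsup_bounded)
      then show False using cd(3) q(2) by (meson ereal_less_eq(3) less_le_not_le order_trans less_imp_le)
    qed
  qed
  have eq: "Liminf (at x) s = Limsup (at x) s" using le Liminf_le_Limsup[OF nb, of s] by simp
  then have lim: "(s \<longlongrightarrow> Limsup (at x) s) (at x)" by (intro Liminf_eq_Limsup) auto
  have "eventually (\<lambda>y. s y \<le> ereal M) (at x)" "eventually (\<lambda>y. ereal (-M) \<le> s y) (at x)"
    unfolding s_def ereal_less_eq using bounded by (eventually_elim, linarith)+
  then have "Limsup (at x) s \<le> ereal M" "ereal (- M) \<le> Limsup (at x) s"
    using Limsup_bounded Liminf_bounded eq by metis+
  then obtain L where L: "Limsup (at x) s = ereal L" by (cases "Limsup (at x) s") auto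
  then have "((\<lambda>y. (f y - f x) / (y - x)) \<longlongrightarrow> L) (at x)" using lim by (simp add: s_def)
  then have "(f has_real_derivative L) (at x)" by (simp add: has_field_derivative_iff)
  then show ?thesis using real_differentiable_def by blast
qed

text \<open>A chord slope is symmetric in its ends, so a point on either side of \<open>x\<close>
  gives an interval with \<open>x\<close> as an endpoint. \<open>P\<close> will stand for a slope
  below \<open>p\<close>, above \<open>q\<close>, or of large modulus.\<close>

lemma frequently_slope_interval:
  fixes f :: "real \<Rightarrow> real"
  assumes "\<exists>\<^sub>F y in at x. P ((f y - f x) / (y - x))" "0 < d"
  shows "\<exists>u v. u < v \<and> u \<le> x \<and> x \<le> v \<and> v - u < d \<and> P ((f v - f u) / (v - u))"
proof -
  obtain y where y: "y \<noteq> x" "dist y x < d" "P ((f y - f x) / (y - x))"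
    using assms by (auto simp: frequently_at)
  show ?thesis
  proof (cases "y < x")
    case True
    have "(f x - f y) / (x - y) = (f y - f x) / (y - x)" using True by (simp add: divide_simps) (simp add: algebra_simps)
    then show ?thesis using True y by (intro exI[of _ y] exI[of _ x]) (auto simp: dist_real_def)
  next
    case False
    then show ?thesis using y by (intro exI[of _ x] exI[of _ y]) (auto simp: dist_real_def)
  qed
qed

text \<open>At an interior point without derivative the slopes either are unbounded or lie
  frequently below \<open>p\<close> and frequently above \<open>q\<close> for some rationals
  \<open>p < q\<close>. \<open>steep_negligible\<close> handles the first case,
  \<open>slopes_negligible\<close> each of the countably many pairs in the second.\<close>

lemma abs_cont_on_negligible_nondiff:
  fixes f :: "real \<Rightarrow> real"
  assumes ac: "abs_cont_on {a..b} f"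
    and bv: "\<And>D. D division_of \<Union>D \<Longrightarrow> \<Union>D \<subseteq> {a..b} \<Longrightarrow> (\<Sum>K\<in>D. \<bar>f (Sup K) - f (Inf K)\<bar>) \<le> B"
  shows "negligible {x \<in> {a..b}. \<not> f differentiable at x}"
proof -
  define s where "s = (\<lambda>x y. (f y - f x) / (y - x))"
  define E where "E = (\<lambda>(p::rat, q::rat). {x \<in> {a<..<b}. (\<exists>\<^sub>F y in at x. s x y < of_rat p) \<and> (\<exists>\<^sub>F y in at x. of_rat q < s x y)})"
  define E' where "E' = {x \<in> {a<..<b}. \<forall>M. \<exists>\<^sub>F y in at x. M < \<bar>s x y\<bar>}"
  have "negligible (E (p, q))" if "p < q" for p q
  proof (rule slopes_negligible[OF ac])
    show "real_of_rat p < real_of_rat q" using that by (simp add: of_rat_less)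
    show "E (p, q) \<subseteq> {a<..<b}" by (auto simp: E_def)
    fix x d :: real assume x: "x \<in> E (p,q)" "0 < d"
    then have f: "\<exists>\<^sub>F y in at x. s x y < of_rat p" "\<exists>\<^sub>F y in at x. of_rat q < s x y" by (auto simp: E_def)
    obtain u v where uv: "u < v" "u \<le> x" "x \<le> v" "v - u < d" "(f v - f u) / (v - u) < real_of_rat p"
      using frequently_slope_interval[OF f(1)[unfolded s_def] x(2)] by blast
    then have "f v - f u < real_of_rat p * (v - u)" by (simp add: pos_divide_less_eq)
    then show "\<exists>u v. u < v \<and> u \<le> x \<and> x \<le> v \<and> v - u < d \<and> f v - f u < real_of_rat p * (v - u)"
      using uv(1-4) by blast
    obtain u v where uw: "u < v" "u \<le> x" "x \<le> v" "v - u < d" "real_of_rat q < (f v - f u) / (v - u)"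
      using frequently_slope_interval[OF f(2)[unfolded s_def] x(2)] by blast
    then have "real_of_rat q * (v - u) < f v - f u" by (simp add: pos_less_divide_eq)
    then show "\<exists>u v. u < v \<and> u \<le> x \<and> x \<le> v \<and> v - u < d \<and> real_of_rat q * (v - u) < f v - f u"
      using uw(1-4) by blast
  qed
  then have 1: "negligible (\<Union>(E ` {(p, q). p < q}))"
    by (intro negligible_countable_Union) auto
  have 2: "negligible E'"
  proof (rule steep_negligible[OF _ bv])
    show "E' \<subseteq> {a<..<b}" by (auto simp: E'_def)
    fix M x d :: real assume x: "x \<in> E'" "0 < d"
    then have "\<exists>\<^sub>F y in at x. M < \<bar>s x y\<bar>" by (auto simp: E'_def)
    from frequently_slope_interval[OF this[unfolded s_def] x(2)]
    obtain u v where "u < v" "u \<le> x" "x \<le> v" "v - u < d" "M < \<bar>(f v - f u) / (v - u)\<bar>" by blast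
    then show "\<exists>u v. u < v \<and> u \<le> x \<and> x \<le> v \<and> v - u < d \<and> M * (v - u) < \<bar>f v - f u\<bar>"
      by (intro exI[of _ u] exI[of _ v]) (auto simp: field_simps abs_divide)
  qed
  have "{x \<in> {a..b}. \<not> f differentiable at x} \<subseteq> \<Union>(E ` {(p, q). p < q}) \<union> E' \<union> {a, b}"
  proof (rule subsetI, rule ccontr)
    fix x assume "x \<in> {x \<in> {a..b}. \<not> f differentiable at x}" "x \<notin> \<Union>(E ` {(p, q). p < q}) \<union> E' \<union> {a, b}"
    then have x: "x \<in> {a<..<b}" "\<not> f differentiable at x" "x \<notin> E'" "\<And>p q. p < q \<Longrightarrow> x \<notin> E (p, q)"
      by auto
    then obtain M where "\<not> (\<exists>\<^sub>F y in at x. M < \<bar>s x y\<bar>)" by (auto simp: E'_def)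
    then have "eventually (\<lambda>y. \<bar>(f y - f x) / (y - x)\<bar> \<le> M) (at x)"
      by (simp add: frequently_def s_def not_less)
    from differentiable_if_slopes_converge[OF this] x(2)
    obtain p q where "p < q" "x \<in> E (p, q)" using x(1) unfolding E_def s_def by auto
    then show False using x(4) by blast
  qed
  moreover have "negligible (\<Union>(E ` {(p, q). p < q}) \<union> E' \<union> {a, b})"
    using 1 2 by (auto simp: negligible_Un_eq)
  ultimately show ?thesis by (rule negligible_subset[rotated])
qed

lemma abs_cont_on_subset:
  assumes "abs_cont_on S f" "S' \<subseteq> S"
  shows "abs_cont_on S' f"
  unfolding abs_cont_on_def
proof (intro allI impI)
  fix \<epsilon> :: real assume "\<epsilon> > 0"
  with assms(1) obtain \<delta> where "\<delta> > 0" and *: "\<forall>(n::nat) (u::nat \<Rightarrow> real) v.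
      (\<forall>k<n. u k \<le> v k \<and> u k \<in> S \<and> v k \<in> S) \<and>
      (\<forall>j<n. \<forall>k<n. j \<noteq> k \<longrightarrow> v j \<le> u k \<or> v k \<le> u j) \<and>
      (\<Sum>k<n. v k - u k) < \<delta> \<longrightarrow> (\<Sum>k<n. \<bar>f (v k) - f (u k)\<bar>) < \<epsilon>"
    unfolding abs_cont_on_def by (elim allE[of _ \<epsilon>]) auto
  show "\<exists>\<delta>>0. \<forall>(n::nat) (u::nat \<Rightarrow> real) v.
      (\<forall>k<n. u k \<le> v k \<and> u k \<in> S' \<and> v k \<in> S') \<and>
      (\<forall>j<n. \<forall>k<n. j \<noteq> k \<longrightarrow> v j \<le> u k \<or> v k \<le> u j) \<and>
      (\<Sum>k<n. v k - u k) < \<delta> \<longrightarrow> (\<Sum>k<n. \<bar>f (v k) - f (u k)\<bar>) < \<epsilon>"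
  proof (rule exI[of _ \<delta>], rule conjI[OF \<open>\<delta> > 0\<close>], intro allI impI, elim conjE)
    fix n and u v :: "nat \<Rightarrow> real"
    assume "\<forall>k<n. u k \<le> v k \<and> u k \<in> S' \<and> v k \<in> S'"
      and 2: "\<forall>j<n. \<forall>k<n. j \<noteq> k \<longrightarrow> v j \<le> u k \<or> v k \<le> u j" "(\<Sum>k<n. v k - u k) < \<delta>"
    then have "\<forall>k<n. u k \<le> v k \<and> u k \<in> S \<and> v k \<in> S" using assms(2) by blast
    then show "(\<Sum>k<n. \<bar>f (v k) - f (u k)\<bar>) < \<epsilon>" using * 2 by blast
  qed
qed

section \<open>The fundamental theorem for absolutely continuous functions\<close>

lemma negligible_outer_open:
  assumes "negligible (N :: real set)" "0 < e"
  obtains V where "open V" "N \<subseteq> V" "V \<in> lmeasurable" "measure lebesgue V < e"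
proof -
  have N: "N \<in> lmeasurable" "measure lebesgue N = 0" using assms(1) by (auto simp: negligible_iff_measure)
  obtain T where T: "open T" "N \<subseteq> T" "T - N \<in> lmeasurable" "emeasure lebesgue (T - N) < ennreal e"
    using sets_lebesgue_outer_open[of N e] N(1) \<open>0 < e\<close> by (auto simp: fmeasurableD)
  have "measure lebesgue (T - N) < e" using T(3,4) \<open>0 < e\<close> by (simp add: emeasure_eq_measure2 ennreal_less_iff)
  moreover have "measure lebesgue (N \<union> (T - N)) \<le> measure lebesgue N + measure lebesgue (T - N)"
    using N(1) T(3) by (intro measure_Un_le) auto
  moreover have "N \<union> (T - N) \<in> lmeasurable" by (rule fmeasurable.Un[OF N(1) T(3)])
  moreover have "N \<union> (T - N) = T" using T(2) by blast
  ultimately show ?thesis using that[of T] T N(2) by simp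
qed

text \<open>The estimates on the two sides of \<open>x\<close> add up, because
  \<open>(x - u) + (v - x) = v - u\<close>; this is where it matters that a tag lies in its
  interval.\<close>

lemma derivative_straddle:
  fixes f :: "real \<Rightarrow> real"
  assumes "(f has_real_derivative D) (at x)" "0 < e"
  obtains d where "0 < d" "\<And>u v. u \<le> x \<Longrightarrow> x \<le> v \<Longrightarrow> {u..v} \<subseteq> ball x d \<Longrightarrow> \<bar>f v - f u - D * (v - u)\<bar> \<le> e * (v - u)"
proof -
  obtain d where d: "0 < d" "\<And>y. \<bar>y - x\<bar> < d \<Longrightarrow> \<bar>f y - f x - D * (y - x)\<bar> \<le> e * \<bar>y - x\<bar>"
    using assms unfolding has_field_derivative_def has_derivative_at_alt by (auto simp: mult.commute)
  show ?thesis
  proof (rule that[OF d(1)])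
    fix u v assume uv: "u \<le> x" "x \<le> v" "{u..v} \<subseteq> ball x d"
    then have "u \<in> ball x d" "v \<in> ball x d" by (meson atLeastAtMost_iff order_refl order_trans subsetD)+
    then have "\<bar>u - x\<bar> < d" "\<bar>v - x\<bar> < d" by (auto simp: dist_real_def)
    then have "\<bar>f u - f x - D * (u - x)\<bar> \<le> e * (x - u)" "\<bar>f v - f x - D * (v - x)\<bar> \<le> e * (v - x)"
      using d(2)[of u] d(2)[of v] uv by auto
    then show "\<bar>f v - f u - D * (v - u)\<bar> \<le> e * (v - u)" by (simp add: abs_le_iff algebra_simps)
  qed
qed

text \<open>The gauge integral delivers integrability together with the value. Off \<open>N\<close>
  the gauge makes the Riemann terms match the increments of \<open>f\<close> by straddling; on
  \<open>N\<close> it confines the intervals to an open set so small that absolute continuity bounds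
  their total increment.\<close>

lemma abs_cont_on_has_integral:
  fixes f g :: "real \<Rightarrow> real"
  assumes ac: "abs_cont_on {a..b} f" and "a \<le> b" and N: "negligible N"
    and der: "\<And>x. x \<in> {a..b} - N \<Longrightarrow> (f has_real_derivative g x) (at x)"
  shows "(g has_integral (f b - f a)) {a..b}"
proof -
  \<comment> \<open>\<open>g\<close> is arbitrary on \<open>N\<close>; with value zero there,
    intervals tagged in \<open>N\<close> contribute only their increments of
    \<open>f\<close>.\<close>
  define h where "h = (\<lambda>x. if x \<in> N then 0 else g x)"
  have "(h has_integral (f b - f a)) (cbox a b)"
    unfolding has_integral
  proof (intro allI impI)
    fix e :: real assume "0 < e"
    \<comment> \<open>The straddling errors sum to at most \<open>e2 * (b - a)\<close>; the
      \<open>+ 1\<close> keeps the denominator positive when \<open>a = b\<close>.\<close>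
    define e2 where "e2 = e / (2 * (b - a + 1))"
    have "0 < e2" "e2 * (b - a) \<le> e / 2" using \<open>0 < e\<close> \<open>a \<le> b\<close> by (auto simp: e2_def field_simps)
    obtain \<delta> where "0 < \<delta>" and \<delta>: "\<And>D. D division_of \<Union>D \<Longrightarrow> \<Union>D \<subseteq> {a..b} \<Longrightarrow> (\<Sum>K\<in>D. measure lborel K) < \<delta>
        \<Longrightarrow> (\<Sum>K\<in>D. \<bar>f (Sup K) - f (Inf K)\<bar>) < e/2"
      using abs_cont_on_division[OF ac half_gt_zero[OF \<open>0 < e\<close>]] by blast
    obtain V where V: "open V" "N \<subseteq> V" "V \<in> lmeasurable" "measure lebesgue V < \<delta>"
      using negligible_outer_open[OF N \<open>0 < \<delta>\<close>] .
    have "\<exists>d>0. x \<in> {a..b} - N \<longrightarrow> (\<forall>u v. u \<le> x \<longrightarrow> x \<le> v \<longrightarrow> {u..v} \<subseteq> ball x d \<longrightarrow> \<bar>f v - f u - g x * (v - u)\<bar> \<le> e2 * (v - u))" for x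
    proof (cases "x \<in> {a..b} - N")
      case True
      show ?thesis using derivative_straddle[OF der[OF True] \<open>0 < e2\<close>] by metis
    qed (auto intro: exI[of _ 1])
    then obtain d where d: "\<And>x. 0 < d x" "\<And>x u v. x \<in> {a..b} - N \<Longrightarrow> u \<le> x \<Longrightarrow> x \<le> v \<Longrightarrow> {u..v} \<subseteq> ball x (d x) \<Longrightarrow> \<bar>f v - f u - g x * (v - u)\<bar> \<le> e2 * (v - u)"
      by metis
    define \<gamma> where "\<gamma> = (\<lambda>x. if x \<in> N then V else ball x (d x))"
    have "gauge \<gamma>" unfolding gauge_def \<gamma>_def using V(1,2) d(1) by auto
    moreover have "norm ((\<Sum>(x, K)\<in>p. measure lborel K *\<^sub>R h x) - (f b - f a)) < e"
      if p: "p tagged_division_of cbox a b" "\<gamma> fine p" for p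
    proof -
      have p': "p tagged_division_of {a..b}" using p(1) by simp
      define p1 where "p1 = {(x,K)\<in>p. x \<in> N}"
      have fin: "finite p" using p(1) by blast
      have form: "\<exists>u v. K = {u..v} \<and> u \<le> x \<and> x \<le> v \<and> Inf K = u \<and> Sup K = v \<and> measure lborel K = v - u \<and> x \<in> {a..b} \<and> K \<subseteq> {a..b}"
        if xK: "(x, K) \<in> p" for x K
      proof -
        obtain u v where "K = {u..v}" using tagged_division_ofD(4)[OF p(1) xK] by auto
        then show ?thesis using tagged_division_ofD(2,3)[OF p(1) xK] by auto
      qed
      have p1: "p1 tagged_division_of \<Union>(snd ` p1)"
      proof (rule tagged_partial_division_of_Union_self)
        show "p1 tagged_partial_division_of cbox a b"
        proof (rule tagged_partial_division_subset)
          show "p tagged_partial_division_of cbox a b" using p(1) by (simp add: tagged_division_of_def)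
          show "p1 \<subseteq> p" by (auto simp: p1_def)
        qed
      qed
      have D1: "snd ` p1 division_of \<Union>(snd ` p1)" by (rule division_of_tagged_division[OF p1])
      have sub1: "\<Union>(snd ` p1) \<subseteq> V"
      proof (rule Union_least)
        fix K assume "K \<in> snd ` p1"
        then obtain x where "(x, K) \<in> p" "x \<in> N" by (auto simp: p1_def)
        moreover have "K \<subseteq> \<gamma> x" using p(2) \<open>(x, K) \<in> p\<close> by (auto simp: fine_def)
        ultimately show "K \<subseteq> V" by (simp add: \<gamma>_def)
      qed
      have "(\<Sum>K\<in>snd ` p1. \<bar>f (Sup K) - f (Inf K)\<bar>) < e/2"
      proof (rule \<delta>[OF D1])
        show "\<Union>(snd ` p1) \<subseteq> {a..b}"
        proof (rule Union_least)
          fix K assume "K \<in> snd ` p1"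
          then obtain x where "(x, K) \<in> p" by (auto simp: p1_def)
          then show "K \<subseteq> {a..b}" using form by blast
        qed
        have "(\<Sum>K\<in>snd ` p1. measure lborel K) = measure lebesgue (\<Union>(snd ` p1))"
          by (rule division_sum_lengths(2)[OF D1])
        also have "\<dots> \<le> measure lebesgue V"
          using lmeasurable_division[OF D1] V(3) sub1 by (intro measure_mono_fmeasurable) auto
        finally show "(\<Sum>K\<in>snd ` p1. measure lborel K) < \<delta>" using V(4) by simp
      qed
      moreover have "(\<Sum>(x,K)\<in>p1. \<bar>f (Sup K) - f (Inf K)\<bar>) = (\<Sum>K\<in>snd ` p1. \<bar>f (Sup K) - f (Inf K)\<bar>)"
      proof -
        \<comment> \<open>Two pairs can share an interval only if its interior is empty, so its
          increment vanishes. The value at the empty set is fixed to zero because \<open>Sup\<close>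
          and \<open>Inf\<close> carry no information there.\<close>
        let ?d = "\<lambda>K. if K = {} then 0 else \<bar>f (Sup K) - f (Inf K)\<bar>"
        have ne: "K \<noteq> {}" if "(x, K) \<in> p1" for x K
          using tagged_division_ofD(2)[OF p1 that] by blast
        have "(\<Sum>(x,K)\<in>p1. \<bar>f (Sup K) - f (Inf K)\<bar>) = (\<Sum>(x,K)\<in>p1. ?d K)"
          using ne by (intro sum.cong) auto
        also have "\<dots> = sum ?d (snd ` p1)"
          by (rule sum.over_tagged_division_lemma[OF p1]) (auto simp: box_eq_empty)
        also have "\<dots> = (\<Sum>K\<in>snd ` p1. \<bar>f (Sup K) - f (Inf K)\<bar>)"
          using ne by (intro sum.cong) auto
        finally show ?thesis .
      qed
      ultimately have s1: "(\<Sum>(x,K)\<in>p1. \<bar>f (Sup K) - f (Inf K)\<bar>) < e/2" by simp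
      have incr: "(\<Sum>(x,K)\<in>p. f (Sup K) - f (Inf K)) = f b - f a"
        using additive_tagged_division_1[OF \<open>a \<le> b\<close> p'] .
      have len: "(\<Sum>(x,K)\<in>p. Sup K - Inf K) = b - a"
        using additive_tagged_division_1[OF \<open>a \<le> b\<close> p', of "\<lambda>x. x"] .
      have "(\<Sum>(x, K)\<in>p. measure lborel K *\<^sub>R h x) - (f b - f a)
          = (\<Sum>(x, K)\<in>p. measure lborel K * h x - (f (Sup K) - f (Inf K)))"
        unfolding incr[symmetric] by (simp add: sum_subtractf case_prod_unfold)
      also have "\<bar>\<dots>\<bar> \<le> (\<Sum>(x, K)\<in>p. \<bar>measure lborel K * h x - (f (Sup K) - f (Inf K))\<bar>)"
        using sum_abs[of "\<lambda>(x,K). measure lborel K * h x - (f (Sup K) - f (Inf K))" p] by (simp add: case_prod_unfold)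
      also have "\<dots> \<le> (\<Sum>(x, K)\<in>p. (if x \<in> N then \<bar>f (Sup K) - f (Inf K)\<bar> else 0) + e2 * (Sup K - Inf K))"
      proof (rule sum_mono, clarify)
        fix x K assume xK: "(x,K) \<in> p"
        from form[OF xK] obtain u v where K: "K = {u..v}" "u \<le> x" "x \<le> v" "Inf K = u" "Sup K = v"
            "measure lborel K = v - u" "x \<in> {a..b}" by blast
        have "K \<subseteq> \<gamma> x" using p(2) xK by (auto simp: fine_def)
        then show "\<bar>measure lborel K * h x - (f (Sup K) - f (Inf K))\<bar>
            \<le> (if x \<in> N then \<bar>f (Sup K) - f (Inf K)\<bar> else 0) + e2 * (Sup K - Inf K)"
          using d(2)[of x u v] K \<open>0 < e2\<close> by (auto simp: h_def \<gamma>_def mult.commute abs_minus_commute)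
      qed
      also have "\<dots> = (\<Sum>(x,K)\<in>p. if x \<in> N then \<bar>f (Sup K) - f (Inf K)\<bar> else 0) + e2 * (\<Sum>(x,K)\<in>p. Sup K - Inf K)"
        by (simp add: sum.distrib case_prod_unfold sum_distrib_left)
      also have "(\<Sum>(x,K)\<in>p. if x \<in> N then \<bar>f (Sup K) - f (Inf K)\<bar> else 0) = (\<Sum>(x,K)\<in>p1. \<bar>f (Sup K) - f (Inf K)\<bar>)"
        unfolding p1_def using fin by (intro sum.mono_neutral_cong_right) (auto split: if_splits)
      also have "\<dots> + e2 * (\<Sum>(x,K)\<in>p. Sup K - Inf K) < e"
        using s1 len \<open>e2 * (b - a) \<le> e / 2\<close> by simp
      finally show ?thesis by simp
    qed
    ultimately show "\<exists>\<gamma>. gauge \<gamma> \<and> (\<forall>\<D>. \<D> tagged_division_of cbox a b \<and> \<gamma> fine \<D> \<longrightarrow>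
        norm ((\<Sum>(x, K)\<in>\<D>. measure lborel K *\<^sub>R h x) - (f b - f a)) < e)"
      by (intro exI[of _ \<gamma>] conjI allI impI) auto
  qed
  then show ?thesis
    using has_integral_spike[OF N, of "{a..b}" g h] by (auto simp: h_def)
qed

text \<open>A \<delta> for the tolerance 1 bounds the variation by 1 on every interval shorter than
  \<delta>, which gives a derivative almost everywhere there. It is then gauge integrable with
  indefinite integral \<open>f\<close>, and the bounded variation of \<open>f\<close> makes the
  integral absolute. Short pieces are glued to reach \<open>{a..b}\<close>.\<close>

theorem abs_cont_on_FTC:
  fixes f :: "real \<Rightarrow> real"
  assumes ac: "abs_cont_on {a..b} f" and "a \<le> b"
  shows "negligible {x \<in> {a..b}. \<not> f differentiable at x}"
    and "deriv f absolutely_integrable_on {a..b}"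
    and "(deriv f has_integral (f b - f a)) {a..b}"
proof -
  have FTC: "(deriv f has_integral (f d - f c)) {c..d}"
    if "a \<le> c" "c \<le> d" "d \<le> b" and neg: "negligible {x \<in> {c..d}. \<not> f differentiable at x}" for c d
  proof (rule abs_cont_on_has_integral[OF abs_cont_on_subset[OF ac] \<open>c \<le> d\<close> neg])
    show "{c..d} \<subseteq> {a..b}" using that by auto
    show "(f has_real_derivative deriv f x) (at x)" if "x \<in> {c..d} - {x \<in> {c..d}. \<not> f differentiable at x}" for x
      using that DERIV_deriv_iff_real_differentiable by blast
  qed
  obtain \<delta> where "0 < \<delta>" and \<delta>: "\<And>D. D division_of \<Union>D \<Longrightarrow> \<Union>D \<subseteq> {a..b} \<Longrightarrow> (\<Sum>K\<in>D. measure lborel K) < \<delta>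
        \<Longrightarrow> (\<Sum>K\<in>D. \<bar>f (Sup K) - f (Inf K)\<bar>) < 1"
    using abs_cont_on_division[OF ac zero_less_one] by blast
  let ?Q = "\<lambda>c d. negligible {x \<in> {c..d}. \<not> f differentiable at x} \<and> deriv f absolutely_integrable_on {c..d}"
  have short: "?Q c d" if cd: "a \<le> c" "c \<le> d" "d \<le> b" "d - c < \<delta>" for c d
  proof
    have sub: "{c..d} \<subseteq> {a..b}" using cd by auto
    have bv: "(\<Sum>K\<in>D. \<bar>f (Sup K) - f (Inf K)\<bar>) \<le> 1" if D: "D division_of \<Union>D" "\<Union>D \<subseteq> {c..d}" for D
    proof -
      have "(\<Sum>K\<in>D. measure lborel K) \<le> measure lborel (cbox c d)"
        by (rule subadditive_content_division[OF D(1)]) (use D(2) in simp)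
      then have "(\<Sum>K\<in>D. measure lborel K) < \<delta>" using cd by simp
      then show ?thesis using \<delta>[OF D(1)] D(2) sub by (meson less_imp_le order_trans)
    qed
    show neg: "negligible {x \<in> {c..d}. \<not> f differentiable at x}"
      by (rule abs_cont_on_negligible_nondiff[OF abs_cont_on_subset[OF ac sub] bv])
    have "deriv f absolutely_integrable_on cbox c d"
    proof (rule bounded_variation_absolutely_integrable_interval)
      show "deriv f integrable_on cbox c d" using FTC[OF cd(1-3) neg] by auto
      fix D assume D: "D division_of cbox c d"
      have "norm (integral K (deriv f)) = \<bar>f (Sup K) - f (Inf K)\<bar>" if K: "K \<in> D" for K
      proof -
        obtain u v where uv: "K = {u..v}" "u \<le> v" using division_ofD(3,4)[OF D K] by auto
        have s: "{u..v} \<subseteq> {c..d}" using division_ofD(2)[OF D K] uv by simp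
        then have "a \<le> u" "v \<le> b" using uv(2) cd by auto
        moreover have "negligible {x \<in> {u..v}. \<not> f differentiable at x}"
          by (rule negligible_subset[OF neg]) (use s in auto)
        ultimately have "(deriv f has_integral (f v - f u)) {u..v}" using FTC uv(2) by blast
        then show ?thesis using uv by (simp add: integral_unique)
      qed
      then show "(\<Sum>K\<in>D. norm (integral K (deriv f))) \<le> 1"
        using bv[of D] D division_of_union_self[OF D] division_ofD(6)[OF D] by simp
    qed
    then show "deriv f absolutely_integrable_on {c..d}" by simp
  qed
  \<comment> \<open>Induction on the number of pieces; their length is at most \<delta> / 2, so that
    each is strictly shorter than \<delta>.\<close>
  have "?Q c d" if "a \<le> c" "c \<le> d" "d \<le> b" "d - c \<le> real n * (\<delta> / 2)" for c d n
    using that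
  proof (induction n arbitrary: c)
    case 0
    then show ?case using short[of c d] \<open>0 < \<delta>\<close> by simp
  next
    case (Suc n)
    define m where "m = min d (c + \<delta>/2)"
    have m: "c \<le> m" "m \<le> d" "m - c < \<delta>" "d - m \<le> real n * (\<delta>/2)"
      using Suc.prems \<open>0 < \<delta>\<close> by (auto simp: m_def min_def algebra_simps)
    have Q: "?Q c m" "?Q m d" using short[of c m] Suc.IH[of m] m Suc.prems by auto
    have eq: "{c..m} \<union> {m..d} = {c..d}" using m by auto
    have "negligible ({x \<in> {c..m}. \<not> f differentiable at x} \<union> {x \<in> {m..d}. \<not> f differentiable at x})"
      using Q by (simp add: negligible_Un_eq)
    moreover have "{x \<in> {c..d}. \<not> f differentiable at x}
        = {x \<in> {c..m}. \<not> f differentiable at x} \<union> {x \<in> {m..d}. \<not> f differentiable at x}"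
      using m by auto
    moreover have "deriv f absolutely_integrable_on {c..d}"
      unfolding eq[symmetric] using Q by (intro set_integrable_Un) auto
    ultimately show ?case by simp
  qed
  moreover obtain n where "b - a \<le> real n * (\<delta> / 2)"
    using reals_Archimedean3[of "\<delta>/2"] \<open>0 < \<delta>\<close> less_imp_le by (metis half_gt_zero)
  ultimately have Q: "?Q a b" using \<open>a \<le> b\<close> by blast
  then show "negligible {x \<in> {a..b}. \<not> f differentiable at x}" "deriv f absolutely_integrable_on {a..b}"
    "(deriv f has_integral (f b - f a)) {a..b}" using FTC[of a b] \<open>a \<le> b\<close> by auto
qed

section \<open>Continuity, products, and functions with vanishing integrals\<close>

lemma abs_cont_on_imp_continuous_on:
  assumes "abs_cont_on S f"
  shows "continuous_on S f"
  unfolding continuous_on_iff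
proof (intro ballI allI impI)
  fix x and e :: real assume "x \<in> S" "0 < e"
  obtain \<delta> where "\<delta> > 0" and *: "\<forall>(n::nat) (u::nat \<Rightarrow> real) v.
      (\<forall>k<n. u k \<le> v k \<and> u k \<in> S \<and> v k \<in> S) \<and>
      (\<forall>j<n. \<forall>k<n. j \<noteq> k \<longrightarrow> v j \<le> u k \<or> v k \<le> u j) \<and>
      (\<Sum>k<n. v k - u k) < \<delta> \<longrightarrow> (\<Sum>k<n. \<bar>f (v k) - f (u k)\<bar>) < e"
    using assms[unfolded abs_cont_on_def, rule_format, OF \<open>0 < e\<close>] by (elim exE conjE)
  have "dist (f y) (f x) < e" if "y \<in> S" "dist y x < \<delta>" for y
  proof -
    have "\<bar>f (max x y) - f (min x y)\<bar> < e"
      using *[rule_format, of 1 "\<lambda>_. min x y" "\<lambda>_. max x y"] that \<open>x \<in> S\<close>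
      by (cases "x \<le> y") (simp_all add: dist_real_def min_def max_def)
    then show ?thesis by (simp add: dist_real_def min_def max_def abs_minus_commute split: if_splits)
  qed
  then show "\<exists>d>0. \<forall>y\<in>S. dist y x < d \<longrightarrow> dist (f y) (f x) < e" using \<open>\<delta> > 0\<close> by blast
qed

lemma abs_cont_on_mult_lipschitz:
  assumes ac: "abs_cont_on S f"
    and f: "\<And>x. x \<in> S \<Longrightarrow> \<bar>f x\<bar> \<le> A" and k: "\<And>x. x \<in> S \<Longrightarrow> \<bar>k x\<bar> \<le> M"
    and lip: "\<And>x y. x \<in> S \<Longrightarrow> y \<in> S \<Longrightarrow> \<bar>k x - k y\<bar> \<le> L * \<bar>x - y\<bar>"
  shows "abs_cont_on S (\<lambda>x. f x * k x)"
  unfolding abs_cont_on_def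
proof (intro allI impI)
  fix \<epsilon> :: real assume "\<epsilon> > 0"
  \<comment> \<open>The bounds are enlarged by one to be positive, since \<epsilon> will be divided
    by them.\<close>
  define A' where "A' = \<bar>A\<bar> + 1"
  define M' where "M' = \<bar>M\<bar> + 1"
  define L' where "L' = \<bar>L\<bar> + 1"
  have pos: "0 < A'" "0 < M'" "0 < L'" by (auto simp: A'_def M'_def L'_def)
  have f': "\<bar>f x\<bar> \<le> A'" and k': "\<bar>k x\<bar> \<le> M'" if "x \<in> S" for x
    using f[OF that] k[OF that] by (auto simp: A'_def M'_def)
  have lip': "\<bar>k x - k y\<bar> \<le> L' * \<bar>x - y\<bar>" if "x \<in> S" "y \<in> S" for x y
    using lip[OF that] mult_right_mono[of L L' "\<bar>x - y\<bar>"] unfolding L'_def by linarith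
  have eM: "0 < \<epsilon> / (2 * M')" using \<open>\<epsilon> > 0\<close> pos by simp
  obtain \<delta> where "\<delta> > 0" and *: "\<forall>(n::nat) (u::nat \<Rightarrow> real) v.
      (\<forall>k<n. u k \<le> v k \<and> u k \<in> S \<and> v k \<in> S) \<and>
      (\<forall>j<n. \<forall>k<n. j \<noteq> k \<longrightarrow> v j \<le> u k \<or> v k \<le> u j) \<and>
      (\<Sum>k<n. v k - u k) < \<delta> \<longrightarrow> (\<Sum>k<n. \<bar>f (v k) - f (u k)\<bar>) < \<epsilon> / (2 * M')"
    using ac[unfolded abs_cont_on_def, rule_format, OF eM] by (elim exE conjE)
  define \<eta> where "\<eta> = min \<delta> (\<epsilon> / (2 * A' * L'))"
  have "0 < \<eta>" using \<open>\<delta> > 0\<close> \<open>\<epsilon> > 0\<close> pos by (simp add: \<eta>_def)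
  show "\<exists>\<delta>>0. \<forall>(n::nat) (u::nat \<Rightarrow> real) v.
      (\<forall>k<n. u k \<le> v k \<and> u k \<in> S \<and> v k \<in> S) \<and>
      (\<forall>j<n. \<forall>k<n. j \<noteq> k \<longrightarrow> v j \<le> u k \<or> v k \<le> u j) \<and>
      (\<Sum>k<n. v k - u k) < \<delta> \<longrightarrow> (\<Sum>i<n. \<bar>f (v i) * k (v i) - f (u i) * k (u i)\<bar>) < \<epsilon>"
  proof (rule exI[of _ \<eta>], rule conjI[OF \<open>0 < \<eta>\<close>], intro allI impI, elim conjE)
    fix n and u v :: "nat \<Rightarrow> real"
    assume 1: "\<forall>k<n. u k \<le> v k \<and> u k \<in> S \<and> v k \<in> S"
      and 2: "\<forall>j<n. \<forall>k<n. j \<noteq> k \<longrightarrow> v j \<le> u k \<or> v k \<le> u j" and 3: "(\<Sum>k<n. v k - u k) < \<eta>"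
    have 4: "(\<Sum>k<n. \<bar>f (v k) - f (u k)\<bar>) < \<epsilon> / (2 * M')"
      using 1 2 3 by (intro *[rule_format]) (auto simp: \<eta>_def)
    have "(\<Sum>i<n. \<bar>f (v i) * k (v i) - f (u i) * k (u i)\<bar>)
        \<le> (\<Sum>i<n. M' * \<bar>f (v i) - f (u i)\<bar> + A' * L' * (v i - u i))"
    proof (rule sum_mono)
      fix i assume "i \<in> {..<n}"
      then have i: "u i \<le> v i" "u i \<in> S" "v i \<in> S" using 1 by auto
      have "f (v i) * k (v i) - f (u i) * k (u i) = k (v i) * (f (v i) - f (u i)) + f (u i) * (k (v i) - k (u i))"
        by (simp add: algebra_simps)
      then have "\<bar>f (v i) * k (v i) - f (u i) * k (u i)\<bar> \<le> \<bar>k (v i)\<bar> * \<bar>f (v i) - f (u i)\<bar> + \<bar>f (u i)\<bar> * \<bar>k (v i) - k (u i)\<bar>"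
        by (metis abs_mult abs_triangle_ineq)
      also have "\<dots> \<le> M' * \<bar>f (v i) - f (u i)\<bar> + A' * (L' * \<bar>v i - u i\<bar>)"
        using k'[OF i(3)] f'[OF i(2)] lip'[OF i(3,2)] pos by (intro add_mono mult_mono) auto
      finally show "\<bar>f (v i) * k (v i) - f (u i) * k (u i)\<bar> \<le> M' * \<bar>f (v i) - f (u i)\<bar> + A' * L' * (v i - u i)"
        using i(1) by simp
    qed
    also have "\<dots> = M' * (\<Sum>i<n. \<bar>f (v i) - f (u i)\<bar>) + A' * L' * (\<Sum>i<n. v i - u i)"
      by (simp add: sum.distrib sum_distrib_left)
    also have "\<dots> < M' * (\<epsilon> / (2 * M')) + A' * L' * (\<epsilon> / (2 * A' * L'))"
      using 3 4 pos by (intro add_strict_mono mult_strict_left_mono) (auto simp: \<eta>_def)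
    also have "\<dots> = \<epsilon>" using pos by (simp add: field_simps)
    finally show "(\<Sum>i<n. \<bar>f (v i) * k (v i) - f (u i) * k (u i)\<bar>) < \<epsilon>" .
  qed
qed

text \<open>On a compact interval a bounded derivative makes \<open>k\<close> Lipschitz. Derivatives
  are taken within the interval because the comparison functions are differentiated within
  \<open>I\<close>, one-sidedly at \<open>T\<close>.\<close>

lemma abs_cont_on_mult_C1:
  fixes f k k' :: "real \<Rightarrow> real"
  assumes ac: "abs_cont_on {a..b} f"
    and k: "\<And>x. x \<in> {a..b} \<Longrightarrow> (k has_real_derivative k' x) (at x within {a..b})"
    and k': "continuous_on {a..b} k'"
  shows "abs_cont_on {a..b} (\<lambda>x. f x * k x)"
proof -
  have "continuous_on {a..b} k" using k by (rule DERIV_continuous_on)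
  then have "bounded (f ` {a..b})" "bounded (k ` {a..b})" "bounded (k' ` {a..b})"
    using abs_cont_on_imp_continuous_on[OF ac] k'
    by (auto intro!: compact_imp_bounded compact_continuous_image)
  then obtain A M L where "\<And>x. x \<in> {a..b} \<Longrightarrow> \<bar>f x\<bar> \<le> A" "\<And>x. x \<in> {a..b} \<Longrightarrow> \<bar>k x\<bar> \<le> M"
    and L: "\<And>x. x \<in> {a..b} \<Longrightarrow> \<bar>k' x\<bar> \<le> L"
    unfolding bounded_iff ball_simps real_norm_def by blast
  moreover have "\<bar>k x - k y\<bar> \<le> L * \<bar>x - y\<bar>" if "x \<in> {a..b}" "y \<in> {a..b}" for x y
    using field_differentiable_bound[OF _ k, of L x y] L that by simp
  ultimately show ?thesis using abs_cont_on_mult_lipschitz[OF ac] by blast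
qed

text \<open>By Henstock's lemma the terms of a fine Riemann sum differ from the corresponding
  integrals by little, even when absolute values are summed. With all integrals zero, the Riemann
  sums of \<open>\<bar>D\<bar>\<close> are therefore small, so \<open>\<bar>D\<bar>\<close> has
  gauge integral zero; being nonnegative, it is Lebesgue integrable and vanishes almost
  everywhere.\<close>

lemma negligible_nonzero_if_integrals_zero:
  fixes D :: "real \<Rightarrow> real"
  assumes zero: "\<And>u v. a \<le> u \<Longrightarrow> u \<le> v \<Longrightarrow> v \<le> b \<Longrightarrow> (D has_integral 0) {u..v}" and "a \<le> b"
  shows "negligible {t \<in> {a..b}. D t \<noteq> 0}"
proof -
  have D0: "integral K D = 0" if K: "K = cbox u v" "K \<subseteq> cbox a b" "K \<noteq> {}" for K u v
    using zero[of u v] K by (auto simp: integral_unique)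
  have "((\<lambda>t. \<bar>D t\<bar>) has_integral 0) (cbox a b)"
    unfolding has_integral
  proof (intro allI impI)
    fix e :: real assume "0 < e"
    have "D integrable_on cbox a b" using zero[of a b] \<open>a \<le> b\<close> by auto
    then obtain \<gamma> where \<gamma>: "gauge \<gamma>"
      "\<And>p. p tagged_partial_division_of cbox a b \<Longrightarrow> \<gamma> fine p \<Longrightarrow>
        (\<Sum>(x,K)\<in>p. norm (measure lborel K *\<^sub>R D x - integral K D)) < e"
      using Henstock_lemma[OF _ \<open>0 < e\<close>] by blast
    have "norm ((\<Sum>(x, K)\<in>p. measure lborel K *\<^sub>R \<bar>D x\<bar>) - 0) < e"
      if p: "p tagged_division_of cbox a b" "\<gamma> fine p" for p
    proof -
      have "(\<Sum>(x, K)\<in>p. measure lborel K *\<^sub>R \<bar>D x\<bar>) = (\<Sum>(x,K)\<in>p. norm (measure lborel K *\<^sub>R D x - integral K D))"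
      proof (rule sum.cong[OF refl], clarify)
        fix x K assume xK: "(x, K) \<in> p"
        obtain u v where "K = cbox u v" using tagged_division_ofD(4)[OF p(1) xK] by blast
        then have "integral K D = 0" using D0 tagged_division_ofD(2,3)[OF p(1) xK] by blast
        then show "measure lborel K *\<^sub>R \<bar>D x\<bar> = norm (measure lborel K *\<^sub>R D x - integral K D)"
          by (simp add: abs_mult)
      qed
      moreover have "0 \<le> (\<Sum>(x, K)\<in>p. measure lborel K *\<^sub>R \<bar>D x\<bar>)" by (intro sum_nonneg) auto
      ultimately show ?thesis using \<gamma>(2)[OF _ p(2)] p(1) by (simp add: tagged_division_of_def)
    qed
    then show "\<exists>\<gamma>. gauge \<gamma> \<and> (\<forall>p. p tagged_division_of cbox a b \<and> \<gamma> fine p \<longrightarrow>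
        norm ((\<Sum>(x, K)\<in>p. measure lborel K *\<^sub>R \<bar>D x\<bar>) - 0) < e)"
      using \<gamma>(1) by (intro exI[of _ \<gamma>] conjI allI impI) auto
  qed
  then have hi: "((\<lambda>t. \<bar>D t\<bar>) has_integral 0) {a..b}" by simp
  then have ai: "(\<lambda>t. \<bar>D t\<bar>) absolutely_integrable_on {a..b}"
    by (intro nonnegative_absolutely_integrable_1) auto
  have "(LINT t:{a..b}|lebesgue. \<bar>D t\<bar>) = 0"
    using set_lebesgue_integral_eq_integral(2)[OF ai] hi by (simp add: integral_unique)
  then have "AE t in lebesgue. indicator {a..b} t *\<^sub>R \<bar>D t\<bar> = 0"
    using ai unfolding set_integrable_def set_lebesgue_integral_def
    by (subst (asm) integral_nonneg_eq_0_iff_AE) auto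
  then obtain N where "negligible N" "{t. \<not> (indicator {a..b} t *\<^sub>R \<bar>D t\<bar> = 0)} \<subseteq> N"
    by (auto simp: eventually_ae_filter_negligible)
  then show ?thesis by (elim negligible_subset) (auto simp: indicator_def split: if_splits)
qed

lemma absolutely_integrable_continuous_mult:
  fixes f k :: "real \<Rightarrow> real"
  assumes "continuous_on {a..b} k" "f absolutely_integrable_on {a..b}"
  shows "(\<lambda>x. k x * f x) absolutely_integrable_on {a..b}"
proof (rule absolutely_integrable_bounded_measurable_product_real[OF _ _ _ assms(2)])
  show "k \<in> borel_measurable (lebesgue_on {a..b})"
    using assms(1) by (intro continuous_imp_measurable_on_sets_lebesgue) auto
  show "bounded (k ` {a..b})" using assms(1) by (auto intro!: compact_imp_bounded compact_continuous_image)
qed auto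

section \<open>Left-sided limits at the endpoint\<close>

text \<open>A single description for finite and infinite \<open>x0\<close>. The threshold can be
  raised to \<open>T\<close>, so that all points between it and \<open>x0\<close> lie in the domain
  of the comparison functions.\<close>

lemma eventually_left_filter:
  assumes "ereal T < x0"
  shows "eventually P (left_filter x0) \<longleftrightarrow> (\<exists>b. T \<le> b \<and> ereal b < x0 \<and> (\<forall>t. b < t \<and> ereal t < x0 \<longrightarrow> P t))"
proof (cases x0)
  case (real r)
  then have "T < r" using assms by simp
  then have "eventually P (left_filter x0) \<longleftrightarrow> (\<exists>b<r. \<forall>y>b. y < r \<longrightarrow> P y)"
    using real by (simp add: left_filter_def eventually_at_left[of T])
  also have "\<dots> \<longleftrightarrow> (\<exists>b. T \<le> b \<and> b < r \<and> (\<forall>t. b < t \<and> t < r \<longrightarrow> P t))"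
  proof
    assume "\<exists>b<r. \<forall>y>b. y < r \<longrightarrow> P y"
    then obtain b where "b < r" "\<forall>y>b. y < r \<longrightarrow> P y" by blast
    then show "\<exists>b. T \<le> b \<and> b < r \<and> (\<forall>t. b < t \<and> t < r \<longrightarrow> P t)"
      using \<open>T < r\<close> by (intro exI[of _ "max T b"]) auto
  qed auto
  finally show ?thesis using real by simp
next
  case PInf
  have "(\<exists>N. \<forall>n>N. P n) \<longleftrightarrow> (\<exists>b. T \<le> b \<and> (\<forall>t. b < t \<longrightarrow> P t))"
  proof
    assume "\<exists>N. \<forall>n>N. P n"
    then obtain b where "\<forall>n>b. P n" by blast
    then show "\<exists>b. T \<le> b \<and> (\<forall>t. b < t \<longrightarrow> P t)" by (intro exI[of _ "max T b"]) auto
  qed auto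
  then show ?thesis using PInf by (simp add: left_filter_def eventually_at_top_dense)
qed (use assms in auto)

lemma left_filter_neq_bot:
  assumes "ereal T < x0"
  shows "left_filter x0 \<noteq> bot"
proof -
  have "\<not> eventually (\<lambda>_. False) (left_filter x0)"
    unfolding eventually_left_filter[OF assms] using ereal_dense2 by (metis less_ereal.simps(1))
  then show ?thesis by (auto simp: trivial_limit_def)
qed

lemma eventually_diff_filter:
  assumes "ereal T < x0"
  shows "eventually P (diff_filter x0 f) \<longleftrightarrow>
    (\<exists>b. T \<le> b \<and> ereal b < x0 \<and> (\<forall>t. b < t \<and> ereal t < x0 \<and> f differentiable (at t) \<longrightarrow> P t))"
  unfolding diff_filter_def eventually_inf_principal eventually_left_filter[OF assms] by auto

lemma diff_filter_le_left_filter: "diff_filter x0 f \<le> left_filter x0"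
  by (simp add: diff_filter_def)

section \<open>Quotients by combinations of the comparison functions\<close>

lemma ereal_le_less_trans: "t \<le> y \<Longrightarrow> ereal y < z \<Longrightarrow> ereal t < z"
  using order_le_less_trans[of "ereal t" "ereal y" z] by simp

locale comparison_pair =
  fixes T :: real and x0 :: ereal
    and \<phi>1 \<phi>1' \<phi>2 \<phi>2' f :: "real \<Rightarrow> real"
  assumes Tx0: "ereal T < x0"
    and d1: "\<forall>t\<in>Ival T x0. (\<phi>1 has_real_derivative \<phi>1' t) (at t within Ival T x0)"
    and d2: "\<forall>t\<in>Ival T x0. (\<phi>2 has_real_derivative \<phi>2' t) (at t within Ival T x0)"
    and c1: "continuous_on (Ival T x0) \<phi>1'"
    and c2: "continuous_on (Ival T x0) \<phi>2'"
    and small: "\<phi>2 \<in> o[left_filter x0](\<phi>1)"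
    and nz1: "\<forall>t\<in>Ival T x0. \<phi>1 t \<noteq> 0"
    and nz2: "\<forall>t\<in>Ival T x0. \<phi>2 t \<noteq> 0"
    and nzW: "\<forall>t\<in>Ival T x0. Wr \<phi>1 \<phi>1' \<phi>2 \<phi>2' t \<noteq> 0"
    and ac: "AC_loc T x0 f"
begin

abbreviation "I \<equiv> Ival T x0"
abbreviation "W \<equiv> Wr \<phi>1 \<phi>1' \<phi>2 \<phi>2'"
abbreviation "f1 \<equiv> f1star \<phi>1 \<phi>1' \<phi>2 \<phi>2' f"
abbreviation "f2 \<equiv> f2star \<phi>1 \<phi>1' \<phi>2 \<phi>2' f"

lemma Icc_subset_I: "x \<in> I \<Longrightarrow> y \<in> I \<Longrightarrow> {x..y} \<subseteq> I"
  by (auto simp: Ival_def intro: ereal_le_less_trans)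

text \<open>\<open>f\<close> is differentiated on both sides, the comparison functions within
  \<open>I\<close>; the two notions agree away from \<open>T\<close>.\<close>

lemma at_within_I: "T < t \<Longrightarrow> ereal t < x0 \<Longrightarrow> at t within I = at t"
proof -
  assume t: "T < t" "ereal t < x0"
  have "open {s. T < s \<and> ereal s < x0}" by (intro open_Collect_conj open_Collect_less continuous_intros)
  moreover have "{s. T < s \<and> ereal s < x0} \<subseteq> I" by (auto simp: Ival_def)
  ultimately have "t \<in> interior I" using t by (auto simp: interior_def)
  then show ?thesis by (rule at_within_interior)
qed

lemma continuous_phi: "continuous_on I \<phi>1" "continuous_on I \<phi>2"
  using d1 d2 by (auto intro: DERIV_continuous_on)

lemma continuous_W: "continuous_on I W"
  unfolding Wr_def by (intro continuous_intros continuous_phi c1 c2)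

text \<open>\<open>W\<close> is continuous and has no zero on an interval. Its constant sign makes
  the integral of \<open>\<bar>\<rho>'\<bar>\<close> equal to
  \<open>\<bar>\<rho> y - \<rho> x\<bar>\<close> for every quotient considered below.\<close>

lemma W_sign: obtains \<sigma> :: real where "\<bar>\<sigma>\<bar> = 1" "\<And>t. t \<in> I \<Longrightarrow> \<sigma> * W t > 0"
proof -
  have conn: "connected (W ` I)"
  proof (rule connected_continuous_image[OF continuous_W])
    show "connected I"
      by (rule connectedI_interval) (use Icc_subset_I in \<open>meson atLeastAtMost_iff subsetD\<close>)
  qed
  have T: "T \<in> I" using Tx0 by (auto simp: Ival_def)
  have "sgn (W T) * W t > 0" if t: "t \<in> I" for t
  proof (rule ccontr)
    assume "\<not> ?thesis"
    then have "W T \<le> 0 \<and> 0 \<le> W t \<or> W t \<le> 0 \<and> 0 \<le> W T"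
      using nzW T t by (auto simp: sgn_if not_less split: if_splits)
    then have "0 \<in> W ` I" using connectedD_interval[OF conn] T t by blast
    then show False using nzW by auto
  qed
  then show ?thesis using that[of "sgn (W T)"] nzW T by (auto simp: abs_sgn_eq)
qed

text \<open>The terms with \<open>deriv f\<close> cancel, so the identity holds at every point of
  \<open>I\<close>, whether or not \<open>f\<close> is differentiable there.\<close>

lemma contact_eq: "t \<in> I \<Longrightarrow> f t = f1 t * \<phi>1 t + f2 t * \<phi>2 t"
proof -
  assume "t \<in> I"
  then have W: "W t \<noteq> 0" using nzW by blast
  then have "f1 t * W t = Wr f (deriv f) \<phi>2 \<phi>2' t" "f2 t * W t = - Wr f (deriv f) \<phi>1 \<phi>1' t"
    by (simp_all add: f1star_def f2star_def)
  moreover have "Wr f (deriv f) \<phi>2 \<phi>2' t * \<phi>1 t - Wr f (deriv f) \<phi>1 \<phi>1' t * \<phi>2 t = f t * W t"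
    by (simp add: Wr_def algebra_simps)
  ultimately have "(f1 t * \<phi>1 t + f2 t * \<phi>2 t) * W t = f t * W t"
    by (simp add: algebra_simps)
  then show ?thesis using W by simp
qed

lemma ratio_tendsto_0: "((\<lambda>t. \<phi>2 t / \<phi>1 t) \<longlongrightarrow> 0) (left_filter x0)"
  using small by (rule smalloD_tendsto)

lemma eventually_I: "eventually (\<lambda>t. t \<in> I \<and> T < t) (left_filter x0)"
  unfolding eventually_left_filter[OF Tx0] using Tx0 by (intro exI[of _ T]) (auto simp: Ival_def)

lemma eventually_I_diff: "eventually (\<lambda>t. t \<in> I \<and> T < t) (diff_filter x0 f)"
  using eventually_I diff_filter_le_left_filter by (rule filter_leD[rotated])

lemma left_imp_diff: "(g \<longlongrightarrow> l) (left_filter x0) \<Longrightarrow> (g \<longlongrightarrow> l) (diff_filter x0 f)" for g :: "real \<Rightarrow> real"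
  using diff_filter_le_left_filter by (rule tendsto_mono)

lemma ac_Icc: "x \<in> I \<Longrightarrow> y \<in> I \<Longrightarrow> abs_cont_on {x..y} f"
  using ac by (auto simp: AC_loc_def)

lemma nondiff_negligible: "x \<in> I \<Longrightarrow> y \<in> I \<Longrightarrow> negligible {t \<in> {x..y}. \<not> f differentiable at t}"
proof (cases "x \<le> y")
  case True
  then show "x \<in> I \<Longrightarrow> y \<in> I \<Longrightarrow> ?thesis" using abs_cont_on_FTC(1)[OF ac_Icc] by blast
qed auto

text \<open>A null set contains no interval, so points of differentiability accumulate at
  \<open>x0\<close>. Uniqueness of limits along \<open>diff_filter\<close> rests on this.\<close>

lemma diff_filter_neq_bot: "diff_filter x0 f \<noteq> bot"
proof
  assume "diff_filter x0 f = bot"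
  then have "eventually (\<lambda>_. False) (diff_filter x0 f)" by simp
  then obtain b where b: "T \<le> b" "ereal b < x0" "\<And>t. b < t \<Longrightarrow> ereal t < x0 \<Longrightarrow> \<not> f differentiable (at t)"
    unfolding eventually_diff_filter[OF Tx0] by blast
  obtain c where c: "b < c" "ereal c < x0" using ereal_dense2[OF b(2)] by auto
  have I: "b \<in> I" "c \<in> I" using b(1,2) c by (auto simp: Ival_def)
  have "{b<..<c} \<subseteq> {t \<in> {b..c}. \<not> f differentiable at t}"
  proof
    fix t assume t: "t \<in> {b<..<c}"
    then have "ereal t < x0" using ereal_le_less_trans[OF _ c(2), of t] by simp
    then show "t \<in> {t \<in> {b..c}. \<not> f differentiable at t}" using b(3) t by auto
  qed
  then have "negligible {b<..<c}" using nondiff_negligible[OF I] negligible_subset by blast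
  then show False using c(1) by (metis open_greaterThanLessThan open_not_negligible greaterThanLessThan_empty_iff not_le)
qed

end

text \<open>The denominators \<open>\<phi>1\<close> and \<open>\<Phi>\<close> are both of the form
  \<open>\<psi> = \<alpha> \<phi>1 - \<beta> \<phi>2\<close>. With \<open>\<rho> = \<phi>2 / (\<alpha> \<psi>)\<close> one has \<open>\<rho>' = W / \<psi>\<^sup>2\<close>
  and \<open>(f / \<psi>)' = \<rho>' (\<alpha> f\<^sub>2\<^sup>* + \<beta> f\<^sub>1\<^sup>*)\<close>. The set \<open>J\<close> allows
  for the zero of \<open>\<Phi>\<close> at \<open>T\<close>.\<close>

locale comparison_quotient = comparison_pair +
  fixes J :: "real set" and \<alpha> \<beta> :: real
  assumes J: "J \<subseteq> I" "\<And>t. T < t \<Longrightarrow> ereal t < x0 \<Longrightarrow> t \<in> J"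
    and \<alpha>: "\<alpha> \<noteq> 0"
    and nz: "\<And>t. t \<in> J \<Longrightarrow> \<alpha> * \<phi>1 t - \<beta> * \<phi>2 t \<noteq> 0"
begin

definition "\<psi> t = \<alpha> * \<phi>1 t - \<beta> * \<phi>2 t"
definition "\<psi>' t = \<alpha> * \<phi>1' t - \<beta> * \<phi>2' t"
text \<open>Among the antiderivatives of \<open>W / \<psi>\<^sup>2\<close> this is the one that
  vanishes at \<open>x0\<close>.\<close>

definition "\<rho> t = \<phi>2 t / (\<alpha> * \<psi> t)"
definition "\<rho>' t = W t / (\<psi> t)\<^sup>2"
definition "h t = f t / \<psi> t"
definition "G t = \<alpha> * f2 t + \<beta> * f1 t"

lemma J_up: "x \<in> J \<Longrightarrow> x \<le> y \<Longrightarrow> ereal y < x0 \<Longrightarrow> y \<in> J"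
proof -
  assume "x \<in> J" "x \<le> y" "ereal y < x0"
  then have "T \<le> x" using J(1) by (auto simp: Ival_def)
  then show "y \<in> J" using J(2)[of y] \<open>x \<in> J\<close> \<open>x \<le> y\<close> \<open>ereal y < x0\<close> by (cases "x = y") auto
qed

lemma J_D: "t \<in> J \<Longrightarrow> T \<le> t \<and> ereal t < x0 \<and> t \<in> I"
  using J(1) by (auto simp: Ival_def)

lemma Icc_subset_J: "x \<in> J \<Longrightarrow> y \<in> J \<Longrightarrow> {x..y} \<subseteq> J"
proof
  fix t assume "x \<in> J" "y \<in> J" "t \<in> {x..y}"
  then have "x \<le> t" "ereal t < x0" using J_D[of y] by (auto intro: ereal_le_less_trans)
  then show "t \<in> J" using J_up[OF \<open>x \<in> J\<close>] by blast
qed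

lemma psi_nz: "t \<in> J \<Longrightarrow> \<psi> t \<noteq> 0"
  using nz by (auto simp: \<psi>_def)

lemma psi_deriv: "t \<in> I \<Longrightarrow> (\<psi> has_real_derivative \<psi>' t) (at t within I)"
  unfolding \<psi>_def \<psi>'_def using d1 d2 by (auto intro!: derivative_eq_intros)

lemma continuous_psi: "continuous_on I \<psi>" "continuous_on I \<psi>'"
  unfolding \<psi>_def \<psi>'_def by (intro continuous_intros continuous_phi c1 c2)+

lemma rho_deriv: "t \<in> J \<Longrightarrow> (\<rho> has_real_derivative \<rho>' t) (at t within I)"
proof -
  assume t: "t \<in> J"
  note p = psi_nz[OF t]
  have "((\<lambda>t. \<phi>2 t / (\<alpha> * \<psi> t)) has_real_derivative
      (\<phi>2' t * (\<alpha> * \<psi> t) - \<phi>2 t * (\<alpha> * \<psi>' t)) / ((\<alpha> * \<psi> t) * (\<alpha> * \<psi> t))) (at t within I)"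
    using J_D[OF t] d2 p \<alpha> by (intro DERIV_divide DERIV_cmult psi_deriv) auto
  moreover have "(\<phi>2' t * (\<alpha> * \<psi> t) - \<phi>2 t * (\<alpha> * \<psi>' t)) = \<alpha> * \<alpha> * W t"
    by (simp add: \<psi>_def \<psi>'_def Wr_def algebra_simps)
  then have "(\<phi>2' t * (\<alpha> * \<psi> t) - \<phi>2 t * (\<alpha> * \<psi>' t)) / ((\<alpha> * \<psi> t) * (\<alpha> * \<psi> t)) = \<rho>' t"
    using \<alpha> p by (simp add: \<rho>'_def power2_eq_square)
  ultimately show ?thesis unfolding \<rho>_def[abs_def] by simp
qed

lemma continuous_rho': "continuous_on J \<rho>'"
  unfolding \<rho>'_def
  by (intro continuous_intros continuous_on_subset[OF continuous_W J(1)] continuous_on_subset[OF continuous_psi(1) J(1)])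
     (use psi_nz in auto)

lemma rho_integral: "x \<in> J \<Longrightarrow> y \<in> J \<Longrightarrow> x \<le> y \<Longrightarrow> (\<rho>' has_integral (\<rho> y - \<rho> x)) {x..y}"
proof (rule fundamental_theorem_of_calculus)
  fix t assume "x \<in> J" "y \<in> J" "t \<in> {x..y}"
  then have "t \<in> J" "{x..y} \<subseteq> I" using Icc_subset_J J(1) by blast+
  then show "(\<rho> has_vector_derivative \<rho>' t) (at t within {x..y})"
    using DERIV_subset[OF rho_deriv] has_real_derivative_iff_has_vector_derivative by blast
qed

lemma rho_tendsto_0: "(\<rho> \<longlongrightarrow> 0) (left_filter x0)"
proof -
  \<comment> \<open>Numerator and denominator of \<open>\<rho>\<close> are divided by
    \<open>\<phi>1\<close>; the denominator then tends to the square of \<alpha>.\<close>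
  have "((\<lambda>t. (\<phi>2 t / \<phi>1 t) / (\<alpha> * (\<alpha> - \<beta> * (\<phi>2 t / \<phi>1 t)))) \<longlongrightarrow> 0 / (\<alpha> * (\<alpha> - \<beta> * 0))) (left_filter x0)"
    using \<alpha> by (intro tendsto_intros ratio_tendsto_0) auto
  moreover have "eventually (\<lambda>t. (\<phi>2 t / \<phi>1 t) / (\<alpha> * (\<alpha> - \<beta> * (\<phi>2 t / \<phi>1 t))) = \<rho> t) (left_filter x0)"
    using eventually_I
  proof eventually_elim
    case (elim t)
    then have "\<phi>1 t \<noteq> 0" using nz1 by auto
    then have "\<alpha> - \<beta> * (\<phi>2 t / \<phi>1 t) = \<psi> t / \<phi>1 t" by (simp add: \<psi>_def field_simps)
    then show ?case using \<open>\<phi>1 t \<noteq> 0\<close> by (simp add: \<rho>_def)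
  qed
  ultimately show ?thesis by (simp add: filterlim_cong)
qed

lemma quotient_deriv:
  assumes t: "T < t" "ereal t < x0" and "f differentiable at t"
  shows "(h has_real_derivative \<rho>' t * G t) (at t)"
proof -
  have tJ: "t \<in> J" using J(2) t .
  have "(f has_real_derivative deriv f t) (at t)"
    using assms(3) DERIV_deriv_iff_real_differentiable by blast
  moreover have "(\<psi> has_real_derivative \<psi>' t) (at t)"
    using psi_deriv[of t] at_within_I[OF t] J_D[OF tJ] by simp
  ultimately have "((\<lambda>t. f t / \<psi> t) has_real_derivative (deriv f t * \<psi> t - f t * \<psi>' t) / (\<psi> t * \<psi> t)) (at t)"
    using psi_nz[OF tJ] by (rule DERIV_divide)
  moreover have "W t * G t = deriv f t * \<psi> t - f t * \<psi>' t"
    using nzW J_D[OF tJ] by (simp add: G_def f1star_def f2star_def \<psi>_def \<psi>'_def divide_simps) (simp add: Wr_def algebra_simps)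
  ultimately show ?thesis
    unfolding h_def[abs_def] \<rho>'_def by (simp add: power2_eq_square)
qed

lemma quotient_FTC:
  assumes x: "x \<in> J" and y: "y \<in> J" and "x \<le> y"
  shows "((\<lambda>t. \<rho>' t * G t) has_integral (h y - h x)) {x..y}"
proof -
  have sJ: "{x..y} \<subseteq> J" using Icc_subset_J x y by blast
  then have sI: "{x..y} \<subseteq> I" using J(1) by blast
  have xI: "x \<in> I" "y \<in> I" using x y J_D by auto
  have ach: "abs_cont_on {x..y} (\<lambda>t. f t * (1 / \<psi> t))"
  proof (rule abs_cont_on_mult_C1[OF ac_Icc[OF xI]])
    show "((\<lambda>t. 1 / \<psi> t) has_real_derivative (- \<psi>' t / (\<psi> t * \<psi> t))) (at t within {x..y})" if "t \<in> {x..y}" for t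
      using DERIV_subset[OF psi_deriv sI, of t] that sI sJ psi_nz
      by (auto intro!: derivative_eq_intros)
    show "continuous_on {x..y} (\<lambda>t. - \<psi>' t / (\<psi> t * \<psi> t))"
      using sJ psi_nz by (intro continuous_intros continuous_on_subset[OF continuous_psi(1) sI]
         continuous_on_subset[OF continuous_psi(2) sI]) auto
  qed
  then have "abs_cont_on {x..y} h" by (simp add: h_def[abs_def])
  then show ?thesis
  proof (rule abs_cont_on_has_integral[OF _ \<open>x \<le> y\<close>])
    \<comment> \<open>\<open>T\<close> joins the exceptional set because \<open>\<psi>\<close> has
      only a one-sided derivative there.\<close>
    show "negligible ({t \<in> {x..y}. \<not> f differentiable at t} \<union> {T})"
      using nondiff_negligible[OF xI] by (simp add: negligible_Un_eq)
    fix t assume "t \<in> {x..y} - ({t \<in> {x..y}. \<not> f differentiable at t} \<union> {T})"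
    then have "t \<in> J" "t \<noteq> T" "f differentiable at t" using sJ by auto
    then show "(h has_real_derivative \<rho>' t * G t) (at t)"
      using J_D[of t] by (intro quotient_deriv) auto
  qed
qed

lemma quotient_FTC_shift:
  assumes "x \<in> J" "y \<in> J" "x \<le> y"
  shows "((\<lambda>t. \<rho>' t * (G t - k)) has_integral (h y - h x - k * (\<rho> y - \<rho> x))) {x..y}"
  using has_integral_diff[OF quotient_FTC[OF assms] has_integral_mult_right[OF rho_integral[OF assms], of k]]
  by (simp add: algebra_simps)

text \<open>A weighted mean value estimate: \<open>\<rho>'\<close> has constant sign, so its modulus
  integrates to \<open>\<bar>\<rho> y - \<rho> x\<bar>\<close>. \<open>F\<close> will be
  \<open>G - k\<close>, known off a null set, or the error function of a representation.\<close>

lemma bounded_by_rho: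
  assumes x: "x \<in> J" and y: "y \<in> J" and "x \<le> y"
    and int: "((\<lambda>t. \<rho>' t * F t) has_integral i) {x..y}" and N: "negligible N"
    and le: "\<And>t. t \<in> {x..y} - N \<Longrightarrow> \<bar>F t\<bar> \<le> \<epsilon>"
  shows "\<bar>i\<bar> \<le> \<epsilon> * \<bar>\<rho> y - \<rho> x\<bar>"
proof -
  obtain \<sigma> :: real where \<sigma>: "\<bar>\<sigma>\<bar> = 1" "\<And>t. t \<in> I \<Longrightarrow> \<sigma> * W t > 0" using W_sign by blast
  have sJ: "{x..y} \<subseteq> J" using Icc_subset_J x y by blast
  have ab: "\<bar>\<rho>' t\<bar> = \<sigma> * \<rho>' t" if "t \<in> {x..y}" for t
  proof -
    have "t \<in> I" using that sJ J(1) by blast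
    then have "\<sigma> * \<rho>' t \<ge> 0" using \<sigma>(2)[of t] by (simp add: \<rho>'_def)
    moreover have "\<bar>\<sigma> * \<rho>' t\<bar> = \<bar>\<rho>' t\<bar>" using \<sigma>(1) by (simp add: abs_mult)
    ultimately show ?thesis by simp
  qed
  define F' where "F' = (\<lambda>t. if t \<in> N then 0 else \<rho>' t * F t)"
  have i1: "(F' has_integral i) {x..y}"
    using has_integral_spike[OF N _ int, of F'] by (auto simp: F'_def)
  have i2: "((\<lambda>t. \<bar>\<epsilon>\<bar> * (\<sigma> * \<rho>' t)) has_integral (\<bar>\<epsilon>\<bar> * (\<sigma> * (\<rho> y - \<rho> x)))) {x..y}"
    by (intro has_integral_mult_right rho_integral x y \<open>x \<le> y\<close>)
  have "norm (integral {x..y} F') \<le> integral {x..y} (\<lambda>t. \<bar>\<epsilon>\<bar> * (\<sigma> * \<rho>' t))"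
  proof (rule integral_norm_bound_integral)
    show "norm (F' t) \<le> \<bar>\<epsilon>\<bar> * (\<sigma> * \<rho>' t)" if "t \<in> {x..y}" for t
    proof (cases "t \<in> N")
      case False
      have "\<bar>\<rho>' t\<bar> * \<bar>F t\<bar> \<le> \<bar>\<rho>' t\<bar> * \<bar>\<epsilon>\<bar>" using le[of t] that False by (intro mult_left_mono) auto
      then show ?thesis using False ab[OF that] by (simp add: F'_def abs_mult mult.commute)
    qed (use ab[OF that] in \<open>simp add: F'_def flip: ab[OF that]\<close>)
  qed (use i1 i2 in auto)
  then have "\<bar>i\<bar> \<le> \<bar>\<epsilon>\<bar> * (\<sigma> * (\<rho> y - \<rho> x))"
    unfolding integral_unique[OF i1] integral_unique[OF i2] by simp
  also have "\<dots> \<le> \<bar>\<epsilon>\<bar> * \<bar>\<sigma> * (\<rho> y - \<rho> x)\<bar>" by (intro mult_left_mono) auto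
  finally have *: "\<bar>i\<bar> \<le> \<bar>\<epsilon>\<bar> * \<bar>\<rho> y - \<rho> x\<bar>" using \<sigma>(1) by (simp add: abs_mult)
  show ?thesis
  \<comment> \<open>A negative \<epsilon> is possible only if \<open>N\<close> contains the whole
    interval, which then is a single point.\<close>
  proof (cases "\<epsilon> \<ge> 0")
    case False
    then have "{x..y} \<subseteq> N" using le by fastforce
    then have "negligible {x..y}" using N negligible_subset by blast
    then have "x = y" using \<open>x \<le> y\<close> by (metis negligible_interval(1) box_real(2) box_real(1) greaterThanLessThan_empty_iff order_antisym)
    then show ?thesis using * by simp
  qed (use * in simp)
qed

lemma quotient_increment_bound:
  assumes x: "x \<in> J" and "x \<le> y" and y: "ereal y < x0"
    and le: "\<And>t. x < t \<Longrightarrow> ereal t < x0 \<Longrightarrow> f differentiable at t \<Longrightarrow> \<bar>G t - k\<bar> \<le> \<epsilon>"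
  shows "\<bar>h y - h x - k * (\<rho> y - \<rho> x)\<bar> \<le> \<epsilon> * \<bar>\<rho> y - \<rho> x\<bar>"
proof -
  have yJ: "y \<in> J" using J_up x \<open>x \<le> y\<close> y by blast
  show ?thesis
  proof (rule bounded_by_rho[OF x yJ \<open>x \<le> y\<close> quotient_FTC_shift[OF x yJ \<open>x \<le> y\<close>]])
    show "negligible ({t \<in> {x..y}. \<not> f differentiable at t} \<union> {x})"
      using nondiff_negligible[of x y] J_D x yJ by (simp add: negligible_Un_eq)
    fix t assume "t \<in> {x..y} - ({t \<in> {x..y}. \<not> f differentiable at t} \<union> {x})"
    then show "\<bar>G t - k\<bar> \<le> \<epsilon>" using y by (intro le) (auto intro: ereal_le_less_trans)
  qed
qed

lemma quotient_tendsto: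
  assumes G: "(G \<longlongrightarrow> g) (diff_filter x0 f)"
  obtains l where "(h \<longlongrightarrow> l) (left_filter x0)"
proof -
  have "eventually (\<lambda>t. dist (G t) g < 1) (diff_filter x0 f)"
    using G by (rule tendstoD) simp
  then obtain b where b: "T \<le> b" "ereal b < x0" "\<And>t. b < t \<Longrightarrow> ereal t < x0 \<Longrightarrow> f differentiable at t \<Longrightarrow> \<bar>G t - g\<bar> \<le> 1"
    unfolding eventually_diff_filter[OF Tx0] dist_real_def by fastforce
  \<comment> \<open>Near \<open>x0\<close> the modulus of \<open>G\<close> is at most
    \<open>c\<close> at points of differentiability, so \<open>h\<close> is Lipschitz with respect
    to \<open>\<rho>\<close> with this constant.\<close>
  define c where "c = \<bar>g\<bar> + 1"
  have "c > 0" by (simp add: c_def)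
  have bound: "\<bar>h y - h x\<bar> \<le> c * \<bar>\<rho> y - \<rho> x\<bar>" if "b < x" "x \<le> y" "ereal y < x0" for x y
  proof -
    have "x \<in> J" using J(2)[of x] that b(1) by (auto intro: ereal_le_less_trans)
    then have "\<bar>h y - h x - g * (\<rho> y - \<rho> x)\<bar> \<le> 1 * \<bar>\<rho> y - \<rho> x\<bar>"
      using that b(3) by (intro quotient_increment_bound) auto
    moreover have "\<bar>g * (\<rho> y - \<rho> x)\<bar> = \<bar>g\<bar> * \<bar>\<rho> y - \<rho> x\<bar>" by (simp add: abs_mult)
    ultimately show ?thesis unfolding c_def by (simp add: algebra_simps)
  qed
  have "cauchy_filter (filtermap h (left_filter x0))"
    unfolding cauchy_filter_metric_filtermap
  proof (intro allI impI)
    fix e :: real assume "0 < e"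
    define P where "P = (\<lambda>x. b < x \<and> ereal x < x0 \<and> \<bar>\<rho> x\<bar> < e / (2 * c))"
    have "eventually P (left_filter x0)"
    proof -
      have "eventually (\<lambda>x. b < x \<and> ereal x < x0) (left_filter x0)"
        unfolding eventually_left_filter[OF Tx0] using b by blast
      moreover have "eventually (\<lambda>x. dist (\<rho> x) 0 < e / (2 * c)) (left_filter x0)"
        using rho_tendsto_0 by (rule tendstoD) (use \<open>0 < e\<close> \<open>0 < c\<close> in simp)
      ultimately show ?thesis unfolding P_def by eventually_elim simp
    qed
    moreover have "dist (h x) (h y) < e" if "P x" "P y" for x y
    proof -
      have "\<bar>h y - h x\<bar> \<le> c * \<bar>\<rho> y - \<rho> x\<bar>"
        using bound[of x y] bound[of y x] that by (cases "x \<le> y") (auto simp: P_def abs_minus_commute)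
      also have "\<bar>\<rho> y - \<rho> x\<bar> < e / (2 * c) + e / (2 * c)" using that by (auto simp: P_def abs_less_iff)
      then have "c * \<bar>\<rho> y - \<rho> x\<bar> < e" using \<open>c > 0\<close> by (simp add: field_simps)
      finally show ?thesis by (simp add: dist_real_def abs_minus_commute)
    qed
    ultimately show "\<exists>P. eventually P (left_filter x0) \<and> (\<forall>x y. P x \<and> P y \<longrightarrow> dist (h x) (h y) < e)" by blast
  qed
  then have "\<exists>l. filtermap h (left_filter x0) \<le> nhds l"
    by (rule cauchy_filter_complete_converges[where A = UNIV])
       (auto simp: complete_UNIV filtermap_bot_iff left_filter_neq_bot[OF Tx0])
  then show ?thesis using that by (auto simp: filterlim_def)
qed

end

section \<open>Convergence of the contact coefficients and integral representations\<close>

context comparison_pair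
begin

text \<open>Property (iii) with explicit limits, the hub to which every other property is
  compared.\<close>

definition "coeffs_tendsto a1 a2 \<longleftrightarrow> (f1 \<longlongrightarrow> a1) (diff_filter x0 f) \<and> (f2 \<longlongrightarrow> a2) (diff_filter x0 f)"

lemma coeffs_tendsto_unique: "coeffs_tendsto a1 a2 \<Longrightarrow> coeffs_tendsto b1 b2 \<Longrightarrow> b1 = a1 \<and> b2 = a2"
  unfolding coeffs_tendsto_def using tendsto_unique[OF diff_filter_neq_bot] by blast

end

context comparison_quotient
begin

text \<open>With \<open>\<psi> = \<phi>1\<close> and \<open>J = I\<close> this is
  \<open>rep_vii\<close>; with \<open>\<psi> = PhiT T \<phi>1 \<phi>2\<close> and the points beyond
  \<open>T\<close> it is \<open>rep_vi\<close>.\<close>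

definition "rep a1 a2 F \<longleftrightarrow> (\<forall>x\<in>J. \<exists>L. improper_int_to (\<lambda>t. \<rho>' t * F t) x x0 L \<and>
    f x = a1 * \<phi>1 x + a2 * \<phi>2 x - \<psi> x * L)"

lemma eventually_J: "x \<in> J \<Longrightarrow> eventually (\<lambda>y. x < y \<and> y \<in> J \<and> ereal y < x0) (left_filter x0)"
  unfolding eventually_left_filter[OF Tx0]
  using J_D[of x] J_up[of x] by (intro exI[of _ x]) auto

lemma J_nonempty: obtains x where "x \<in> J" "T < x"
  using ereal_dense2[OF Tx0] J(2) by (metis less_ereal.simps(1))

lemma psi_ratio: "t \<in> I \<Longrightarrow> \<psi> t / \<phi>1 t = \<alpha> - \<beta> * (\<phi>2 t / \<phi>1 t)"
  using nz1 by (auto simp: \<psi>_def field_simps)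

text \<open>The limit of \<open>h\<close> gives that of \<open>f / \<phi>1\<close>. The contact
  identity divided by \<open>\<phi>1\<close> and the definition of \<open>G\<close> are two linear
  equations for \<open>f1\<close> and \<open>f2\<close>; up to sign their determinant is
  \<open>\<alpha> - \<beta> * (\<phi>2 / \<phi>1)\<close>, which tends to \<alpha>.\<close>

lemma G_tendsto_imp_coeffs:
  assumes G: "(G \<longlongrightarrow> g) (diff_filter x0 f)"
  obtains a1 a2 where "coeffs_tendsto a1 a2" "(h \<longlongrightarrow> a1 / \<alpha>) (left_filter x0)" "g = \<alpha> * a2 + \<beta> * a1"
proof -
  obtain l where l: "(h \<longlongrightarrow> l) (left_filter x0)" using quotient_tendsto[OF G] .
  define a1 where "a1 = l * \<alpha>"
  \<comment> \<open>Forced by \<open>g = \<alpha> * a2 + \<beta> * a1\<close>.\<close>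
  define a2 where "a2 = (g - \<beta> * a1) / \<alpha>"
  let ?s = "\<lambda>t. \<phi>2 t / \<phi>1 t" and ?Q = "\<lambda>t. f t / \<phi>1 t"
  have "((\<lambda>t. h t * (\<alpha> - \<beta> * ?s t)) \<longlongrightarrow> l * (\<alpha> - \<beta> * 0)) (left_filter x0)"
    by (intro tendsto_intros l ratio_tendsto_0)
  moreover have "eventually (\<lambda>t. h t * (\<alpha> - \<beta> * ?s t) = ?Q t) (left_filter x0)"
    using eventually_I
  proof eventually_elim
    case (elim t)
    then have "t \<in> J" using J(2) by (auto simp: Ival_def)
    then show ?case
      using psi_nz[of t] elim psi_ratio[of t, symmetric] by (simp add: h_def)
  qed
  ultimately have Q: "(?Q \<longlongrightarrow> a1) (diff_filter x0 f)"
    using left_imp_diff by (simp add: a1_def filterlim_cong)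
  have s: "(?s \<longlongrightarrow> 0) (diff_filter x0 f)" using left_imp_diff ratio_tendsto_0 .
  have "((\<lambda>t. (G t - \<beta> * ?Q t) / (\<alpha> - \<beta> * ?s t)) \<longlongrightarrow> (g - \<beta> * a1) / (\<alpha> - \<beta> * 0)) (diff_filter x0 f)"
    using \<alpha> by (intro tendsto_intros G Q s) auto
  moreover have "eventually (\<lambda>t. (G t - \<beta> * ?Q t) / (\<alpha> - \<beta> * ?s t) = f2 t) (diff_filter x0 f)"
    using eventually_I_diff
  proof eventually_elim
    case (elim t)
    then have p: "\<phi>1 t \<noteq> 0" "t \<in> J" using nz1 J(2) by (auto simp: Ival_def)
    have "?Q t = f1 t + f2 t * ?s t" using contact_eq[of t] elim p(1) by (simp add: field_simps)
    then have "G t - \<beta> * ?Q t = (\<alpha> - \<beta> * ?s t) * f2 t" by (simp add: G_def algebra_simps)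
    moreover have "\<alpha> - \<beta> * ?s t \<noteq> 0" using psi_ratio[of t] elim psi_nz[OF p(2)] p(1) by auto
    ultimately show ?case by simp
  qed
  ultimately have f2: "(f2 \<longlongrightarrow> a2) (diff_filter x0 f)" by (simp add: a2_def filterlim_cong)
  have "((\<lambda>t. ?Q t - f2 t * ?s t) \<longlongrightarrow> a1 - a2 * 0) (diff_filter x0 f)"
    by (intro tendsto_intros Q f2 s)
  moreover have "eventually (\<lambda>t. ?Q t - f2 t * ?s t = f1 t) (diff_filter x0 f)"
    using eventually_I_diff
  proof eventually_elim
    case (elim t)
    then have "\<phi>1 t \<noteq> 0" using nz1 by auto
    then show ?case using contact_eq[of t] elim by (simp add: field_simps)
  qed
  ultimately have f1: "(f1 \<longlongrightarrow> a1) (diff_filter x0 f)" by (simp add: filterlim_cong)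
  show ?thesis
  proof (rule that)
    show "coeffs_tendsto a1 a2" unfolding coeffs_tendsto_def using f1 f2 by (rule conjI)
    show "(h \<longlongrightarrow> a1 / \<alpha>) (left_filter x0)" using l \<alpha> by (simp add: a1_def)
    show "g = \<alpha> * a2 + \<beta> * a1" using \<alpha> by (simp add: a2_def)
  qed
qed

lemma coeffs_imp_G_tendsto: "coeffs_tendsto a1 a2 \<Longrightarrow> (G \<longlongrightarrow> \<alpha> * a2 + \<beta> * a1) (diff_filter x0 f)"
  unfolding coeffs_tendsto_def G_def[abs_def] by (intro tendsto_intros) auto

lemma coeffs_imp_quotient_tendsto:
  assumes "coeffs_tendsto a1 a2"
  shows "(h \<longlongrightarrow> a1 / \<alpha>) (left_filter x0)"
  using G_tendsto_imp_coeffs[OF coeffs_imp_G_tendsto[OF assms]] coeffs_tendsto_unique[OF assms] by metis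

text \<open>Solving the representation for \<open>L\<close> with
  \<open>\<psi> * \<rho> = \<phi>2 / \<alpha>\<close> and
  \<open>\<psi> + \<beta> * \<phi>2 = \<alpha> * \<phi>1\<close>. The result is the increment of
  \<open>h - g * \<rho>\<close> from \<open>x\<close> to \<open>x0\<close> when \<open>h\<close>
  tends to \<open>a1 / \<alpha>\<close>, with
  \<open>g = \<alpha> * a2 + \<beta> * a1\<close>.\<close>

lemma rep_identity:
  assumes "x \<in> J"
  shows "f x = a1 * \<phi>1 x + a2 * \<phi>2 x - \<psi> x * L \<longleftrightarrow> L = a1 / \<alpha> - h x + (\<alpha> * a2 + \<beta> * a1) * \<rho> x"
proof -
  note p = psi_nz[OF assms]
  have "\<psi> x * (a1 / \<alpha> - h x + (\<alpha> * a2 + \<beta> * a1) * \<rho> x) = a1 * (\<psi> x + \<beta> * \<phi>2 x) / \<alpha> - f x + a2 * \<phi>2 x"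
    using p \<alpha> by (simp add: h_def \<rho>_def field_simps)
  also have "\<dots> = a1 * \<phi>1 x + a2 * \<phi>2 x - f x" using \<alpha> by (simp add: \<psi>_def)
  finally have *: "f x = a1 * \<phi>1 x + a2 * \<phi>2 x - \<psi> x * (a1 / \<alpha> - h x + (\<alpha> * a2 + \<beta> * a1) * \<rho> x)" by simp
  show ?thesis
  proof
    assume "f x = a1 * \<phi>1 x + a2 * \<phi>2 x - \<psi> x * L"
    with * have "\<psi> x * L = \<psi> x * (a1 / \<alpha> - h x + (\<alpha> * a2 + \<beta> * a1) * \<rho> x)" by linarith
    then show "L = a1 / \<alpha> - h x + (\<alpha> * a2 + \<beta> * a1) * \<rho> x" using p by simp
  qed (use * in simp)
qed

text \<open>The shift \<open>k\<close> is free: the limit of \<open>G\<close> gives the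
  representation, and \<open>k = 0\<close> the integral in the weighted limit.\<close>

lemma improper_shift:
  assumes l: "(h \<longlongrightarrow> l) (left_filter x0)" and x: "x \<in> J"
  shows "improper_int_to (\<lambda>t. \<rho>' t * (G t - k)) x x0 (l - h x + k * \<rho> x)"
proof -
  have "((\<lambda>y. h y - h x - k * (\<rho> y - \<rho> x)) \<longlongrightarrow> l - h x - k * (0 - \<rho> x)) (left_filter x0)"
    by (intro tendsto_intros l rho_tendsto_0)
  moreover have "eventually (\<lambda>y. h y - h x - k * (\<rho> y - \<rho> x) = integral {x..y} (\<lambda>t. \<rho>' t * (G t - k))) (left_filter x0)"
    using eventually_J[OF x]
    by eventually_elim (rule sym, rule integral_unique, rule quotient_FTC_shift[OF x], auto)
  ultimately have "((\<lambda>y. integral {x..y} (\<lambda>t. \<rho>' t * (G t - k))) \<longlongrightarrow> l - h x - k * (0 - \<rho> x)) (left_filter x0)"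
    by (rule Lim_transform_eventually)
  then show ?thesis unfolding improper_int_to_def by simp
qed

lemma coeffs_imp_rep:
  assumes "coeffs_tendsto a1 a2"
  shows "rep a1 a2 (\<lambda>t. G t - (\<alpha> * a2 + \<beta> * a1))"
  unfolding rep_def
  using improper_shift[OF coeffs_imp_quotient_tendsto[OF assms]] rep_identity by blast

text \<open>The remainder is \<open>- \<psi> * L\<close> with \<open>L\<close> the tail integral of
  \<open>\<rho>' * (G - g)\<close>. Since \<open>G\<close> is close to \<open>g\<close>, the tail is
  small relative to \<open>\<rho>\<close>, and
  \<open>\<psi> * \<rho> = \<phi>2 / \<alpha>\<close>.\<close>

lemma coeffs_imp_expansion:
  assumes c: "coeffs_tendsto a1 a2"
  shows "((\<lambda>x. (f x - (a1 * \<phi>1 x + a2 * \<phi>2 x)) / \<phi>2 x) \<longlongrightarrow> 0) (left_filter x0)"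
proof (rule tendstoI)
  fix e :: real assume "0 < e"
  define g where "g = \<alpha> * a2 + \<beta> * a1"
  define L where "L x = a1 / \<alpha> - h x + g * \<rho> x" for x
  \<comment> \<open>\<open>\<bar>\<psi> / \<phi>2\<bar> * \<bar>\<rho>\<bar>\<close> equals
    \<open>1 / \<bar>\<alpha>\<bar>\<close>, so this \<epsilon> leads to the bound
    \<open>e / 2\<close>.\<close>
  define \<epsilon> where "\<epsilon> = e * \<bar>\<alpha>\<bar> / 2"
  have "0 < \<epsilon>" using \<open>0 < e\<close> \<alpha> by (simp add: \<epsilon>_def)
  have "eventually (\<lambda>t. dist (G t) g < \<epsilon>) (diff_filter x0 f)"
    using coeffs_imp_G_tendsto[OF c] \<open>0 < \<epsilon>\<close> unfolding g_def by (rule tendstoD)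
  then obtain b where b: "T \<le> b" "ereal b < x0" "\<And>t. b < t \<Longrightarrow> ereal t < x0 \<Longrightarrow> f differentiable at t \<Longrightarrow> \<bar>G t - g\<bar> \<le> \<epsilon>"
    unfolding eventually_diff_filter[OF Tx0] dist_real_def by fastforce
  have bound: "\<bar>L x\<bar> \<le> \<epsilon> * \<bar>\<rho> x\<bar>" if x: "b < x" "ereal x < x0" for x
  proof -
    have xJ: "x \<in> J" using J(2)[of x] x b(1) by auto
    \<comment> \<open>Letting \<open>y\<close> tend to \<open>x0\<close> turns the increment bound
      into a bound for the tail \<open>L x\<close>.\<close>
    have "((\<lambda>y. \<bar>h y - h x - g * (\<rho> y - \<rho> x)\<bar>) \<longlongrightarrow> \<bar>a1 / \<alpha> - h x - g * (0 - \<rho> x)\<bar>) (left_filter x0)"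
      by (intro tendsto_intros coeffs_imp_quotient_tendsto[OF c] rho_tendsto_0)
    moreover have "((\<lambda>y. \<epsilon> * \<bar>\<rho> y - \<rho> x\<bar>) \<longlongrightarrow> \<epsilon> * \<bar>0 - \<rho> x\<bar>) (left_filter x0)"
      by (intro tendsto_intros rho_tendsto_0)
    moreover have "eventually (\<lambda>y. \<bar>h y - h x - g * (\<rho> y - \<rho> x)\<bar> \<le> \<epsilon> * \<bar>\<rho> y - \<rho> x\<bar>) (left_filter x0)"
      using eventually_J[OF xJ]
      by eventually_elim (use b(3) x in \<open>intro quotient_increment_bound[OF xJ], auto\<close>)
    ultimately have "\<bar>a1 / \<alpha> - h x - g * (0 - \<rho> x)\<bar> \<le> \<epsilon> * \<bar>0 - \<rho> x\<bar>"
      using tendsto_le[OF left_filter_neq_bot[OF Tx0]] by blast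
    then show ?thesis by (simp add: L_def)
  qed
  have "eventually (\<lambda>x. b < x \<and> ereal x < x0) (left_filter x0)"
    unfolding eventually_left_filter[OF Tx0] using b by blast
  then show "eventually (\<lambda>x. dist ((f x - (a1 * \<phi>1 x + a2 * \<phi>2 x)) / \<phi>2 x) 0 < e) (left_filter x0)"
  proof eventually_elim
    case (elim x)
    then have xJ: "x \<in> J" using J(2)[of x] b(1) by auto
    then have p: "\<psi> x \<noteq> 0" "\<phi>2 x \<noteq> 0" using psi_nz nz2 J_D by auto
    have "f x - (a1 * \<phi>1 x + a2 * \<phi>2 x) = - \<psi> x * L x"
      using rep_identity[OF xJ, of a1 a2 "L x"] by (simp add: L_def g_def)
    then have "\<bar>(f x - (a1 * \<phi>1 x + a2 * \<phi>2 x)) / \<phi>2 x\<bar> = \<bar>\<psi> x / \<phi>2 x\<bar> * \<bar>L x\<bar>"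
      by (simp add: abs_mult)
    also have "\<dots> \<le> \<bar>\<psi> x / \<phi>2 x\<bar> * (\<epsilon> * \<bar>\<rho> x\<bar>)" using bound elim by (intro mult_left_mono) auto
    also have "\<dots> = e / 2" using p \<alpha> by (simp add: \<rho>_def \<epsilon>_def abs_mult)
    also have "e / 2 < e" using \<open>0 < e\<close> by simp
    finally show ?case by (simp only: dist_real_def diff_0_right)
  qed
qed

text \<open>The weighted tail equals \<open>- g / \<alpha>\<close> minus the remainder of the
  expansion divided by \<open>\<phi>2\<close>, where
  \<open>g = \<alpha> * a2 + \<beta> * a1\<close>, so its limit is read off from
  \<open>coeffs_imp_expansion\<close>.\<close>

lemma coeffs_imp_weighted_limit:
  assumes c: "coeffs_tendsto a1 a2"
  shows "\<And>x. x \<in> J \<Longrightarrow> improper_int_to (\<lambda>t. \<rho>' t * G t) x x0 (a1 / \<alpha> - h x)"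
    and "((\<lambda>x. \<psi> x / \<phi>2 x * (a1 / \<alpha> - h x)) \<longlongrightarrow> - (\<alpha> * a2 + \<beta> * a1) / \<alpha>) (left_filter x0)"
proof -
  show "improper_int_to (\<lambda>t. \<rho>' t * G t) x x0 (a1 / \<alpha> - h x)" if "x \<in> J" for x
    using improper_shift[OF coeffs_imp_quotient_tendsto[OF c] that, of 0] by simp
  have "((\<lambda>x. - (\<alpha> * a2 + \<beta> * a1) / \<alpha> - (f x - (a1 * \<phi>1 x + a2 * \<phi>2 x)) / \<phi>2 x)
      \<longlongrightarrow> - (\<alpha> * a2 + \<beta> * a1) / \<alpha> - 0) (left_filter x0)"
    by (intro tendsto_intros coeffs_imp_expansion[OF c])
  moreover have "eventually (\<lambda>x. - (\<alpha> * a2 + \<beta> * a1) / \<alpha> - (f x - (a1 * \<phi>1 x + a2 * \<phi>2 x)) / \<phi>2 x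
      = \<psi> x / \<phi>2 x * (a1 / \<alpha> - h x)) (left_filter x0)"
    using eventually_I
  proof eventually_elim
    case (elim x)
    then have xJ: "x \<in> J" using J(2) by (auto simp: Ival_def)
    have p: "\<psi> x \<noteq> 0" "\<phi>2 x \<noteq> 0" using psi_nz[OF xJ] nz2 elim by auto
    have "\<psi> x * (a1 / \<alpha> - h x) = a1 * \<psi> x / \<alpha> - f x" using p by (simp add: h_def algebra_simps)
    also have "\<dots> = a1 * \<phi>1 x - a1 * \<beta> / \<alpha> * \<phi>2 x - f x" using \<alpha> by (simp add: \<psi>_def field_simps)
    finally show ?case using p(2) \<alpha> by (simp add: field_simps)
  qed
  ultimately show "((\<lambda>x. \<psi> x / \<phi>2 x * (a1 / \<alpha> - h x)) \<longlongrightarrow> - (\<alpha> * a2 + \<beta> * a1) / \<alpha>) (left_filter x0)"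
    by (simp add: filterlim_cong)
qed

section \<open>Representations with a summable error function\<close>

text \<open>\<open>G\<close> is \<open>(\<psi> / W) * deriv f - f * \<psi>' / W\<close>, an
  integrable derivative times a continuous factor minus a continuous function. Only \<open>W\<close>
  is in the denominator, so summability extends to \<open>T\<close> even when \<open>\<psi>\<close>
  vanishes there.\<close>

lemma absolutely_integrable_G:
  assumes "x \<in> I" "y \<in> I"
  shows "G absolutely_integrable_on {x..y}"
proof (cases "x \<le> y")
  case True
  have s: "{x..y} \<subseteq> I" using Icc_subset_I assms by blast
  have cW: "continuous_on {x..y} W" "continuous_on {x..y} \<psi>" "continuous_on {x..y} \<psi>'"
    using continuous_on_subset[OF _ s] continuous_W continuous_psi by auto
  have Wnz: "\<forall>t\<in>{x..y}. W t \<noteq> 0" using nzW s by auto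
  have "(\<lambda>t. (\<psi> t / W t) * deriv f t) absolutely_integrable_on {x..y}"
    by (intro absolutely_integrable_continuous_mult abs_cont_on_FTC(2) ac_Icc assms True continuous_intros cW Wnz)
  moreover have "(\<lambda>t. f t * \<psi>' t / W t) absolutely_integrable_on {x..y}"
    by (intro absolutely_integrable_continuous_real continuous_intros cW Wnz
        abs_cont_on_imp_continuous_on ac_Icc assms)
  ultimately have "(\<lambda>t. (\<psi> t / W t) * deriv f t - f t * \<psi>' t / W t) absolutely_integrable_on {x..y}"
    by (rule set_integral_diff(1))
  then show ?thesis
  proof (rule absolutely_integrable_spike[OF _ negligible_empty])
    fix t assume "t \<in> {x..y} - {}"
    then have "W t \<noteq> 0" using Wnz by auto
    then show "G t = (\<psi> t / W t) * deriv f t - f t * \<psi>' t / W t"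
      by (simp add: G_def f1star_def f2star_def \<psi>_def \<psi>'_def divide_simps) (simp add: Wr_def algebra_simps)
  qed
qed auto

lemma coeffs_imp_rep_exists:
  assumes c: "coeffs_tendsto a1 a2"
  shows "\<exists>F. loc_summable T x0 F \<and> F \<in> o[left_filter x0](\<lambda>_. 1) \<and> rep a1 a2 F"
proof -
  define g where "g = \<alpha> * a2 + \<beta> * a1"
  \<comment> \<open>\<open>F\<close> has to be o(1) along all points, whereas \<open>G\<close>
    converges along points of differentiability only; the value zero elsewhere changes
    \<open>F\<close> on a null set.\<close>
  define F where "F t = (if f differentiable at t then G t - g else 0)" for t
  have neg: "negligible {t \<in> {x..y}. F t \<noteq> G t - g}" if "x \<in> I" "y \<in> I" for x y
    by (rule negligible_subset[OF nondiff_negligible[OF that]]) (auto simp: F_def)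
  have "F absolutely_integrable_on {x..y}" if "x \<in> I" "y \<in> I" for x y
  proof (rule absolutely_integrable_spike[OF _ neg[OF that]])
    show "(\<lambda>t. G t - g) absolutely_integrable_on {x..y}"
      by (intro set_integral_diff(1) absolutely_integrable_G that absolutely_integrable_continuous_real continuous_intros)
  qed auto
  then have "loc_summable T x0 F" by (auto simp: loc_summable_def)
  moreover have "F \<in> o[left_filter x0](\<lambda>_. 1)"
  proof (rule smalloI_tendsto)
    show "((\<lambda>t. F t / 1) \<longlongrightarrow> 0) (left_filter x0)"
    proof (rule tendstoI)
      fix e :: real assume "0 < e"
      have "eventually (\<lambda>t. dist (G t) g < e) (diff_filter x0 f)"
        using coeffs_imp_G_tendsto[OF c] \<open>0 < e\<close> unfolding g_def by (rule tendstoD)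
      then show "eventually (\<lambda>t. dist (F t / 1) 0 < e) (left_filter x0)"
        unfolding diff_filter_def eventually_inf_principal
        by eventually_elim (use \<open>0 < e\<close> in \<open>auto simp: F_def dist_real_def\<close>)
    qed
  qed simp
  moreover have "rep a1 a2 F"
    unfolding rep_def
  proof
    fix x assume x: "x \<in> J"
    obtain L where L: "improper_int_to (\<lambda>t. \<rho>' t * (G t - g)) x x0 L" "f x = a1 * \<phi>1 x + a2 * \<phi>2 x - \<psi> x * L"
      using coeffs_imp_rep[OF c] x unfolding rep_def g_def by blast
    have "eventually (\<lambda>y. integral {x..y} (\<lambda>t. \<rho>' t * (G t - g)) = integral {x..y} (\<lambda>t. \<rho>' t * F t)) (left_filter x0)"
      using eventually_J[OF x]
    proof eventually_elim
      case (elim y)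
      then show ?case using neg[of x y] J_D[of x] J_D[of y] x by (intro integral_spike[of "{t \<in> {x..y}. F t \<noteq> G t - g}"]) auto
    qed
    then have "improper_int_to (\<lambda>t. \<rho>' t * F t) x x0 L"
      using L(1) unfolding improper_int_to_def by (simp add: filterlim_cong)
    then show "\<exists>L. improper_int_to (\<lambda>t. \<rho>' t * F t) x x0 L \<and> f x = a1 * \<phi>1 x + a2 * \<phi>2 x - \<psi> x * L"
      using L(2) by blast
  qed
  ultimately show ?thesis by blast
qed

text \<open>A representation prescribes the tail integrals of \<open>\<rho>' * F\<close>, hence its
  integrals over all compact subintervals of \<open>J\<close>. They control the difference quotients
  of \<open>h - g * \<rho>\<close> at each point of differentiability, and they agree with the
  integrals of \<open>\<rho>' * (G - g)\<close>, which identifies the integrands up to a null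
  set.\<close>

lemma rep_imp:
  assumes ls: "loc_summable T x0 F" and so: "F \<in> o[left_filter x0](\<lambda>_. 1)" and rep: "rep a1 a2 F"
  shows "coeffs_tendsto a1 a2"
    and "AE t in lborel. t \<in> I \<longrightarrow> F t = G t - (\<alpha> * a2 + \<beta> * a1)"
proof -
  define g where "g = \<alpha> * a2 + \<beta> * a1"
  define L where "L x = a1 / \<alpha> - h x + g * \<rho> x" for x
  have imp: "improper_int_to (\<lambda>t. \<rho>' t * F t) x x0 (L x)" if x: "x \<in> J" for x
  proof -
    obtain l where l: "improper_int_to (\<lambda>t. \<rho>' t * F t) x x0 l" "f x = a1 * \<phi>1 x + a2 * \<phi>2 x - \<psi> x * l"
      using bspec[OF rep[unfolded rep_def] x] by blast
    have "l = L x" using rep_identity[OF x, of a1 a2 l] l(2) unfolding L_def g_def by simp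
    then show ?thesis using l(1) by simp
  qed
  have integrable: "(\<lambda>t. \<rho>' t * F t) integrable_on {x..y}" if "x \<in> J" "y \<in> J" for x y
  proof -
    have "F absolutely_integrable_on {x..y}" using ls that J_D by (auto simp: loc_summable_def)
    then have "(\<lambda>t. \<rho>' t * F t) absolutely_integrable_on {x..y}"
      using Icc_subset_J that by (intro absolutely_integrable_continuous_mult continuous_on_subset[OF continuous_rho']) auto
    then show ?thesis by (simp add: absolutely_integrable_on_def)
  qed
  have int: "((\<lambda>t. \<rho>' t * F t) has_integral (L x - L y)) {x..y}" if x: "x \<in> J" and y: "y \<in> J" and "x \<le> y" for x y
  proof -
    have "((\<lambda>z. integral {x..y} (\<lambda>t. \<rho>' t * F t) + integral {y..z} (\<lambda>t. \<rho>' t * F t))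
        \<longlongrightarrow> integral {x..y} (\<lambda>t. \<rho>' t * F t) + L y) (left_filter x0)"
      using imp[OF y] unfolding improper_int_to_def by (intro tendsto_intros)
    moreover have "eventually (\<lambda>z. integral {x..y} (\<lambda>t. \<rho>' t * F t) + integral {y..z} (\<lambda>t. \<rho>' t * F t)
        = integral {x..z} (\<lambda>t. \<rho>' t * F t)) (left_filter x0)"
      using eventually_J[OF y]
      by eventually_elim (use \<open>x \<le> y\<close> integrable x in \<open>intro Henstock_Kurzweil_Integration.integral_combine, auto\<close>)
    ultimately have "((\<lambda>z. integral {x..z} (\<lambda>t. \<rho>' t * F t)) \<longlongrightarrow> integral {x..y} (\<lambda>t. \<rho>' t * F t) + L y) (left_filter x0)"
      by (simp add: filterlim_cong)
    then have "integral {x..y} (\<lambda>t. \<rho>' t * F t) + L y = L x"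
      using imp[OF x] tendsto_unique[OF left_filter_neq_bot[OF Tx0]] unfolding improper_int_to_def by blast
    then have "L x - L y = integral {x..y} (\<lambda>t. \<rho>' t * F t)" by simp
    then show ?thesis using integrable_integral[OF integrable[OF x y]] by simp
  qed
  obtain c where c: "c \<in> J" using J_nonempty by blast
  \<comment> \<open>Tails of a convergent improper integral vanish at \<open>x0\<close>; this
    identifies the limit of \<open>h\<close> as \<open>a1 / \<alpha>\<close>.\<close>
  have L0: "(L \<longlongrightarrow> 0) (left_filter x0)"
  proof -
    have "((\<lambda>y. L c - integral {c..y} (\<lambda>t. \<rho>' t * F t)) \<longlongrightarrow> L c - L c) (left_filter x0)"
      using imp[OF c] unfolding improper_int_to_def by (intro tendsto_intros)
    moreover have "eventually (\<lambda>y. L c - integral {c..y} (\<lambda>t. \<rho>' t * F t) = L y) (left_filter x0)"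
      using eventually_J[OF c]
    proof eventually_elim
      case (elim y)
      then show ?case using integral_unique[OF int[OF c, of y]] by simp
    qed
    ultimately show ?thesis by (simp add: filterlim_cong)
  qed
  have h: "(h \<longlongrightarrow> a1 / \<alpha>) (left_filter x0)"
  proof -
    have "((\<lambda>x. a1 / \<alpha> + g * \<rho> x - L x) \<longlongrightarrow> a1 / \<alpha> + g * 0 - 0) (left_filter x0)"
      by (intro tendsto_intros rho_tendsto_0 L0)
    then show ?thesis by (simp add: L_def)
  qed
  have "(G \<longlongrightarrow> g) (diff_filter x0 f)"
  proof (rule tendstoI)
    fix e :: real assume "0 < e"
    define \<epsilon> where "\<epsilon> = e / 2"
    have "0 < \<epsilon>" using \<open>0 < e\<close> by (simp add: \<epsilon>_def)
    have "(F \<longlongrightarrow> 0) (left_filter x0)" using smalloD_tendsto[OF so] by simp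
    then have "eventually (\<lambda>t. dist (F t) 0 < \<epsilon>) (left_filter x0)" using \<open>0 < \<epsilon>\<close> by (rule tendstoD)
    then obtain b where b: "T \<le> b" "ereal b < x0" "\<And>t. b < t \<Longrightarrow> ereal t < x0 \<Longrightarrow> \<bar>F t\<bar> \<le> \<epsilon>"
      unfolding eventually_left_filter[OF Tx0] dist_real_def by fastforce
    have "\<bar>G t - g\<bar> \<le> \<epsilon>" if t: "b < t" "ereal t < x0" "f differentiable at t" for t
    proof -
      have tT: "T < t" using t b by simp
      have tJ: "t \<in> J" using J(2)[OF tT t(2)] .
      \<comment> \<open>The derivative of \<open>h - g * \<rho>\<close> at \<open>t\<close> is
        \<open>\<rho>' t * (G t - g)\<close>, and its difference quotients from the right are at
        most \<epsilon> times those of \<open>\<rho>\<close> in modulus. Dividing by the nonzero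
        \<open>\<rho>' t\<close> transfers the bound on \<open>F\<close> to \<open>G t - g\<close>
        at this very point.\<close>
      have h': "((\<lambda>y. (h y - h t) / (y - t)) \<longlongrightarrow> \<rho>' t * G t) (at_right t)"
        using quotient_deriv[OF tT t(2,3)] unfolding has_field_derivative_iff
        by (rule tendsto_mono[rotated]) (simp add: at_le)
      have r': "((\<lambda>y. (\<rho> y - \<rho> t) / (y - t)) \<longlongrightarrow> \<rho>' t) (at_right t)"
        using rho_deriv[OF tJ] unfolding at_within_I[OF tT t(2)] has_field_derivative_iff
        by (rule tendsto_mono[rotated]) (simp add: at_le)
      have "((\<lambda>y. \<bar>(h y - h t) / (y - t) - g * ((\<rho> y - \<rho> t) / (y - t))\<bar>) \<longlongrightarrow> \<bar>\<rho>' t * G t - g * \<rho>' t\<bar>) (at_right t)"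
        by (intro tendsto_intros h' r')
      moreover have "((\<lambda>y. \<epsilon> * \<bar>(\<rho> y - \<rho> t) / (y - t)\<bar>) \<longlongrightarrow> \<epsilon> * \<bar>\<rho>' t\<bar>) (at_right t)"
        by (intro tendsto_intros r')
      moreover have "eventually (\<lambda>y. \<bar>(h y - h t) / (y - t) - g * ((\<rho> y - \<rho> t) / (y - t))\<bar> \<le> \<epsilon> * \<bar>(\<rho> y - \<rho> t) / (y - t)\<bar>) (at_right t)"
      proof -
        obtain d where d: "t < d" "ereal d < x0" using ereal_dense2[OF t(2)] by auto
        have "eventually (\<lambda>y. y \<in> {t<..<d}) (at_right t)" by (rule eventually_at_right_real[OF d(1)])
        then show ?thesis
        proof eventually_elim
          case (elim y)
          then have y: "t < y" "ereal y < x0" using ereal_le_less_trans[OF _ d(2), of y] by auto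
          have yJ: "y \<in> J" using J_up[OF tJ _ y(2)] y(1) by simp
          have "\<bar>L t - L y\<bar> \<le> \<epsilon> * \<bar>\<rho> y - \<rho> t\<bar>"
          proof (rule bounded_by_rho[OF tJ yJ _ int[OF tJ yJ] negligible_empty])
            show "\<bar>F s\<bar> \<le> \<epsilon>" if "s \<in> {t..y} - {}" for s
              using b(3)[of s] that t(1) ereal_le_less_trans[OF _ y(2), of s] by auto
          qed (use y in auto)
          moreover have "L t - L y = h y - h t - g * (\<rho> y - \<rho> t)" by (simp add: L_def algebra_simps)
          ultimately have "\<bar>h y - h t - g * (\<rho> y - \<rho> t)\<bar> / (y - t) \<le> \<epsilon> * \<bar>\<rho> y - \<rho> t\<bar> / (y - t)"
            using y(1) by (intro divide_right_mono) auto
          moreover have "(h y - h t) / (y - t) - g * ((\<rho> y - \<rho> t) / (y - t)) = (h y - h t - g * (\<rho> y - \<rho> t)) / (y - t)"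
            by (metis diff_divide_distrib times_divide_eq_right)
          ultimately show ?case using y(1) by (simp add: abs_divide)
        qed
      qed
      ultimately have "\<bar>\<rho>' t * G t - g * \<rho>' t\<bar> \<le> \<epsilon> * \<bar>\<rho>' t\<bar>"
        using tendsto_le[OF trivial_limit_at_right_real] by blast
      moreover have "\<bar>\<rho>' t * G t - g * \<rho>' t\<bar> = \<bar>G t - g\<bar> * \<bar>\<rho>' t\<bar>"
        by (simp add: abs_mult[symmetric] algebra_simps)
      moreover have "0 < \<bar>\<rho>' t\<bar>" using nzW J_D[OF tJ] psi_nz[OF tJ] by (simp add: \<rho>'_def)
      ultimately show ?thesis by simp
    qed
    then show "eventually (\<lambda>t. dist (G t) g < e) (diff_filter x0 f)"
      unfolding eventually_diff_filter[OF Tx0] using b(1,2) \<open>0 < e\<close>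
      by (intro exI[of _ b]) (fastforce simp: \<epsilon>_def dist_real_def)
  qed
  then obtain b1 b2 where b: "coeffs_tendsto b1 b2" "(h \<longlongrightarrow> b1 / \<alpha>) (left_filter x0)" "g = \<alpha> * b2 + \<beta> * b1"
    using G_tendsto_imp_coeffs by blast
  \<comment> \<open>The limit of \<open>h\<close> fixes the first coefficient; the value
    \<open>g\<close> then fixes the second, as \<alpha> is nonzero.\<close>
  have "b1 = a1" using tendsto_unique[OF left_filter_neq_bot[OF Tx0] b(2) h] \<alpha> by simp
  moreover have "b2 = a2" using b(3) \<open>b1 = a1\<close> \<alpha> by (simp add: g_def)
  ultimately show "coeffs_tendsto a1 a2" using b(1) by simp

  \<comment> \<open>Both terms have the integral \<open>L u - L v\<close> over
    \<open>{u..v}\<close>, so all integrals of \<open>D\<close> vanish.\<close>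
  define D where "D t = \<rho>' t * F t - \<rho>' t * (G t - g)" for t
  have neg: "negligible {t \<in> {x..y}. D t \<noteq> 0}" if x: "x \<in> J" "y \<in> J" "x \<le> y" for x y
  proof (rule negligible_nonzero_if_integrals_zero[OF _ x(3)])
    fix u v assume uv: "x \<le> u" "u \<le> v" "v \<le> y"
    then have J: "u \<in> J" "v \<in> J" using Icc_subset_J[OF x(1,2)] by auto
    have "(D has_integral (L u - L v - (h v - h u - g * (\<rho> v - \<rho> u)))) {u..v}"
      unfolding D_def by (intro has_integral_diff int quotient_FTC_shift J uv(2))
    then show "(D has_integral 0) {u..v}" by (simp add: L_def algebra_simps)
  qed
  \<comment> \<open>Rational endpoints give countably many compact intervals covering all points
    between \<open>T\<close> and \<open>x0\<close>; \<open>T\<close> itself, possibly outside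
    \<open>J\<close>, is added as a null set.\<close>
  let ?R = "{(p, q). p \<in> \<rat> \<and> q \<in> \<rat> \<and> p \<in> J \<and> q \<in> J \<and> p \<le> q}"
  have "countable ?R" by (rule countable_subset[of _ "\<rat> \<times> \<rat>"]) (auto simp: countable_rat)
  then have "negligible (\<Union>((\<lambda>(p, q). {t \<in> {p..q}. D t \<noteq> 0}) ` ?R))"
    using neg by (intro negligible_countable_Union) auto
  then have "negligible (\<Union>((\<lambda>(p, q). {t \<in> {p..q}. D t \<noteq> 0}) ` ?R) \<union> {T})"
    by (simp add: negligible_Un_eq)
  moreover have "{t. \<not> (t \<in> I \<longrightarrow> F t = G t - g)} \<subseteq> \<Union>((\<lambda>(p, q). {t \<in> {p..q}. D t \<noteq> 0}) ` ?R) \<union> {T}"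
  proof
    fix t assume "t \<in> {t. \<not> (t \<in> I \<longrightarrow> F t = G t - g)}"
    then have t: "t \<in> I" "F t \<noteq> G t - g" by auto
    show "t \<in> \<Union>((\<lambda>(p, q). {t \<in> {p..q}. D t \<noteq> 0}) ` ?R) \<union> {T}"
    proof (cases "t = T")
      case False
      then have tT: "T < t" "ereal t < x0" using t(1) by (auto simp: Ival_def)
      have tJ: "t \<in> J" using J(2)[OF tT] .
      obtain d where d: "t < d" "ereal d < x0" using ereal_dense2[OF tT(2)] by auto
      obtain p where p: "p \<in> \<rat>" "T < p" "p < t" using Rats_dense_in_real[OF tT(1)] by blast
      obtain q where q: "q \<in> \<rat>" "t < q" "q < d" using Rats_dense_in_real[OF d(1)] by blast
      have "p \<in> J" "q \<in> J"
        using J(2)[of p] J(2)[of q] p q tT ereal_le_less_trans[OF _ tT(2), of p] ereal_le_less_trans[OF _ d(2), of q] by auto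
      then have "(p, q) \<in> ?R" using p q by auto
      moreover have "D t \<noteq> 0"
        using t nzW psi_nz[OF tJ] by (simp add: D_def \<rho>'_def)
      ultimately show ?thesis using p(3) q(2) by (intro UnI1 UN_I[of "(p, q)"]) auto
    qed simp
  qed
  ultimately have "AE t in lebesgue. t \<in> I \<longrightarrow> F t = G t - g"
    unfolding eventually_ae_filter_negligible by blast
  then show "AE t in lborel. t \<in> I \<longrightarrow> F t = G t - (\<alpha> * a2 + \<beta> * a1)"
    by (simp add: AE_completion_iff g_def)
qed

end

section \<open>The equivalences\<close>

context comparison_pair
begin

lemma quotient_phi1: "comparison_quotient T x0 \<phi>1 \<phi>1' \<phi>2 \<phi>2' f I 1 0"
  by unfold_locales (use nz1 in \<open>auto simp: Ival_def\<close>)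

lemma T_in_I: "T \<in> I"
  using Tx0 by (simp add: Ival_def)

text \<open>A further zero of \<Phi> would make \<open>\<phi>2 / \<phi>1\<close> take the same value
  at \<open>T\<close> and \<open>t\<close>. By Rolle its derivative
  \<open>W / \<phi>1\<^sup>2\<close> would vanish in between.\<close>

lemma PhiT_nonzero:
  assumes "T < t" "ereal t < x0"
  shows "\<phi>2 T * \<phi>1 t - \<phi>1 T * \<phi>2 t \<noteq> 0"
proof
  assume eq: "\<phi>2 T * \<phi>1 t - \<phi>1 T * \<phi>2 t = 0"
  interpret A: comparison_quotient T x0 \<phi>1 \<phi>1' \<phi>2 \<phi>2' f I 1 0 by (rule quotient_phi1)
  have t: "t \<in> I" using assms by (simp add: Ival_def)
  have "A.\<rho> T = A.\<rho> t"
    using eq nz1 t T_in_I by (simp add: A.\<rho>_def A.\<psi>_def field_simps)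
  then obtain s where s: "T < s" "s < t" "A.\<rho>' s = 0"
  proof -
    assume *: "\<And>s. T < s \<Longrightarrow> s < t \<Longrightarrow> A.\<rho>' s = 0 \<Longrightarrow> thesis" and eq: "A.\<rho> T = A.\<rho> t"
    have der: "(A.\<rho> has_real_derivative A.\<rho>' s) (at s)" if "T < s" "s < t" for s
      using A.rho_deriv[of s] at_within_I[of s] that assms(2) ereal_le_less_trans[of s t] by (simp add: Ival_def)
    have cont: "continuous_on {T..t} A.\<rho>"
    proof (rule DERIV_continuous_on)
      fix s assume "s \<in> {T..t}"
      then have "s \<in> I" using Icc_subset_I[OF T_in_I t] by blast
      then show "(A.\<rho> has_real_derivative A.\<rho>' s) (at s within {T..t})"
        using DERIV_subset[OF A.rho_deriv Icc_subset_I[OF T_in_I t]] by blast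
    qed
    show thesis
    proof (rule mvt[OF assms(1) cont, where f' = "\<lambda>s. (*) (A.\<rho>' s)"])
      show "(A.\<rho> has_derivative (*) (A.\<rho>' s)) (at s)" if "T < s" "s < t" for s
        using der[OF that] by (simp add: has_field_derivative_def)
      fix z assume "T < z" "z < t" "A.\<rho> t - A.\<rho> T = A.\<rho>' z * (t - T)"
      then show thesis using * eq assms(1) by simp
    qed
  qed
  then have "s \<in> I" using assms(2) ereal_le_less_trans[of s t] by (simp add: Ival_def)
  then show False using s(3) nzW nz1 by (simp add: A.\<rho>'_def A.\<psi>_def)
qed

lemma quotient_PhiT: "comparison_quotient T x0 \<phi>1 \<phi>1' \<phi>2 \<phi>2' f {t. T < t \<and> ereal t < x0} (\<phi>2 T) (\<phi>1 T)"
  by unfold_locales (use nz2 PhiT_nonzero T_in_I in \<open>auto simp: Ival_def\<close>)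

lemma dquot_phi: "t \<in> I \<Longrightarrow> dquot \<phi>2 \<phi>2' \<phi>1 \<phi>1' t = W t / (\<phi>1 t)\<^sup>2"
  by (simp add: dquot_def Wr_def mult.commute)

section \<open>Expansions with a condition on the derivative of a quotient\<close>

definition "expansion a1 a2 \<longleftrightarrow> ((\<lambda>x. (f x - (a1 * \<phi>1 x + a2 * \<phi>2 x)) / \<phi>2 x) \<longlongrightarrow> 0) (left_filter x0)"

lemma eventually_phi2_nz: "eventually (\<lambda>x. \<phi>2 x \<noteq> 0) (left_filter x0)"
  using eventually_I by eventually_elim (use nz2 in auto)

lemma smallo_iff:
  assumes "eventually (\<lambda>x. g x \<noteq> (0::real)) F"
  shows "u \<in> o[F](g) \<longleftrightarrow> ((\<lambda>x. u x / g x) \<longlongrightarrow> 0) F"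
  using smalloI_tendsto[OF _ assms] smalloD_tendsto by blast

text \<open>Divided by \<open>(\<phi>2 / \<phi>1)'\<close>, the difference in the derivative
  condition is \<open>f2 - a2\<close>.\<close>

lemma cond_iv_iff: "cond_iv x0 \<phi>1 \<phi>1' \<phi>2 \<phi>2' f a1 a2 \<longleftrightarrow> expansion a1 a2 \<and> (f2 \<longlongrightarrow> a2) (diff_filter x0 f)"
proof -
  let ?d = "dquot \<phi>2 \<phi>2' \<phi>1 \<phi>1'"
  have nz: "eventually (\<lambda>x. ?d x \<noteq> 0) (diff_filter x0 f)"
    using eventually_I_diff by eventually_elim (use nzW nz1 dquot_phi in auto)
  have "eventually (\<lambda>x. (dquot f (deriv f) \<phi>1 \<phi>1' x - a2 * ?d x) / ?d x = f2 x - a2) (diff_filter x0 f)"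
    using eventually_I_diff nz
  proof eventually_elim
    case (elim x)
    then have p: "W x \<noteq> 0" "\<phi>1 x \<noteq> 0" using nzW nz1 by auto
    then have "dquot f (deriv f) \<phi>1 \<phi>1' x = ?d x * f2 x"
      using dquot_phi[of x] elim by (simp add: dquot_def f2star_def) (auto simp: Wr_def divide_simps algebra_simps)
    then show ?case using elim by (simp add: diff_divide_distrib)
  qed
  then have "((\<lambda>x. (dquot f (deriv f) \<phi>1 \<phi>1' x - a2 * ?d x) / ?d x) \<longlongrightarrow> 0) (diff_filter x0 f)
      \<longleftrightarrow> ((\<lambda>x. f2 x - a2) \<longlongrightarrow> 0) (diff_filter x0 f)" by (rule filterlim_cong[OF refl refl])
  then show ?thesis
    unfolding cond_iv_def expansion_def smallo_iff[OF nz] smallo_iff[OF eventually_phi2_nz]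
    using LIM_zero_iff[of f2 a2] by simp
qed

text \<open>The quotient in the derivative condition is
  \<open>(f1 - a1) * \<phi>1 / \<phi>2\<close>, which by the contact identity equals the remainder
  of the expansion over \<open>\<phi>2\<close> minus \<open>f2 - a2\<close>. The weight
  \<open>\<phi>2 / \<phi>1\<close> is thus what makes (v) as strong as (iv).\<close>

lemma cond_v_iff: "cond_v x0 \<phi>1 \<phi>1' \<phi>2 \<phi>2' f a1 a2 \<longleftrightarrow> expansion a1 a2 \<and> (f2 \<longlongrightarrow> a2) (diff_filter x0 f)"
proof -
  let ?d = "dquot \<phi>1 \<phi>1' \<phi>2 \<phi>2'"
  let ?g = "\<lambda>x. \<phi>2 x / \<phi>1 x * ?d x"
  let ?E = "\<lambda>x. (f x - (a1 * \<phi>1 x + a2 * \<phi>2 x)) / \<phi>2 x"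
  have d: "?d x = - W x / (\<phi>2 x)\<^sup>2" for x by (simp add: dquot_def Wr_def algebra_simps)
  have nz: "eventually (\<lambda>x. ?g x \<noteq> 0) (diff_filter x0 f)"
    using eventually_I_diff by eventually_elim (use nzW nz1 nz2 d in auto)
  have ev: "eventually (\<lambda>x. (dquot f (deriv f) \<phi>2 \<phi>2' x - a1 * ?d x) / ?g x = ?E x - (f2 x - a2)) (diff_filter x0 f)"
    using eventually_I_diff nz
  proof eventually_elim
    case (elim x)
    then have p: "W x \<noteq> 0" "\<phi>1 x \<noteq> 0" "\<phi>2 x \<noteq> 0" "?d x \<noteq> 0" using nzW nz1 nz2 by auto
    then have "dquot f (deriv f) \<phi>2 \<phi>2' x = ?d x * f1 x"
      unfolding d by (simp add: dquot_def f1star_def) (auto simp: Wr_def divide_simps algebra_simps)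
    then have "(dquot f (deriv f) \<phi>2 \<phi>2' x - a1 * ?d x) / ?g x = (f1 x - a1) * \<phi>1 x / \<phi>2 x"
      using p by (simp add: field_simps)
    also have "(f1 x - a1) * \<phi>1 x = f x - a1 * \<phi>1 x - f2 x * \<phi>2 x"
      using contact_eq[of x] elim by (simp add: algebra_simps)
    also have "\<dots> / \<phi>2 x = ?E x - (f2 x - a2)" using p(3) by (simp add: field_simps)
    finally show ?case .
  qed
  have "((\<lambda>x. ?E x - (f2 x - a2)) \<longlongrightarrow> 0) (diff_filter x0 f) \<longleftrightarrow> (f2 \<longlongrightarrow> a2) (diff_filter x0 f)"
    if "expansion a1 a2"
  proof -
    have E: "(?E \<longlongrightarrow> 0) (diff_filter x0 f)" using that left_imp_diff unfolding expansion_def by blast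
    show ?thesis
    proof
      assume "((\<lambda>x. ?E x - (f2 x - a2)) \<longlongrightarrow> 0) (diff_filter x0 f)"
      from tendsto_diff[OF E this] have "((\<lambda>x. f2 x - a2) \<longlongrightarrow> 0) (diff_filter x0 f)" by simp
      then show "(f2 \<longlongrightarrow> a2) (diff_filter x0 f)" using LIM_zero_iff[of f2 a2] by simp
    next
      assume "(f2 \<longlongrightarrow> a2) (diff_filter x0 f)"
      then have "((\<lambda>x. f2 x - a2) \<longlongrightarrow> 0) (diff_filter x0 f)" using LIM_zero_iff[of f2 a2] by simp
      from tendsto_diff[OF E this] show "((\<lambda>x. ?E x - (f2 x - a2)) \<longlongrightarrow> 0) (diff_filter x0 f)" by simp
    qed
  qed
  then show ?thesis
    unfolding cond_v_def smallo_iff[OF nz] smallo_iff[OF eventually_phi2_nz] filterlim_cong[OF refl refl ev]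
    unfolding expansion_def by blast
qed

lemma expansion_iff: "expansion a1 a2 \<and> (f2 \<longlongrightarrow> a2) (diff_filter x0 f) \<longleftrightarrow> coeffs_tendsto a1 a2"
proof
  interpret A: comparison_quotient T x0 \<phi>1 \<phi>1' \<phi>2 \<phi>2' f I 1 0 by (rule quotient_phi1)
  assume "coeffs_tendsto a1 a2"
  then show "expansion a1 a2 \<and> (f2 \<longlongrightarrow> a2) (diff_filter x0 f)"
    using A.coeffs_imp_expansion unfolding expansion_def coeffs_tendsto_def by blast
next
  assume *: "expansion a1 a2 \<and> (f2 \<longlongrightarrow> a2) (diff_filter x0 f)"
  let ?s = "\<lambda>t. \<phi>2 t / \<phi>1 t" and ?E = "\<lambda>x. (f x - (a1 * \<phi>1 x + a2 * \<phi>2 x)) / \<phi>2 x"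
  \<comment> \<open>The contact identity solved for \<open>f1\<close>, with \<open>f\<close>
    replaced by its expansion.\<close>
  have "((\<lambda>t. a1 + ?s t * (?E t + a2 - f2 t)) \<longlongrightarrow> a1 + 0 * (0 + a2 - a2)) (diff_filter x0 f)"
    using * left_imp_diff[OF ratio_tendsto_0] left_imp_diff unfolding expansion_def
    by (intro tendsto_intros) auto
  moreover have "eventually (\<lambda>t. a1 + ?s t * (?E t + a2 - f2 t) = f1 t) (diff_filter x0 f)"
    using eventually_I_diff
  proof eventually_elim
    case (elim t)
    then have p: "\<phi>1 t \<noteq> 0" "\<phi>2 t \<noteq> 0" using nz1 nz2 by auto
    then have "a1 + ?s t * (?E t + a2 - f2 t) = (f t - f2 t * \<phi>2 t) / \<phi>1 t" by (simp add: field_simps)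
    then show ?case using contact_eq[of t] elim p by simp
  qed
  ultimately have "(f1 \<longlongrightarrow> a1 + 0 * (0 + a2 - a2)) (diff_filter x0 f)" by (rule Lim_transform_eventually)
  then show "coeffs_tendsto a1 a2" using * by (simp add: coeffs_tendsto_def)
qed

lemmas cond_iv_coeffs = cond_iv_iff[unfolded expansion_iff]
  and cond_v_coeffs = cond_v_iff[unfolded expansion_iff]

end

theorem theorem4p5:
  fixes T :: real and x0 :: ereal
    and \<phi>1 \<phi>1' \<phi>2 \<phi>2' f :: "real \<Rightarrow> real"
  assumes Tx0: "ereal T < x0"
    and d1: "\<forall>t\<in>Ival T x0. (\<phi>1 has_real_derivative \<phi>1' t) (at t within Ival T x0)"
    and d2: "\<forall>t\<in>Ival T x0. (\<phi>2 has_real_derivative \<phi>2' t) (at t within Ival T x0)"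
    and c1: "continuous_on (Ival T x0) \<phi>1'"
    and c2: "continuous_on (Ival T x0) \<phi>2'"
    and small: "\<phi>2 \<in> o[left_filter x0](\<phi>1)"
    and nz1: "\<forall>t\<in>Ival T x0. \<phi>1 t \<noteq> 0"
    and nz2: "\<forall>t\<in>Ival T x0. \<phi>2 t \<noteq> 0"
    and nzW: "\<forall>t\<in>Ival T x0. Wr \<phi>1 \<phi>1' \<phi>2 \<phi>2' t \<noteq> 0"
    and ac: "AC_loc T x0 f"
  shows
   "(((\<exists>\<gamma>. (Fstar T \<phi>1 \<phi>1' \<phi>2 \<phi>2' f \<longlongrightarrow> \<gamma>) (diff_filter x0 f))
      \<longleftrightarrow> (\<exists>a2. (f2star \<phi>1 \<phi>1' \<phi>2 \<phi>2' f \<longlongrightarrow> a2) (diff_filter x0 f)))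
    \<and> ((\<exists>a2. (f2star \<phi>1 \<phi>1' \<phi>2 \<phi>2' f \<longlongrightarrow> a2) (diff_filter x0 f))
      \<longleftrightarrow> (\<exists>a1 a2. (f1star \<phi>1 \<phi>1' \<phi>2 \<phi>2' f \<longlongrightarrow> a1) (diff_filter x0 f) \<and>
                   (f2star \<phi>1 \<phi>1' \<phi>2 \<phi>2' f \<longlongrightarrow> a2) (diff_filter x0 f)))
    \<and> ((\<exists>a1 a2. (f1star \<phi>1 \<phi>1' \<phi>2 \<phi>2' f \<longlongrightarrow> a1) (diff_filter x0 f) \<and>
                   (f2star \<phi>1 \<phi>1' \<phi>2 \<phi>2' f \<longlongrightarrow> a2) (diff_filter x0 f))
      \<longleftrightarrow> (\<exists>a1 a2. cond_iv x0 \<phi>1 \<phi>1' \<phi>2 \<phi>2' f a1 a2))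
    \<and> ((\<exists>a1 a2. cond_iv x0 \<phi>1 \<phi>1' \<phi>2 \<phi>2' f a1 a2)
      \<longleftrightarrow> (\<exists>a1 a2. cond_v x0 \<phi>1 \<phi>1' \<phi>2 \<phi>2' f a1 a2))
    \<and> ((\<exists>a1 a2. cond_v x0 \<phi>1 \<phi>1' \<phi>2 \<phi>2' f a1 a2)
      \<longleftrightarrow> (\<exists>a1 a2 Fb. loc_summable T x0 Fb \<and> Fb \<in> o[left_filter x0](\<lambda>_. 1) \<and>
                      rep_vi T x0 \<phi>1 \<phi>1' \<phi>2 \<phi>2' f a1 a2 Fb))
    \<and> ((\<exists>a1 a2 Fb. loc_summable T x0 Fb \<and> Fb \<in> o[left_filter x0](\<lambda>_. 1) \<and>
                      rep_vi T x0 \<phi>1 \<phi>1' \<phi>2 \<phi>2' f a1 a2 Fb)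
      \<longleftrightarrow> (\<exists>a1 a2 f2b. loc_summable T x0 f2b \<and> f2b \<in> o[left_filter x0](\<lambda>_. 1) \<and>
                      rep_vii T x0 \<phi>1 \<phi>1' \<phi>2 \<phi>2' f a1 a2 f2b)))
  \<and> ((\<exists>\<gamma>. (Fstar T \<phi>1 \<phi>1' \<phi>2 \<phi>2' f \<longlongrightarrow> \<gamma>) (diff_filter x0 f)) \<longrightarrow>
      (\<exists>a1 a2 \<gamma>.
         (f1star \<phi>1 \<phi>1' \<phi>2 \<phi>2' f \<longlongrightarrow> a1) (diff_filter x0 f) \<and>
         (f2star \<phi>1 \<phi>1' \<phi>2 \<phi>2' f \<longlongrightarrow> a2) (diff_filter x0 f) \<and>
         (Fstar T \<phi>1 \<phi>1' \<phi>2 \<phi>2' f \<longlongrightarrow> \<gamma>) (diff_filter x0 f) \<and>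
         \<gamma> = a1 * \<phi>1 T + a2 * \<phi>2 T \<and>
         (\<forall>b1 b2. cond_iv x0 \<phi>1 \<phi>1' \<phi>2 \<phi>2' f b1 b2 \<longrightarrow> b1 = a1 \<and> b2 = a2) \<and>
         (\<forall>b1 b2. cond_v x0 \<phi>1 \<phi>1' \<phi>2 \<phi>2' f b1 b2 \<longrightarrow> b1 = a1 \<and> b2 = a2) \<and>
         (\<forall>b1 b2 Fb. loc_summable T x0 Fb \<and> Fb \<in> o[left_filter x0](\<lambda>_. 1) \<and>
                      rep_vi T x0 \<phi>1 \<phi>1' \<phi>2 \<phi>2' f b1 b2 Fb \<longrightarrow>
             b1 = a1 \<and> b2 = a2 \<and>
             (AE t in lborel. t \<in> Ival T x0 \<longrightarrow> Fb t = Fstar T \<phi>1 \<phi>1' \<phi>2 \<phi>2' f t - \<gamma>)) \<and>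
         (\<forall>b1 b2 f2b. loc_summable T x0 f2b \<and> f2b \<in> o[left_filter x0](\<lambda>_. 1) \<and>
                      rep_vii T x0 \<phi>1 \<phi>1' \<phi>2 \<phi>2' f b1 b2 f2b \<longrightarrow>
             b1 = a1 \<and> b2 = a2 \<and>
             (AE t in lborel. t \<in> Ival T x0 \<longrightarrow> f2b t = f2star \<phi>1 \<phi>1' \<phi>2 \<phi>2' f t - a2)) \<and>
         (\<exists>J. (\<forall>x\<in>Ival T x0. improper_int_to
                  (\<lambda>t. dquot \<phi>2 \<phi>2' \<phi>1 \<phi>1' t * f2star \<phi>1 \<phi>1' \<phi>2 \<phi>2' f t) x x0 (J x)) \<and>
              ((\<lambda>x. \<phi>1 x / \<phi>2 x * J x) \<longlongrightarrow> - a2) (left_filter x0)) \<and>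
         (\<exists>K. (\<forall>x. T < x \<and> ereal x < x0 \<longrightarrow> improper_int_to
                  (\<lambda>t. Wr \<phi>1 \<phi>1' \<phi>2 \<phi>2' t / (PhiT T \<phi>1 \<phi>2 t)\<^sup>2 * Fstar T \<phi>1 \<phi>1' \<phi>2 \<phi>2' f t)
                  x x0 (K x)) \<and>
              ((\<lambda>x. PhiT T \<phi>1 \<phi>2 x / \<phi>2 x * K x) \<longlongrightarrow> - \<gamma> / \<phi>2 T) (left_filter x0)) \<and>
         rep_vii T x0 \<phi>1 \<phi>1' \<phi>2 \<phi>2' f a1 a2 (\<lambda>t. f2star \<phi>1 \<phi>1' \<phi>2 \<phi>2' f t - a2) \<and>
         rep_vi T x0 \<phi>1 \<phi>1' \<phi>2 \<phi>2' f a1 a2 (\<lambda>t. Fstar T \<phi>1 \<phi>1' \<phi>2 \<phi>2' f t - \<gamma>)))"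
proof -
  interpret P: comparison_pair T x0 \<phi>1 \<phi>1' \<phi>2 \<phi>2' f
    using assms by unfold_locales
  define J where "J = {t. T < t \<and> ereal t < x0}"
  interpret A: comparison_quotient T x0 \<phi>1 \<phi>1' \<phi>2 \<phi>2' f "Ival T x0" 1 0 by (rule P.quotient_phi1)
  interpret B: comparison_quotient T x0 \<phi>1 \<phi>1' \<phi>2 \<phi>2' f J "\<phi>2 T" "\<phi>1 T"
    unfolding J_def by (rule P.quotient_PhiT)
  let ?D = "diff_filter x0 f" and ?S = "Fstar T \<phi>1 \<phi>1' \<phi>2 \<phi>2' f"
  have AG: "A.G = f2star \<phi>1 \<phi>1' \<phi>2 \<phi>2' f" and BG: "B.G = ?S"
    by (auto simp: A.G_def[abs_def] B.G_def[abs_def] Fstar_def[abs_def])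
  have Apsi: "A.\<psi> = \<phi>1" and Bpsi: "B.\<psi> = PhiT T \<phi>1 \<phi>2"
    by (auto simp: A.\<psi>_def[abs_def] B.\<psi>_def[abs_def] PhiT_def[abs_def])
  have Arho: "A.\<rho>' = dquot \<phi>2 \<phi>2' \<phi>1 \<phi>1'"
    by (auto simp: A.\<rho>'_def[abs_def] Apsi dquot_def[abs_def] Wr_def mult.commute)
  have Brho: "B.\<rho>' = (\<lambda>t. Wr \<phi>1 \<phi>1' \<phi>2 \<phi>2' t / (PhiT T \<phi>1 \<phi>2 t)\<^sup>2)"
    by (simp add: B.\<rho>'_def[abs_def] Bpsi)
  have vi: "rep_vi T x0 \<phi>1 \<phi>1' \<phi>2 \<phi>2' f a1 a2 F \<longleftrightarrow> B.rep a1 a2 F" for a1 a2 F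
    unfolding rep_vi_def B.rep_def Brho Bpsi by (auto simp: J_def)
  have vii: "rep_vii T x0 \<phi>1 \<phi>1' \<phi>2 \<phi>2' f a1 a2 F \<longleftrightarrow> A.rep a1 a2 F" for a1 a2 F
    unfolding rep_vii_def A.rep_def Arho Apsi by auto
  have i: "(\<exists>\<gamma>. (?S \<longlongrightarrow> \<gamma>) ?D) \<longleftrightarrow> (\<exists>a1 a2. P.coeffs_tendsto a1 a2)"
    using B.G_tendsto_imp_coeffs B.coeffs_imp_G_tendsto unfolding BG by metis
  have ii: "(\<exists>a2. (f2star \<phi>1 \<phi>1' \<phi>2 \<phi>2' f \<longlongrightarrow> a2) ?D) \<longleftrightarrow> (\<exists>a1 a2. P.coeffs_tendsto a1 a2)"
    using A.G_tendsto_imp_coeffs A.coeffs_imp_G_tendsto unfolding AG by metis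
  have ex_vi: "(\<exists>a1 a2 F. loc_summable T x0 F \<and> F \<in> o[left_filter x0](\<lambda>_. 1) \<and> rep_vi T x0 \<phi>1 \<phi>1' \<phi>2 \<phi>2' f a1 a2 F)
      \<longleftrightarrow> (\<exists>a1 a2. P.coeffs_tendsto a1 a2)"
    unfolding vi using B.coeffs_imp_rep_exists B.rep_imp(1) by meson
  have ex_vii: "(\<exists>a1 a2 F. loc_summable T x0 F \<and> F \<in> o[left_filter x0](\<lambda>_. 1) \<and> rep_vii T x0 \<phi>1 \<phi>1' \<phi>2 \<phi>2' f a1 a2 F)
      \<longleftrightarrow> (\<exists>a1 a2. P.coeffs_tendsto a1 a2)"
    unfolding vii using A.coeffs_imp_rep_exists A.rep_imp(1) by meson
  \<comment> \<open>Each of the seven properties is rewritten to the existence of both coefficient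
    limits, so the equivalences close by reflexivity.\<close>
  show ?thesis
    unfolding i ii ex_vi ex_vii P.cond_iv_coeffs P.cond_v_coeffs P.coeffs_tendsto_def[symmetric]
  proof (intro conjI impI refl)
    assume "\<exists>a1 a2. P.coeffs_tendsto a1 a2"
    then obtain a1 a2 where c: "P.coeffs_tendsto a1 a2" by blast
    define \<gamma> where "\<gamma> = a1 * \<phi>1 T + a2 * \<phi>2 T"
    \<comment> \<open>The left side is \<open>\<alpha> * a2 + \<beta> * a1\<close>, the limit of
      \<open>B.G\<close>, for the parameters \<open>\<phi>2 T\<close> and \<open>\<phi>1 T\<close>
      of \<open>B\<close>.\<close>
    have \<gamma>: "\<phi>2 T * a2 + \<phi>1 T * a1 = \<gamma>" by (simp add: \<gamma>_def mult.commute)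
    show "\<exists>a1 a2 \<gamma>.
         (f1star \<phi>1 \<phi>1' \<phi>2 \<phi>2' f \<longlongrightarrow> a1) ?D \<and>
         (f2star \<phi>1 \<phi>1' \<phi>2 \<phi>2' f \<longlongrightarrow> a2) ?D \<and>
         (?S \<longlongrightarrow> \<gamma>) ?D \<and>
         \<gamma> = a1 * \<phi>1 T + a2 * \<phi>2 T \<and>
         (\<forall>b1 b2. P.coeffs_tendsto b1 b2 \<longrightarrow> b1 = a1 \<and> b2 = a2) \<and>
         (\<forall>b1 b2. P.coeffs_tendsto b1 b2 \<longrightarrow> b1 = a1 \<and> b2 = a2) \<and>
         (\<forall>b1 b2 Fb. loc_summable T x0 Fb \<and> Fb \<in> o[left_filter x0](\<lambda>_. 1) \<and>
                      rep_vi T x0 \<phi>1 \<phi>1' \<phi>2 \<phi>2' f b1 b2 Fb \<longrightarrow>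
             b1 = a1 \<and> b2 = a2 \<and> (AE t in lborel. t \<in> Ival T x0 \<longrightarrow> Fb t = ?S t - \<gamma>)) \<and>
         (\<forall>b1 b2 f2b. loc_summable T x0 f2b \<and> f2b \<in> o[left_filter x0](\<lambda>_. 1) \<and>
                      rep_vii T x0 \<phi>1 \<phi>1' \<phi>2 \<phi>2' f b1 b2 f2b \<longrightarrow>
             b1 = a1 \<and> b2 = a2 \<and>
             (AE t in lborel. t \<in> Ival T x0 \<longrightarrow> f2b t = f2star \<phi>1 \<phi>1' \<phi>2 \<phi>2' f t - a2)) \<and>
         (\<exists>J. (\<forall>x\<in>Ival T x0. improper_int_to
                  (\<lambda>t. dquot \<phi>2 \<phi>2' \<phi>1 \<phi>1' t * f2star \<phi>1 \<phi>1' \<phi>2 \<phi>2' f t) x x0 (J x)) \<and>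
              ((\<lambda>x. \<phi>1 x / \<phi>2 x * J x) \<longlongrightarrow> - a2) (left_filter x0)) \<and>
         (\<exists>K. (\<forall>x. T < x \<and> ereal x < x0 \<longrightarrow> improper_int_to
                  (\<lambda>t. Wr \<phi>1 \<phi>1' \<phi>2 \<phi>2' t / (PhiT T \<phi>1 \<phi>2 t)\<^sup>2 * ?S t) x x0 (K x)) \<and>
              ((\<lambda>x. PhiT T \<phi>1 \<phi>2 x / \<phi>2 x * K x) \<longlongrightarrow> - \<gamma> / \<phi>2 T) (left_filter x0)) \<and>
         rep_vii T x0 \<phi>1 \<phi>1' \<phi>2 \<phi>2' f a1 a2 (\<lambda>t. f2star \<phi>1 \<phi>1' \<phi>2 \<phi>2' f t - a2) \<and>
         rep_vi T x0 \<phi>1 \<phi>1' \<phi>2 \<phi>2' f a1 a2 (\<lambda>t. ?S t - \<gamma>)"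
      unfolding vi vii
    proof (rule exI[of _ a1], rule exI[of _ a2], rule exI[of _ \<gamma>], intro conjI allI impI)
      show "(f1star \<phi>1 \<phi>1' \<phi>2 \<phi>2' f \<longlongrightarrow> a1) ?D" "(f2star \<phi>1 \<phi>1' \<phi>2 \<phi>2' f \<longlongrightarrow> a2) ?D"
        using c by (auto simp: P.coeffs_tendsto_def)
      show "(?S \<longlongrightarrow> \<gamma>) ?D" using B.coeffs_imp_G_tendsto[OF c] unfolding BG \<gamma> .
      show "\<gamma> = a1 * \<phi>1 T + a2 * \<phi>2 T" by (rule \<gamma>_def)
      fix b1 b2 assume "P.coeffs_tendsto b1 b2"
      then show "b1 = a1" "b2 = a2" using P.coeffs_tendsto_unique[OF c] by blast+
    next
      fix b1 b2 assume "P.coeffs_tendsto b1 b2"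
      then show "b1 = a1" "b2 = a2" using P.coeffs_tendsto_unique[OF c] by blast+
    next
      fix b1 b2 F assume "loc_summable T x0 F \<and> F \<in> o[left_filter x0](\<lambda>_. 1) \<and> B.rep b1 b2 F"
      then have r: "loc_summable T x0 F" "F \<in> o[left_filter x0](\<lambda>_. 1)" "B.rep b1 b2 F" by auto
      have "b1 = a1 \<and> b2 = a2" using P.coeffs_tendsto_unique[OF c B.rep_imp(1)[OF r]] .
      then show "b1 = a1" "b2 = a2" by auto
      then show "AE t in lborel. t \<in> Ival T x0 \<longrightarrow> F t = ?S t - \<gamma>"
        using B.rep_imp(2)[OF r] unfolding BG by (simp add: \<gamma>)
    next
      fix b1 b2 F assume "loc_summable T x0 F \<and> F \<in> o[left_filter x0](\<lambda>_. 1) \<and> A.rep b1 b2 F"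
      then have r: "loc_summable T x0 F" "F \<in> o[left_filter x0](\<lambda>_. 1)" "A.rep b1 b2 F" by auto
      have "b1 = a1 \<and> b2 = a2" using P.coeffs_tendsto_unique[OF c A.rep_imp(1)[OF r]] .
      then show "b1 = a1" "b2 = a2" by auto
      then show "AE t in lborel. t \<in> Ival T x0 \<longrightarrow> F t = f2star \<phi>1 \<phi>1' \<phi>2 \<phi>2' f t - a2"
        using A.rep_imp(2)[OF r] unfolding AG by simp
    next
      \<comment> \<open>The integrand is the derivative of \<open>A.h\<close> almost everywhere, so
        the integral from \<open>x\<close> to \<open>x0\<close> is the limit of \<open>A.h\<close>
        minus \<open>A.h x\<close>. The next witness is the same expression for \<open>B\<close>,
        where the limit is \<open>a1 / \<phi>2 T\<close>.\<close>
      show "\<exists>J. (\<forall>x\<in>Ival T x0. improper_int_to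
                  (\<lambda>t. dquot \<phi>2 \<phi>2' \<phi>1 \<phi>1' t * f2star \<phi>1 \<phi>1' \<phi>2 \<phi>2' f t) x x0 (J x)) \<and>
              ((\<lambda>x. \<phi>1 x / \<phi>2 x * J x) \<longlongrightarrow> - a2) (left_filter x0)"
        using A.coeffs_imp_weighted_limit[OF c] unfolding AG Arho Apsi
        by (intro exI[of _ "\<lambda>x. a1 / 1 - A.h x"]) simp
      show "\<exists>K. (\<forall>x. T < x \<and> ereal x < x0 \<longrightarrow> improper_int_to
                  (\<lambda>t. Wr \<phi>1 \<phi>1' \<phi>2 \<phi>2' t / (PhiT T \<phi>1 \<phi>2 t)\<^sup>2 * ?S t) x x0 (K x)) \<and>
              ((\<lambda>x. PhiT T \<phi>1 \<phi>2 x / \<phi>2 x * K x) \<longlongrightarrow> - \<gamma> / \<phi>2 T) (left_filter x0)"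
        using B.coeffs_imp_weighted_limit[OF c] unfolding BG Brho Bpsi \<gamma> J_def
        by (intro exI[of _ "\<lambda>x. a1 / \<phi>2 T - B.h x"]) simp
      show "A.rep a1 a2 (\<lambda>t. f2star \<phi>1 \<phi>1' \<phi>2 \<phi>2' f t - a2)"
        using A.coeffs_imp_rep[OF c] unfolding AG by simp
      show "B.rep a1 a2 (\<lambda>t. ?S t - \<gamma>)"
        using B.coeffs_imp_rep[OF c] unfolding BG \<gamma> .
    qed
  qed
qed

end
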